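(* Let $X$ be a quasi-Banach rearrangement invariant space on $\mathbb{R}$ with Boyd indices $p_X,q_X$. The Hilbert transform is bounded on $X$ (i.e. there is $C$ with $\|\mathcal{H}f\|_X\le C\|f\|_X$ for all bounded measurable $f$ with support of finite measure) if and only if $p_X>1$ and $q_X<\infty$.
   Context: The Hilbert transform is $\mathcal{H}f(x)=\frac1\pi\,\mathrm{P.V.}\int_{-\infty}^\infty \frac{f(y)}{x-y}\,dy$. For measurable $f$, $f^*(s)=\sup\{t:\text{measure}\{|f|>t\}>s\}$. A rearrangement invariant (r.i.) space $X$ on $\mathbb{R}$ is a set of measurable functions (modulo a.e. equality) with a complete quasi-norm $\|\cdot\|_X$ such that: (1) if $g^*\le f^*$ and $f\in X$ then $g\in X$ and $\|g\|_X\le\|f\|_X$; (2) every simple function with support of finite measure is in $X$; (3) either $f_n\searrow 0$ implies $\|f_n\|_X\searrow 0$, or $0\le f_n\nearrow f$ with $\sup_n\|f_n\|_X<\infty$ implies $f\in X$ and $\|f\|_X=\sup_n\|f_n\|_X$. With $D_af(t)=f(at)$, the lower Boyd index is $p_X=\sup\{p:\exists c\ \forall a<1\ \forall f\in X,\ \|D_af\|_X\le c\,a^{-1/p}\|f\|_X\}$ and the upper Boyd index is $q_X=\inf\{q:\exists c\ \forall a>1\ \forall f\in X,\ \|D_af\|_X\le c\,a^{-1/q}\|f\|_X\}$. *)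

theory Defs
  imports "HOL-Analysis.Analysis"
begin

definition rearr :: "(real \<Rightarrow> real) \<Rightarrow> real \<Rightarrow> ereal" where
  "rearr f s = Sup {ereal t | t. ennreal s < emeasure lebesgue {x. t < \<bar>f x\<bar>}}"

definition dil :: "real \<Rightarrow> (real \<Rightarrow> real) \<Rightarrow> (real \<Rightarrow> real)" where
  "dil a f = (\<lambda>t. f (a * t))"

text \<open>A quasi-Banach rearrangement invariant space: a set X of Lebesgue measurable
functions together with a complete quasi-norm N satisfying (1)-(3).
(Elements are functions; a.e.-equal functions have the same rearrangement, so by (1)
X is closed under a.e. modification and N is a.e.-invariant.)\<close>

definition ri_space :: "(real \<Rightarrow> real) set \<Rightarrow> ((real \<Rightarrow> real) \<Rightarrow> real) \<Rightarrow> bool" where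
  "ri_space X N \<longleftrightarrow>
     X \<subseteq> borel_measurable lebesgue \<and>
     \<comment> \<open>quasi-norm\<close>
     (\<forall>f\<in>X. 0 \<le> N f) \<and>
     (\<forall>f\<in>X. N f = 0 \<longleftrightarrow> (AE x in lebesgue. f x = 0)) \<and>
     (\<forall>f\<in>X. \<forall>c::real. (\<lambda>x. c * f x) \<in> X \<and> N (\<lambda>x. c * f x) = \<bar>c\<bar> * N f) \<and>
     (\<exists>K\<ge>1. \<forall>f\<in>X. \<forall>g\<in>X. (\<lambda>x. f x + g x) \<in> X \<and> N (\<lambda>x. f x + g x) \<le> K * (N f + N g)) \<and>
     \<comment> \<open>completeness\<close>
     (\<forall>u :: nat \<Rightarrow> real \<Rightarrow> real. (\<forall>n. u n \<in> X) \<and>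
        (\<forall>e>0. \<exists>M. \<forall>m\<ge>M. \<forall>n\<ge>M. N (\<lambda>x. u m x - u n x) < e) \<longrightarrow>
        (\<exists>f\<in>X. (\<lambda>n. N (\<lambda>x. u n x - f x)) \<longlonglongrightarrow> 0)) \<and>
     \<comment> \<open>(1) rearrangement invariance / lattice property\<close>
     (\<forall>f\<in>X. \<forall>g\<in>borel_measurable lebesgue.
        (\<forall>s\<ge>0. rearr g s \<le> rearr f s) \<longrightarrow> g \<in> X \<and> N g \<le> N f) \<and>
     \<comment> \<open>(2) simple functions with support of finite measure\<close>
     (\<forall>g\<in>borel_measurable lebesgue. finite (range g) \<and>
        emeasure lebesgue {x. g x \<noteq> 0} < \<infinity> \<longrightarrow> g \<in> X) \<and>
     \<comment> \<open>(3) order continuity or Fatou property\<close>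
     ((\<forall>u :: nat \<Rightarrow> real \<Rightarrow> real. (\<forall>n. u n \<in> X) \<and>
          (AE x in lebesgue. (\<forall>n. 0 \<le> u (Suc n) x \<and> u (Suc n) x \<le> u n x) \<and>
                             (\<lambda>n. u n x) \<longlonglongrightarrow> 0)
        \<longrightarrow> (\<lambda>n. N (u n)) \<longlonglongrightarrow> 0)
      \<or>
      (\<forall>(u :: nat \<Rightarrow> real \<Rightarrow> real) (f :: real \<Rightarrow> real).
          (\<forall>n. u n \<in> X) \<and> f \<in> borel_measurable lebesgue \<and>
          (AE x in lebesgue. (\<forall>n. 0 \<le> u n x \<and> u n x \<le> u (Suc n) x) \<and>
                             (\<lambda>n. u n x) \<longlonglongrightarrow> f x) \<and>
          bdd_above (range (\<lambda>n. N (u n)))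
        \<longrightarrow> f \<in> X \<and> N f = (SUP n. N (u n))))"

text \<open>Lower and upper Boyd indices (exponents p, q range over positive reals;
the value is taken in the extended reals, Sup of the empty set being -\<infinity>
and Inf of the empty set \<infinity>).\<close>

definition boyd_lower :: "(real \<Rightarrow> real) set \<Rightarrow> ((real \<Rightarrow> real) \<Rightarrow> real) \<Rightarrow> ereal" where
  "boyd_lower X N = Sup {ereal p | p. 0 < p \<and>
     (\<exists>c. \<forall>a. 0 < a \<and> a < 1 \<longrightarrow>
        (\<forall>f\<in>X. dil a f \<in> X \<and> N (dil a f) \<le> c * a powr (-1/p) * N f))}"

definition boyd_upper :: "(real \<Rightarrow> real) set \<Rightarrow> ((real \<Rightarrow> real) \<Rightarrow> real) \<Rightarrow> ereal" where
  "boyd_upper X N = Inf {ereal q | q. 0 < q \<and>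
     (\<exists>c. \<forall>a. 1 < a \<longrightarrow>
        (\<forall>f\<in>X. dil a f \<in> X \<and> N (dil a f) \<le> c * a powr (-1/q) * N f))}"

definition hilbert_trunc :: "(real \<Rightarrow> real) \<Rightarrow> real \<Rightarrow> real \<Rightarrow> real" where
  "hilbert_trunc f \<epsilon> x =
     (1 / pi) * (LINT y|lebesgue. indicator {y. \<epsilon> < \<bar>x - y\<bar>} y * f y / (x - y))"

definition hilbert :: "(real \<Rightarrow> real) \<Rightarrow> real \<Rightarrow> real" where
  "hilbert f x = Lim (at_right 0) (\<lambda>\<epsilon>. hilbert_trunc f \<epsilon> x)"

definition hilbert_bounded_on :: "(real \<Rightarrow> real) set \<Rightarrow> ((real \<Rightarrow> real) \<Rightarrow> real) \<Rightarrow> bool" where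
  "hilbert_bounded_on X N \<longleftrightarrow>
     (\<exists>C. \<forall>f. f \<in> borel_measurable lebesgue \<and> bounded (range f) \<and>
              emeasure lebesgue {x. f x \<noteq> 0} < \<infinity> \<longrightarrow>
              hilbert f \<in> X \<and> N (hilbert f) \<le> C * N f)"

end

theory Submission
  imports Defs "HOL-Complex_Analysis.Complex_Analysis" "HOL-Probability.Sinc_Integral"
begin

text \<open>Sufficiency. Let \<open>u\<close> and \<open>v\<close> be the Poisson and conjugate Poisson integrals at height \<open>e\<close> of a function with
  values in \<open>[0,1]\<close>. Then \<open>v - \<i> u\<close> is analytic in the upper half plane, and Cauchy's theorem for
  \<open>cosh (v - \<i> u) - 1\<close> bounds the integral of \<open>cosh v - 1\<close> by the mass of the function, uniformly in \<open>e\<close>. Hence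
  the average of \<open>\<bar>v\<bar>\<close> over a set \<open>A\<close> grows only logarithmically in \<open>\<bar>E\<bar> / \<bar>A\<bar>\<close> for the indicator of \<open>E\<close>;
  antisymmetry of the kernel gives a bound of order \<open>\<bar>E\<bar> / \<bar>A\<bar>\<close>, up to a logarithm, when \<open>\<bar>E\<bar> \<le> \<bar>A\<bar>\<close>. By the layer
  cake formula the rearrangement of the Hilbert transform of \<open>f\<close> is dominated by a weighted series of dilations
  \<open>t \<mapsto> f\<^sup>*(r\<^sup>k t)\<close>, \<open>k \<in> \<int>\<close>, and the conditions on the Boyd indices make this series converge in \<open>X\<close> once \<open>r\<close>
  is large compared with the constant of the quasi-norm. Principal values exist almost everywhere because the
  functions \<open>v\<close> converge in \<open>L\<^sup>2\<close> as \<open>e \<rightarrow> 0\<close> and are the Poisson integrals of their limit, so that they converge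
  at its Lebesgue points.

  Necessity. For decreasing \<open>F \<ge> 0\<close> on \<open>(0,\<infinity>)\<close> the values of the Hilbert transform on the negative half line are
  a Stieltjes transform, which dominates \<open>ln b * F (b x)\<close> for \<open>b > 1\<close> and, after a second application,
  \<open>a * ln (1 / a) * F (a x)\<close> for \<open>a < 1\<close>. So at some scale the dilation operators beat their trivial norm bounds,
  and iteration turns this into a power gain.\<close>

subsection \<open>Cauchy integrals over horizontal lines\<close>

text \<open>In a quasi-normed space neither a dual pairing nor a countable triangle inequality is at
  hand, so the argument compares rearrangements and sums dilations geometrically, each term paying a
  power of \<open>K\<close>. The function \<open>cosh\<close> is chosen because its linear Taylor
  term vanishes: the Cauchy transform decays only like the inverse of \<open>norm z\<close>, but
  \<open>cosh W - 1\<close> decays quadratically, so a large arc contributes nothing. The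
  logarithmic estimate alone is too weak: when \<open>E\<close> is small it stays of the order of
  the measure of \<open>A\<close>. Antisymmetry supplies the missing decay. After division by the
  measure of \<open>A\<close> it leaves the weight \<open>(n + 1) / r ^ n\<close> in front of the
  dilation by \<open>1 / r ^ n\<close>, whose norm grows at most like \<open>r ^ (n / p)\<close>;
  this is where \<open>p > 1\<close> is decisive, while a finite \<open>q\<close> makes the
  dilations by \<open>r ^ n\<close> decay. In the converse direction \<open>p = 1\<close>
  corresponds to growth of order \<open>1 / a\<close>, and \<open>q = \<infinity>\<close> to no
  decay at all. A logarithmic gain over these borderline rates at one single scale is therefore
  enough.\<close>

lemma half_plane_line_integral_tendsto_0:
  fixes G :: "complex \<Rightarrow> complex"
  assumes hol: "G holomorphic_on {z. Im z > 0}" and e: "e > 0" and C: "C \<ge> 0"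
    and bd: "\<And>z. Im z > 0 \<Longrightarrow> norm z \<ge> R0 \<Longrightarrow> norm (G z) \<le> C / (norm z)^2"
  shows "(\<lambda>n. integral {-real n..real n} (\<lambda>x. G (Complex x e))) \<longlonglongrightarrow> 0"
proof (rule Lim_null_comparison)
  show "\<forall>\<^sub>F n in sequentially. norm (integral {-real n..real n} (\<lambda>x. G (Complex x e))) \<le> C * pi / real n"
  proof (rule eventually_mono[OF eventually_ge_at_top[of "nat \<lceil>max R0 1\<rceil>"]])
    fix n assume "nat \<lceil>max R0 1\<rceil> \<le> n"
    then have n: "real n \<ge> R0" "real n \<ge> 1" by linarith+
    \<comment> \<open>Shifting by \<open>\<i> * e\<close> moves the line to the real axis, where the
      segment \<open>l\<close> and the upper half circle \<open>p\<close> close up inside the convex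
      half plane \<open>S\<close>.\<close>
    define H where "H = (\<lambda>z. G (z + \<i> * e))"
    define S where "S = {z. Im z > - e}"
    define l where "l = linepath (complex_of_real (- real n)) (complex_of_real (real n))"
    define p where "p = part_circlepath 0 (real n) 0 pi"
    have holH: "H holomorphic_on S"
      unfolding H_def S_def
      by (intro holomorphic_on_compose_gen[OF _ hol, unfolded o_def] holomorphic_intros) auto
    have ends: "pathstart p = of_real (real n)" "pathfinish p = of_real (- real n)"
      by (auto simp: p_def exp_eq_polar complex_eq_iff)
    have pim: "Im z \<ge> 0 \<and> norm z = real n" if z: "z \<in> path_image p" for z
    proof -
      obtain t where t: "0 \<le> t" "t \<le> pi" "z = real n * exp (\<i> * t)"
        using z unfolding p_def path_image_part_circlepath'[of 0 "real n" 0 pi]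
        by (auto simp: closed_segment_eq_real_ivl cis_conv_exp)
      have "sin t \<ge> 0" using t sin_ge_zero by auto
      then show ?thesis using t by (auto simp: exp_eq_polar norm_mult)
    qed
    have conv: "convex S" unfolding S_def by (rule convex_halfspace_Im_gt)
    have lS: "path_image l \<subseteq> S"
      unfolding l_def path_image_linepath
      by (intro closed_segment_subset conv) (use e in \<open>auto simp: S_def\<close>)
    have pS: "path_image p \<subseteq> S"
      using pim e by (force simp: S_def)
    have "(H has_contour_integral 0) (l +++ p)"
      using lS pS ends
      by (intro Cauchy_theorem_convex_simple[OF holH conv])
        (auto simp: l_def p_def path_image_join intro!: valid_path_join)
    moreover have "H contour_integrable_on l" 
      unfolding l_def using lS l_def
      by (intro contour_integrable_continuous_linepath continuous_on_subset[OF holomorphic_on_imp_continuous_on[OF holH]]) auto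
    moreover have cp: "H contour_integrable_on p" 
      unfolding p_def using pS p_def
      by (intro contour_integrable_continuous_part_circlepath continuous_on_subset[OF holomorphic_on_imp_continuous_on[OF holH]]) auto
    ultimately have sum0: "contour_integral l H + contour_integral p H = 0"
      by (metis contour_integral_unique contour_integral_join ends(1) l_def p_def pathfinish_linepath valid_path_linepath valid_path_part_circlepath)
    have "norm (contour_integral p H) \<le> C / (real n)^2 * real n * \<bar>pi - 0\<bar>"
      unfolding p_def
    proof (rule contour_integral_bound_part_circlepath)
      show "H contour_integrable_on part_circlepath 0 (real n) 0 pi" using cp p_def by simp
      fix z assume "z \<in> path_image (part_circlepath 0 (real n) 0 pi)"
      then have z: "Im z \<ge> 0" "norm z = real n" using pim p_def by auto
      \<comment> \<open>Moving a point of the upper half plane upwards does not decrease its norm,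
        so the decay hypothesis applies on the shifted arc with radius \<open>n\<close>.\<close>
      have "(norm z)^2 \<le> (norm (z + \<i> * e))^2"
        using z(1) e by (auto simp: cmod_power2 intro!: power_mono)
      then have zn: "real n \<le> norm (z + \<i> * e)" using z(2) by (metis norm_ge_zero power2_le_imp_le)
      then have "norm (H z) \<le> C / (norm (z + \<i> * e))^2" using bd[of "z + \<i> * e"] n z e by (auto simp: H_def)
      also have "\<dots> \<le> C / (real n)^2" using zn n C 
        by (intro divide_left_mono power_mono mult_pos_pos zero_less_power) auto
      finally show "norm (H z) \<le> C / (real n)^2" .
    qed (use C in auto)
    also have "\<dots> = C * pi / real n" using n by (simp add: power2_eq_square)
    finally have pb: "norm (contour_integral p H) \<le> C * pi / real n" .
    have "contour_integral l H = integral {-real n..real n} (\<lambda>x. H (of_real x))"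
      unfolding l_def using n by (subst contour_integral_linepath_Reals_eq) auto
    then have "integral {-real n..real n} (\<lambda>x. G (Complex x e)) = contour_integral l H"
      by (auto simp: H_def Complex_eq)
    then show "norm (integral {-real n..real n} (\<lambda>x. G (Complex x e))) \<le> C * pi / real n"
      using sum0 pb by (metis add_eq_0_iff2 norm_minus_cancel)
  qed
  show "(\<lambda>n. C * pi / real n) \<longlonglongrightarrow> 0" by real_asymp
qed

section \<open>Cauchy kernels, Poisson kernels and their convolutions\<close>

definition poisson :: "real \<Rightarrow> real \<Rightarrow> real" where
  "poisson e x = e / (pi * (x^2 + e^2))"

text \<open>Signs and normalisation are those of \<open>1 / (pi * (x + \<i> * e)) = conj_poisson e x
  - \<i> * poisson e x\<close>. Thus \<open>conj_poisson e\<close> is a regularisation of the kernel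
  \<open>1 / (pi * x)\<close> of the Hilbert transform.\<close>

definition conj_poisson :: "real \<Rightarrow> real \<Rightarrow> real" where
  "conj_poisson e x = x / (pi * (x^2 + e^2))"

lemma has_bochner_integral_inverse_1_plus_square:
  "has_bochner_integral lborel (\<lambda>x::real. inverse (1 + x^2)) pi"
  using integrable_inverse_1_plus_square LBINT_inverse_1_plus_square
  by (simp add: has_bochner_integral_iff set_integrable_def interval_lebesgue_integral_def set_lebesgue_integral_def)

lemma has_bochner_integral_poisson:
  assumes "e > 0"
  shows "has_bochner_integral lborel (\<lambda>y. poisson e (x - y)) 1"
proof -
  have "has_bochner_integral lborel (\<lambda>y. (1/(e*pi)) * inverse (1 + (x / e + (-1/e) * y)^2)) ((1/(e*pi)) * (pi /\<^sub>R \<bar>-1/e\<bar>))"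
    using assms
    by (intro has_bochner_integral_mult_right lborel_has_bochner_integral_real_affine_iff[THEN iffD1] has_bochner_integral_inverse_1_plus_square)
      (auto intro: has_bochner_integral_inverse_1_plus_square)
  also have "(\<lambda>y. (1/(e*pi)) * inverse (1 + (x / e + (-1/e) * y)^2)) = (\<lambda>y. poisson e (x - y))"
  proof
    fix y
    have "(x / e + (-1/e) * y) = (x - y) / e" using assms by (simp add: field_simps)
    then have "1 + (x / e + (-1/e) * y)^2 = (e^2 + (x-y)^2) / e^2"
      using assms by (simp add: field_simps power2_eq_square)
    then show "(1/(e*pi)) * inverse (1 + (x / e + (-1/e) * y)^2) = poisson e (x - y)"
      using assms by (simp add: poisson_def field_simps power2_eq_square)
  qed
  finally show ?thesis using assms by simp
qed

lemma eventually_mem_Icc: "eventually (\<lambda>n. x \<in> {-real n..real n}) sequentially"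
  by (rule eventually_mono[OF eventually_ge_at_top[of "nat \<lceil>\<bar>x\<bar>\<rceil>"]]) (auto simp: abs_le_iff)

lemma integral_Icc_eq_lborel:
  fixes h :: "real \<Rightarrow> 'a::euclidean_space"
  assumes "integrable lborel (\<lambda>x. indicator {a..b} x *\<^sub>R h x)"
  shows "integral {a..b} h = (LINT x|lborel. indicator {a..b} x *\<^sub>R h x)"
  using set_borel_integral_eq_integral(2)[of "{a..b}" h] assms
  by (simp add: set_lebesgue_integral_def set_integrable_def)

lemma integral_tendsto_lborel:
  fixes h :: "real \<Rightarrow> 'a::euclidean_space"
  assumes "integrable lborel h"
  shows "(\<lambda>n. integral {-real n..real n} h) \<longlonglongrightarrow> (LINT x|lborel. h x)"
proof -
  have "(\<lambda>n. LINT x|lborel. indicator {-real n..real n} x *\<^sub>R h x) \<longlonglongrightarrow> (LINT x|lborel. h x)"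
  proof (rule integral_dominated_convergence[where w="\<lambda>x. norm (h x)"])
    have "(\<lambda>n. indicator {- real n..real n} x *\<^sub>R h x) \<longlonglongrightarrow> h x" for x
      by (rule tendsto_eventually, rule eventually_mono[OF eventually_mem_Icc[of x]]) simp
    then show "AE x in lborel. (\<lambda>n. indicator {- real n..real n} x *\<^sub>R h x) \<longlonglongrightarrow> h x" by simp
  qed (use assms in \<open>auto simp: indicator_def\<close>)
  moreover have "(LINT x|lborel. indicator {-real n..real n} x *\<^sub>R h x) = integral {-real n..real n} h" for n
    using integral_Icc_eq_lborel[OF integrable_mult_indicator[OF _ assms]] by simp
  ultimately show ?thesis by simp
qed

lemma integrable_inverse_norm_square:
  assumes "Im a \<noteq> 0"
  shows "integrable lborel (\<lambda>x. 1 / (norm (of_real x - a))^2)"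
proof -
  have "integrable lborel (\<lambda>y. (pi / \<bar>Im a\<bar>) * poisson \<bar>Im a\<bar> (Re a - y))"
    using has_bochner_integral_poisson[of "\<bar>Im a\<bar>" "Re a"] assms
    by (intro integrable_mult_right) (auto simp: has_bochner_integral_iff)
  also have "(\<lambda>y. (pi / \<bar>Im a\<bar>) * poisson \<bar>Im a\<bar> (Re a - y)) = (\<lambda>x. 1 / (norm (of_real x - a))^2)"
    using assms by (auto simp: poisson_def cmod_power2 fun_eq_iff power2_commute)
  finally show ?thesis .
qed

lemma measurable_cauchy_kernel [measurable]:
  "(\<lambda>x. 1 / ((complex_of_real x - a) * (of_real x - b))) \<in> borel_measurable borel"
  by measurable

lemma integrable_cauchy_kernel:
  assumes "Im a \<noteq> 0" "Im b \<noteq> 0"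
  shows "integrable lborel (\<lambda>x. 1 / ((of_real x - a) * (of_real x - b)))"
proof (rule Bochner_Integration.integrable_bound)
  show "integrable lborel (\<lambda>x. 1 / (norm (of_real x - a))^2 + 1 / (norm (of_real x - b))^2)"
    using assms by (intro Bochner_Integration.integrable_add integrable_inverse_norm_square)
  have "norm (1 / ((of_real x - a) * (of_real x - b))) \<le> norm (1 / (norm (of_real x - a))^2 + 1 / (norm (of_real x - b))^2)" for x
  proof -
    have "p * q \<le> p^2 + q^2" if "p \<ge> 0" "q \<ge> 0" for p q :: real
      using sum_squares_bound[of p q] mult_nonneg_nonneg[OF that] by linarith
    from this[of "1 / norm (of_real x - a)" "1 / norm (of_real x - b)"]
    have "(1 / norm (of_real x - a)) * (1 / norm (of_real x - b)) \<le> (1 / norm (of_real x - a))^2 + (1 / norm (of_real x - b))^2"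
      by simp
    then show ?thesis by (simp add: norm_divide norm_mult power_divide)
  qed
  then show "AE x in lborel. norm (1 / ((of_real x - a) * (of_real x - b))) \<le> norm (1 / (norm (of_real x - a))^2 + 1 / (norm (of_real x - b))^2)"
    by simp
qed measurable

text \<open>With both poles below the axis the integrand is holomorphic above it and decays
  quadratically, so the contour can be closed there.\<close>

lemma integral_cauchy_kernel_same_side:
  assumes a: "Im a < 0" and b: "Im b < 0"
  shows "(LINT x|lborel. 1 / ((of_real x - a) * (of_real x - b))) = 0"
proof -
  \<comment> \<open>The contour lemma integrates at a positive height. Raising both poles by half
    the smaller distance to the axis creates this height and keeps them below the axis.\<close>
  define e where "e = min (- Im a) (- Im b) / 2"
  define c where "c = a + \<i> * e"
  define d where "d = b + \<i> * e"
  define G where "G = (\<lambda>z. 1 / ((z - c) * (z - d)))"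
  have e: "e > 0" and cd: "Im c < 0" "Im d < 0" using a b by (auto simp: e_def c_def d_def min_def)
  have "(\<lambda>n. integral {-real n..real n} (\<lambda>x. G (Complex x e))) \<longlonglongrightarrow> 0"
  \<comment> \<open>Beyond this radius each factor of the denominator is at least
    \<open>norm z / 2\<close>, which gives the constant 4.\<close>
  proof (rule half_plane_line_integral_tendsto_0[where C=4 and ?R0.0="2 * (norm c + norm d + 1)"])
    show "G holomorphic_on {z. 0 < Im z}"
      using cd unfolding G_def by (auto intro!: holomorphic_intros)
    fix z assume z: "Im z > 0" "2 * (norm c + norm d + 1) \<le> norm z"
    have h: "norm z / 2 \<le> norm (z - c)" "norm z / 2 \<le> norm (z - d)"
      using norm_triangle_ineq2[of z c] norm_triangle_ineq2[of z d] z norm_ge_zero[of c] norm_ge_zero[of d]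
      by (smt (verit) field_sum_of_halves)+
    from h have "(norm z / 2) * (norm z / 2) \<le> norm (z - c) * norm (z - d)"
      by (intro mult_mono) auto
    moreover have "norm z > 0" using z by auto
    moreover have "norm (z - c) > 0" "norm (z - d) > 0" using h \<open>norm z > 0\<close> by linarith+
    ultimately have "1 / (norm (z - c) * norm (z - d)) \<le> 1 / ((norm z / 2) * (norm z / 2))"
      by (intro divide_left_mono mult_pos_pos) auto
    then show "norm (G z) \<le> 4 / (norm z)^2"
      by (simp add: G_def norm_divide norm_mult power2_eq_square)
  qed (use e in auto)
  moreover have "G (Complex x e) = 1 / ((of_real x - a) * (of_real x - b))" for x
    by (simp add: G_def c_def d_def Complex_eq)
  ultimately have "(\<lambda>n. integral {-real n..real n} (\<lambda>x. 1 / ((of_real x - a) * (of_real x - b)))) \<longlonglongrightarrow> 0"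
    by simp
  moreover have "(\<lambda>n. integral {-real n..real n} (\<lambda>x. 1 / ((of_real x - a) * (of_real x - b)))) \<longlonglongrightarrow>
     (LINT x|lborel. 1 / ((of_real x - a) * (of_real x - b)))"
    using a b by (intro integral_tendsto_lborel integrable_cauchy_kernel) auto
  ultimately have "0 = (LINT x|lborel. 1 / ((of_real x - a) * (of_real x - b)))" by (rule LIMSEQ_unique)
  then show ?thesis by (rule sym)
qed

lemma poisson_eq_cauchy:
  assumes "e \<noteq> 0"
  shows "of_real (poisson e (x - y)) = 1 / (2 * pi * \<i>) * (1 / (of_real y - Complex x e) - 1 / (of_real y - Complex x (-e)))"
proof -
  have n: "of_real y - Complex x e \<noteq> 0" "of_real y - Complex x (-e) \<noteq> 0" using assms by (auto simp: complex_eq_iff)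
  have "(of_real y - Complex x e) * (of_real y - Complex x (-e)) = of_real ((x-y)^2 + e^2)"
    by (simp add: complex_eq_iff power2_eq_square algebra_simps)
  moreover have "1 / (of_real y - Complex x e) - 1 / (of_real y - Complex x (-e)) = 
      (Complex x e - Complex x (-e)) / ((of_real y - Complex x e) * (of_real y - Complex x (-e)))"
    using n by (simp add: field_simps)
  moreover have "Complex x e - Complex x (-e) = 2 * \<i> * e" by (simp add: complex_eq_iff)
  ultimately show ?thesis by (simp add: poisson_def)
qed

text \<open>No residue is computed. Replacing the pole \<open>b\<close> by \<open>cnj b\<close>
  gives a kernel with integral 0, and by partial fractions the correction is
  \<open>2 * pi * \<i>\<close> times a Poisson kernel, of total mass 1, divided by
  \<open>b - a\<close>.\<close>

lemma integral_cauchy_kernel_opposite_sides: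
  assumes a: "Im a < 0" and b: "Im b > 0"
  shows "(LINT x|lborel. 1 / ((of_real x - a) * (of_real x - b))) = 2 * pi * \<i> / (b - a)"
proof -
  define k where "k = (\<lambda>x::real. 1 / ((of_real x - a) * (of_real x - cnj b)))"
  have k: "integrable lborel k" "(LINT x|lborel. k x) = 0"
    using a b integrable_cauchy_kernel[of a "cnj b"] integral_cauchy_kernel_same_side[of a "cnj b"] by (auto simp: k_def)
  define h where "h = (\<lambda>x::real. complex_of_real (poisson (Im b) (Re b - x)))"
  have h: "integrable lborel h" "(LINT x|lborel. h x) = 1"
    using has_bochner_integral_poisson[of "Im b" "Re b"] b by (auto simp: h_def has_bochner_integral_iff)
  have bb: "Complex (Re b) (Im b) = b" "Complex (Re b) (- Im b) = cnj b" by (auto simp: complex_eq_iff)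
  have ba: "b - a \<noteq> 0" using a b by auto
  have "1 / ((of_real x - a) * (of_real x - b)) = (2 * pi * \<i> * h x + (cnj b - a) * k x) / (b - a)" for x :: real
  proof -
    have "of_real x - a \<noteq> 0" "of_real x - b \<noteq> 0" "of_real x - cnj b \<noteq> 0" using a b by (auto simp: complex_eq_iff)
    then show ?thesis using ba b unfolding h_def k_def 
      by (subst poisson_eq_cauchy) (auto simp: bb, simp add: divide_simps, simp add: algebra_simps)
  qed
  then have "(LINT x|lborel. 1 / ((of_real x - a) * (of_real x - b))) = (LINT x|lborel. (2 * pi * \<i> * h x + (cnj b - a) * k x) / (b - a))"
    by simp
  also have "\<dots> = 2 * pi * \<i> / (b - a)" using h k by simp
  finally show ?thesis .
qed

lemma conj_poisson_eq_Re: "e \<noteq> 0 \<Longrightarrow> conj_poisson e x = Re (1 / Complex x e) / pi"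
  by (simp add: conj_poisson_def Re_divide power2_eq_square)

text \<open>The semigroup law of harmonic extension. The Poisson kernel is a difference of Cauchy
  kernels with poles at \<open>x + \<i> * e\<close> and \<open>x - \<i> * e\<close>; against the
  Cauchy kernel with pole \<open>a\<close> below the axis only the first one survives.\<close>

lemma poisson_convolution_conj_poisson:
  assumes "e > 0" "d > 0"
  shows "has_bochner_integral lborel (\<lambda>y. poisson e (x - y) * conj_poisson d (y - z)) (conj_poisson (e + d) (x - z))"
proof -
  define a where "a = Complex z (-d)"
  define A where "A = (\<lambda>w y. 1 / ((complex_of_real y - a) * (of_real y - w)))"
  have I: "has_bochner_integral lborel (A (Complex x e)) (2 * pi * \<i> / (Complex x e - a))"
    "has_bochner_integral lborel (A (Complex x (-e))) 0"
    using integrable_cauchy_kernel[of a "Complex x e"] integral_cauchy_kernel_opposite_sides[of a "Complex x e"]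
     integrable_cauchy_kernel[of a "Complex x (-e)"] integral_cauchy_kernel_same_side[of a "Complex x (-e)"] assms
    by (auto simp: A_def a_def has_bochner_integral_iff)
  have "has_bochner_integral lborel (\<lambda>y. Re (1 / (2 * pi * \<i>) * (A (Complex x e) y - A (Complex x (-e)) y)) / pi) 
     (Re (1 / (2 * pi * \<i>) * (2 * pi * \<i> / (Complex x e - a) - 0)) / pi)"
    by (intro has_bochner_integral_divide_zero has_bochner_integral_Re has_bochner_integral_mult_right has_bochner_integral_diff I)
  also have "(\<lambda>y. Re (1 / (2 * pi * \<i>) * (A (Complex x e) y - A (Complex x (-e)) y)) / pi) = (\<lambda>y. poisson e (x - y) * conj_poisson d (y - z))"
  proof
    fix y
    have c: "Complex (y - z) d = of_real y - a" by (simp add: a_def complex_eq_iff)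
    have "Re (of_real (poisson e (x - y)) * (1 / (of_real y - a))) / pi = poisson e (x - y) * conj_poisson d (y - z)"
    proof -
      have "Re (of_real (poisson e (x - y)) * w) / pi = poisson e (x - y) * (Re w / pi)" for w by simp
      then show ?thesis using assms by (simp only: conj_poisson_eq_Re[of d] c)
    qed
    moreover have "of_real (poisson e (x - y)) * (1 / (of_real y - a)) = 1 / (2 * pi * \<i>) * (A (Complex x e) y - A (Complex x (-e)) y)"
      using assms by (subst poisson_eq_cauchy) (auto simp: A_def algebra_simps)
    ultimately show "Re (1 / (2 * pi * \<i>) * (A (Complex x e) y - A (Complex x (-e)) y)) / pi = poisson e (x - y) * conj_poisson d (y - z)" by simp
  qed
  also have "Re (1 / (2 * pi * \<i>) * (2 * pi * \<i> / (Complex x e - a) - 0)) / pi = conj_poisson (e + d) (x - z)"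
  proof -
    have "Complex x e - a = Complex (x - z) (e + d)" by (simp add: a_def complex_eq_iff)
    then show ?thesis using assms by (simp add: conj_poisson_eq_Re)
  qed
  finally show ?thesis .
qed

text \<open>This identity carries the \<open>L\<^sup>2\<close> isometry of the Hilbert transform:
  pairing two conjugate kernels gives a Poisson kernel, without any Fourier transform.\<close>

lemma conj_poisson_convolution:
  assumes "e > 0" "d > 0"
  shows "has_bochner_integral lborel (\<lambda>x. conj_poisson e (x - y) * conj_poisson d (x - z)) (poisson (e + d) (y - z))"
proof -
  define a where "a = Complex y (-e)"
  define A where "A = (\<lambda>w x. 1 / ((complex_of_real x - a) * (of_real x - w)))"
  have I: "has_bochner_integral lborel (A (Complex z d)) (2 * pi * \<i> / (Complex z d - a))"
    "has_bochner_integral lborel (A (Complex z (-d))) 0"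
    using integrable_cauchy_kernel[of a "Complex z d"] integral_cauchy_kernel_opposite_sides[of a "Complex z d"]
     integrable_cauchy_kernel[of a "Complex z (-d)"] integral_cauchy_kernel_same_side[of a "Complex z (-d)"] assms
    by (auto simp: A_def a_def has_bochner_integral_iff)
  have "has_bochner_integral lborel (\<lambda>x. Re (A (Complex z d) x + A (Complex z (-d)) x) / (2 * pi^2)) 
     (Re (2 * pi * \<i> / (Complex z d - a) + 0) / (2 * pi^2))"
    by (intro has_bochner_integral_divide_zero has_bochner_integral_Re has_bochner_integral_add I)
  also have "(\<lambda>x. Re (A (Complex z d) x + A (Complex z (-d)) x) / (2 * pi^2)) = (\<lambda>x. conj_poisson e (x - y) * conj_poisson d (x - z))"
  proof
    fix x
    define P where "P = 1 / (complex_of_real x - a)"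
    define Q where "Q = 1 / (complex_of_real x - Complex z (-d))"
    have c: "Complex (x - y) e = of_real x - a" "Complex (x - z) d = of_real x - Complex z (-d)" by (auto simp: a_def complex_eq_iff)
    have q: "cnj (1 / (complex_of_real x - Complex z (-d))) = 1 / (of_real x - Complex z d)"
    proof -
      have "cnj (Complex z (-d)) = Complex z d" by (simp add: complex_eq_iff)
      then show ?thesis by simp
    qed
    have "conj_poisson e (x - y) * conj_poisson d (x - z) = Re P / pi * (Re Q / pi)"
      using assms by (simp add: conj_poisson_eq_Re c P_def Q_def)
    \<comment> \<open>A product of real parts is half the real part of this sum. The first summand
      has its poles on opposite sides of the axis, the second has both below and integrates to
      0.\<close>
    also have "\<dots> = Re (P * cnj Q + P * Q) / (2 * pi^2)" by (simp add: power2_eq_square)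
    also have "P * cnj Q + P * Q = A (Complex z d) x + A (Complex z (-d)) x"
      unfolding Q_def q by (simp add: A_def P_def)
    finally show "Re (A (Complex z d) x + A (Complex z (-d)) x) / (2 * pi^2) = conj_poisson e (x - y) * conj_poisson d (x - z)" by simp
  qed
  also have "Re (2 * pi * \<i> / (Complex z d - a) + 0) / (2 * pi^2) = poisson (e + d) (y - z)"
  proof -
    have "Complex z d - a = Complex (z - y) (e + d)" by (simp add: a_def complex_eq_iff)
    moreover have "(z - y) * (z - y) = (y - z) * (y - z)" by (simp add: algebra_simps)
    ultimately show ?thesis by (simp add: Re_divide poisson_def power2_eq_square)
  qed
  finally show ?thesis .
qed

subsection \<open>Poisson and conjugate Poisson integrals\<close>

lemma borel_measurable_poisson [measurable]: "poisson e \<in> borel_measurable borel"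
  unfolding poisson_def by measurable

lemma borel_measurable_conj_poisson [measurable]: "conj_poisson e \<in> borel_measurable borel"
  unfolding conj_poisson_def by measurable

lemma poisson_nonneg: "e > 0 \<Longrightarrow> 0 \<le> poisson e x"
  by (simp add: poisson_def)

lemma poisson_le: "e > 0 \<Longrightarrow> poisson e x \<le> 1 / (pi * e)"
  by (simp add: poisson_def field_simps power2_eq_square add_pos_nonneg)

lemma abs_conj_poisson_le:
  assumes "e > 0" shows "\<bar>conj_poisson e x\<bar> \<le> 1 / (pi * e)"
proof -
  have "\<bar>x\<bar> * e \<le> x^2 + e^2" 
    using sum_squares_bound[of "\<bar>x\<bar>" e] mult_nonneg_nonneg[of "\<bar>x\<bar>" e] assms 
    unfolding power2_abs by linarith
  moreover have "x^2 + e^2 > 0" using assms by (simp add: add_nonneg_pos)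
  ultimately have "\<bar>x\<bar> / (x^2 + e^2) \<le> 1 / e"
    using assms by (simp add: field_simps)
  then have "\<bar>x\<bar> / (x^2 + e^2) / pi \<le> 1 / e / pi" by (intro divide_right_mono) auto
  then show ?thesis by (simp add: conj_poisson_def abs_mult mult.commute)
qed

lemma integrable_bounded_mult:
  fixes f k :: "real \<Rightarrow> real"
  assumes f: "integrable lborel f" and [measurable]: "k \<in> borel_measurable borel" and k: "\<And>y. \<bar>k y\<bar> \<le> B"
  shows "integrable lborel (\<lambda>y. k y * f y)"
proof (rule Bochner_Integration.integrable_bound)
  show "integrable lborel (\<lambda>y. B * f y)" using f by simp
  have [measurable]: "f \<in> borel_measurable borel" using f by auto
  show "(\<lambda>y. k y * f y) \<in> borel_measurable lborel" by measurable
  have "\<bar>k y\<bar> \<le> \<bar>B\<bar>" for y using k[of y] by linarith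
  then show "AE y in lborel. norm (k y * f y) \<le> norm (B * f y)"
    by (auto simp: abs_mult intro!: mult_right_mono)
qed

definition poisson_conv :: "(real \<Rightarrow> real) \<Rightarrow> real \<Rightarrow> real \<Rightarrow> real" where
  "poisson_conv f e x = (LINT y|lborel. poisson e (x - y) * f y)"

definition conj_conv :: "(real \<Rightarrow> real) \<Rightarrow> real \<Rightarrow> real \<Rightarrow> real" where
  "conj_conv f e x = (LINT y|lborel. conj_poisson e (x - y) * f y)"

lemma integrable_poisson_mult:
  assumes "e > 0" "integrable lborel f"
  shows "integrable lborel (\<lambda>y. poisson e (x - y) * f y)"
  using poisson_le[OF assms(1)] poisson_nonneg[OF assms(1)]
  by (intro integrable_bounded_mult[OF assms(2), where B="1 / (pi * e)"]) (auto simp: abs_of_nonneg)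

lemma integrable_conj_poisson_mult:
  assumes "e > 0" "integrable lborel f"
  shows "integrable lborel (\<lambda>y. conj_poisson e (x - y) * f y)"
  using abs_conj_poisson_le[OF assms(1)]
  by (intro integrable_bounded_mult[OF assms(2), where B="1 / (pi * e)"]) auto

lemma borel_measurable_conj_conv [measurable]:
  assumes [measurable]: "f \<in> borel_measurable borel"
  shows "conj_conv f e \<in> borel_measurable borel"
  unfolding conj_conv_def by measurable

lemma borel_measurable_poisson_conv [measurable]:
  assumes [measurable]: "f \<in> borel_measurable borel"
  shows "poisson_conv f e \<in> borel_measurable borel"
  unfolding poisson_conv_def by measurable

lemma has_bochner_integral_poisson':
  "e > 0 \<Longrightarrow> has_bochner_integral lborel (\<lambda>x. poisson e (x - y)) 1"
  using has_bochner_integral_poisson[of e y] by (simp add: poisson_def power2_commute)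

lemma has_bochner_integral_poisson_conv:
  assumes e: "e > 0" and f: "integrable lborel f"
  shows "has_bochner_integral lborel (poisson_conv f e) (LINT y|lborel. f y)"
proof -
  have [measurable]: "f \<in> borel_measurable borel" using f by auto
  have I: "(LINT x|lborel. norm (poisson e (x - y) * f y)) = \<bar>f y\<bar>" for y
  proof -
    have "norm (poisson e (x - y) * f y) = poisson e (x - y) * \<bar>f y\<bar>" for x
      using poisson_nonneg[OF e] by (simp add: abs_mult)
    then show ?thesis using has_bochner_integral_poisson'[OF e, of y] by (simp add: has_bochner_integral_iff)
  qed
  have int: "integrable (lborel \<Otimes>\<^sub>M lborel) (\<lambda>(y, x). poisson e (x - y) * f y)"
  proof (rule lborel_pair.Fubini_integrable)
    show "integrable lborel (\<lambda>y. LINT x|lborel. norm (case (y, x) of (y, x) \<Rightarrow> poisson e (x - y) * f y))"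
      using f by (simp add: I[unfolded real_norm_def])
    show "AE y in lborel. integrable lborel (\<lambda>x. case (y, x) of (y, x) \<Rightarrow> poisson e (x - y) * f y)"
      using has_bochner_integral_poisson'[OF e] by (auto simp: has_bochner_integral_iff)
  qed measurable
  have "integrable lborel (\<lambda>x. LINT y|lborel. poisson e (x - y) * f y)"
    using lborel_pair.integrable_snd[OF int] by simp
  moreover have "(LINT x|lborel. LINT y|lborel. poisson e (x - y) * f y) = (LINT y|lborel. LINT x|lborel. poisson e (x - y) * f y)"
    using lborel_pair.Fubini_integral[OF int] by simp
  moreover have "(LINT y|lborel. LINT x|lborel. poisson e (x - y) * f y) = (LINT y|lborel. f y)"
    using has_bochner_integral_poisson'[OF e]
    by (intro Bochner_Integration.integral_cong) (auto simp: has_bochner_integral_iff)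
  ultimately show ?thesis unfolding has_bochner_integral_iff poisson_conv_def[abs_def] by argo
qed

lemma poisson_conv_bounds:
  assumes e: "e > 0" and f: "integrable lborel f" "\<And>y. 0 \<le> f y" "\<And>y. f y \<le> 1"
  shows "0 \<le> poisson_conv f e x" "poisson_conv f e x \<le> 1"
proof -
  show "0 \<le> poisson_conv f e x" unfolding poisson_conv_def
    using poisson_nonneg[OF e] f by (intro integral_nonneg_AE) auto
  have "poisson_conv f e x \<le> (LINT y|lborel. poisson e (x - y))"
    unfolding poisson_conv_def
    using poisson_nonneg[OF e] f has_bochner_integral_poisson[OF e, of x] integrable_poisson_mult[OF e f(1), of x]
    by (intro integral_mono) (auto simp: has_bochner_integral_iff mult_left_le)
  then show "poisson_conv f e x \<le> 1"
    using has_bochner_integral_poisson[OF e, of x] by (simp add: has_bochner_integral_iff)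
qed

section \<open>Analyticity of the Cauchy transform\<close>

definition cauchy_transform :: "(real \<Rightarrow> real) \<Rightarrow> complex \<Rightarrow> complex" where
  "cauchy_transform f z = (LINT y|lborel. of_real (f y) / (z - of_real y))"

lemma integrable_mult_cauchy:
  assumes "integrable lborel f" and [measurable]: "k \<in> borel_measurable borel" and "\<And>y. norm (k y) \<le> B"
  shows "integrable lborel (\<lambda>y. complex_of_real (f y) * k y)"
proof (rule Bochner_Integration.integrable_bound)
  show "integrable lborel (\<lambda>y. B * f y)" using assms by simp
  have [measurable]: "f \<in> borel_measurable borel" using assms by auto
  show "(\<lambda>y. of_real (f y) * k y) \<in> borel_measurable lborel" by measurable
  have "norm (k y) \<le> \<bar>B\<bar>" for y using assms(3)[of y] by linarith
  then show "AE y in lborel. norm (of_real (f y) * k y) \<le> norm (B * f y)"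
    by (auto simp: norm_mult abs_mult mult.commute[of "\<bar>B\<bar>"] intro!: mult_left_mono)
qed

lemma norm_inverse_minus_of_real_le:
  assumes "Im z > 0" shows "norm (1 / (z - of_real y)) \<le> 1 / Im z"
proof -
  have "Im z \<le> norm (z - of_real y)" using abs_Im_le_cmod[of "z - of_real y"] by auto
  then show ?thesis using assms by (simp add: norm_divide frac_le)
qed

lemma integrable_cauchy_transform:
  assumes "integrable lborel f" "Im z > 0"
  shows "integrable lborel (\<lambda>y. of_real (f y) / (z - of_real y))"
  using integrable_mult_cauchy[OF assms(1) _ norm_inverse_minus_of_real_le[OF assms(2)]] by simp

text \<open>Differentiation under the integral with an explicit remainder: the error of the
  difference quotient is exactly \<open>w - z\<close> times the integral of \<open>f\<close> against
  a triple product of Cauchy kernels, which is bounded as long as \<open>Im w\<close> stays above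
  \<open>Im z / 2\<close>.\<close>

lemma cauchy_transform_holomorphic:
  assumes f: "integrable lborel f"
  shows "cauchy_transform f holomorphic_on {z. Im z > 0}"
proof -
  have "(cauchy_transform f has_field_derivative - (LINT y|lborel. of_real (f y) / (z - of_real y)^2)) (at z)" if z: "Im z > 0" for z
    unfolding has_field_derivative_iff
  proof (rule Lim_transform2[OF tendsto_const], rule Lim_null_comparison)
    define L where "L = (LINT y|lborel. \<bar>f y\<bar>)"
    have "eventually (\<lambda>w. w \<in> {w. Im w > Im z / 2}) (at z)"
      using z by (intro eventually_at_in_open') (auto intro: open_halfspace_Im_gt simp del: less_divide_eq_numeral1 divide_less_eq_numeral1)
    moreover have "eventually (\<lambda>w. w \<noteq> z) (at z)" by (simp add: eventually_at_filter)
    ultimately show "eventually (\<lambda>w. norm (- (LINT y|lborel. of_real (f y) / (z - of_real y)^2) - (cauchy_transform f w - cauchy_transform f z) / (w - z))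
        \<le> norm (w - z) * (L * (1 / (Im z / 2) * (1 / Im z) * (1 / Im z)))) (at z)"
    proof eventually_elim
      case (elim w)
      then have w: "Im w > Im z / 2" "w \<noteq> z" by auto
      have n: "z - of_real y \<noteq> 0" "w - of_real y \<noteq> 0" for y using z w by (auto simp: complex_eq_iff)
      have bz: "norm (1 / (z - of_real y)) \<le> 1 / Im z" for y using norm_inverse_minus_of_real_le z .
      have bw: "norm (1 / (w - of_real y)) \<le> 1 / (Im z / 2)" for y
      proof -
        have "norm (1 / (w - of_real y)) \<le> 1 / Im w" using norm_inverse_minus_of_real_le z w by simp
        also have "\<dots> \<le> 1 / (Im z / 2)" using z w by (intro divide_left_mono) auto
        finally show ?thesis .
      qed
      define k where "k = (\<lambda>y. (1 / (w - complex_of_real y)) * (1 / (z - of_real y)) * (1 / (z - of_real y)))"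
      have kb: "norm (k y) \<le> 1 / (Im z / 2) * (1 / Im z) * (1 / Im z)" for y
        unfolding k_def norm_mult using bz[of y] bw[of y] z by (intro mult_mono) auto
      have km [measurable]: "k \<in> borel_measurable borel" unfolding k_def by measurable
      have ik: "integrable lborel (\<lambda>y. of_real (f y) * k y)" by (rule integrable_mult_cauchy[OF f km kb])
      have i2: "integrable lborel (\<lambda>y. of_real (f y) * ((1 / (z - of_real y)) * (1 / (z - of_real y))))"
      proof (rule integrable_mult_cauchy[OF f])
        show "norm ((1 / (z - of_real y)) * (1 / (z - of_real y))) \<le> (1 / Im z) * (1 / Im z)" for y
          unfolding norm_mult using bz[of y] z by (intro mult_mono) auto
      qed measurable
      have iw: "integrable lborel (\<lambda>y. of_real (f y) / (w - of_real y))" "integrable lborel (\<lambda>y. of_real (f y) / (z - of_real y))"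
        using z w by (auto intro!: integrable_cauchy_transform f)
      have "- (LINT y|lborel. of_real (f y) / (z - of_real y)^2) - (cauchy_transform f w - cauchy_transform f z) / (w - z)
          = (LINT y|lborel. - (of_real (f y) * ((1 / (z - of_real y)) * (1 / (z - of_real y)))) - (of_real (f y) / (w - of_real y) - of_real (f y) / (z - of_real y)) / (w - z))"
        unfolding cauchy_transform_def using iw i2 
        by (simp add: power2_eq_square)
      also have "\<dots> = (LINT y|lborel. - (w - z) * (of_real (f y) * k y))"
      proof (rule Bochner_Integration.integral_cong[OF refl])
        fix y :: real
        define A B where "A = w - of_real y" and "B = z - of_real y"
        have AB: "A \<noteq> 0" "B \<noteq> 0" "A - B \<noteq> 0" "w - z = A - B" using n[of y] w by (auto simp: A_def B_def)
        have "- (c * (1 / B * (1 / B))) - (c / A - c / B) / (A - B) = - (A - B) * (c * (1/A * (1/B) * (1/B)))" for c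
        proof -
          have "c / A - c / B = - c / (A * B) * (A - B)" using AB by (simp add: field_simps)
          then have "(c / A - c / B) / (A - B) = - c / (A * B)" using AB by simp
          moreover have "- (c * (1 / B * (1 / B))) - (- c / (A * B)) = - (A - B) * (c * (1/A * (1/B) * (1/B)))"
            using AB by (simp add: field_simps)
          ultimately show ?thesis by metis
        qed
        then show "- (of_real (f y) * ((1 / (z - of_real y)) * (1 / (z - of_real y)))) - (of_real (f y) / (w - of_real y) - of_real (f y) / (z - of_real y)) / (w - z) = - (w - z) * (of_real (f y) * k y)"
          unfolding k_def A_def[symmetric] B_def[symmetric] AB(4) .
      qed
      also have "\<dots> = - (w - z) * (LINT y|lborel. of_real (f y) * k y)" by (rule integral_mult_right_zero)
      finally have eq: "- (LINT y|lborel. of_real (f y) / (z - of_real y)^2) - (cauchy_transform f w - cauchy_transform f z) / (w - z) = - (w - z) * (LINT y|lborel. of_real (f y) * k y)" .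
      have "norm (LINT y|lborel. of_real (f y) * k y) \<le> (LINT y|lborel. \<bar>f y\<bar> * (1 / (Im z / 2) * (1 / Im z) * (1 / Im z)))"
      proof (rule Bochner_Integration.integral_norm_bound_integral[OF ik])
        show "norm (of_real (f y) * k y) \<le> \<bar>f y\<bar> * (1 / (Im z / 2) * (1 / Im z) * (1 / Im z))" for y
          unfolding norm_mult norm_of_real by (intro mult_left_mono kb) auto
      qed (use f in auto)
      also have "\<dots> = L * (1 / (Im z / 2) * (1 / Im z) * (1 / Im z))" by (simp add: L_def)
      finally show ?case unfolding eq norm_mult norm_minus_cancel by (intro mult_left_mono) auto
    qed
    show "((\<lambda>w. norm (w - z) * (L * (1 / (Im z / 2) * (1 / Im z) * (1 / Im z)))) \<longlongrightarrow> 0) (at z)"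
      by (rule tendsto_eq_intros refl | simp)+
  qed
  then show ?thesis
    by (intro holomorphic_onI) (auto simp: field_differentiable_def intro: has_field_derivative_at_within)
qed

lemma cauchy_transform_eq:
  assumes f: "integrable lborel f" and e: "e > 0"
  shows "Re (cauchy_transform f (Complex x e)) = pi * conj_conv f e x"
    "Im (cauchy_transform f (Complex x e)) = - pi * poisson_conv f e x"
proof -
  have I: "integrable lborel (\<lambda>y. of_real (f y) / (Complex x e - of_real y))"
    using integrable_cauchy_transform[OF f] e by simp
  have c: "Complex x e - of_real y = Complex (x - y) e" for y by (simp add: complex_eq_iff)
  have "Re (cauchy_transform f (Complex x e)) = (LINT y|lborel. Re (of_real (f y) / (Complex x e - of_real y)))"
    unfolding cauchy_transform_def using I by simp
  also have "\<dots> = (LINT y|lborel. pi * (conj_poisson e (x - y) * f y))"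
    unfolding c by (intro Bochner_Integration.integral_cong) (auto simp: conj_poisson_def Re_divide power2_eq_square)
  finally show "Re (cauchy_transform f (Complex x e)) = pi * conj_conv f e x" by (simp add: conj_conv_def)
  have "Im (cauchy_transform f (Complex x e)) = (LINT y|lborel. Im (of_real (f y) / (Complex x e - of_real y)))"
    unfolding cauchy_transform_def using I by simp
  also have "\<dots> = (LINT y|lborel. - pi * (poisson e (x - y) * f y))"
    unfolding c by (intro Bochner_Integration.integral_cong) (auto simp: poisson_def Im_divide power2_eq_square)
  finally show "Im (cauchy_transform f (Complex x e)) = - pi * poisson_conv f e x" by (simp add: poisson_conv_def)
qed

lemma continuous_on_conv:
  assumes f: "integrable lborel f" and e: "e > 0"
  shows "continuous_on UNIV (conj_conv f e)" "continuous_on UNIV (poisson_conv f e)"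
proof -
  have c: "continuous_on UNIV (\<lambda>x. cauchy_transform f (Complex x e))"
    using e by (intro continuous_on_compose2[OF holomorphic_on_imp_continuous_on[OF cauchy_transform_holomorphic[OF f]]])
      (auto simp: Complex_eq intro!: continuous_intros)
  have "conj_conv f e = (\<lambda>x. Re (cauchy_transform f (Complex x e)) / pi)"
    "poisson_conv f e = (\<lambda>x. Im (cauchy_transform f (Complex x e)) / - pi)"
    using cauchy_transform_eq[OF f e] by auto
  then show "continuous_on UNIV (conj_conv f e)" "continuous_on UNIV (poisson_conv f e)"
    using c by (auto intro!: continuous_intros)
qed

subsection \<open>The exponential estimate\<close>

text \<open>The linear Taylor terms of the exponentials of \<open>w\<close> and \<open>-w\<close>
  cancel. The quadratic bound turns the first order decay of the Cauchy transform into the decay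
  which the contour argument demands.\<close>

lemma norm_cosh_minus_1_le:
  fixes w :: complex
  assumes "norm w \<le> 1"
  shows "norm (cosh w - 1) \<le> exp 1 * (norm w)^2"
proof -
  have *: "norm (exp z - 1 - z) \<le> exp 1 * (norm z)^2" if "norm z \<le> 1" for z :: complex
  proof -
    have "norm (exp z - (\<Sum>k\<le>1. z ^ k / (fact k))) \<le> exp\<bar>Re z\<bar> * (norm z) ^ (Suc 1) / (fact 1)"
      by (rule Taylor_exp)
    also have "\<dots> \<le> exp 1 * (norm z)^2"
      using that abs_Re_le_cmod[of z] by (simp add: power2_eq_square mult_right_mono)
    finally show ?thesis by (simp add: diff_diff_eq)
  qed
  have "cosh w - 1 = ((exp w - 1 - w) + (exp (-w) - 1 - (-w))) / 2"
    by (simp add: cosh_def scaleR_conv_of_real field_simps)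
  then have "norm (cosh w - 1) \<le> (norm (exp w - 1 - w) + norm (exp (-w) - 1 - (-w))) / 2"
    using norm_triangle_ineq[of "exp w - 1 - w" "exp (-w) - 1 - (-w)"] 
    by (simp only: norm_divide norm_numeral) simp
  also have "\<dots> \<le> (exp 1 * (norm w)^2 + exp 1 * (norm (-w))^2) / 2"
    using assms by (intro divide_right_mono add_mono *) auto
  finally show ?thesis by simp
qed

lemma nn_integral_tendsto_le:
  assumes [measurable]: "\<And>n. u n \<in> borel_measurable M" "U \<in> borel_measurable M"
    and lim: "AE x in M. (\<lambda>n. u n x) \<longlonglongrightarrow> U x"
    and le: "\<And>n. (\<integral>\<^sup>+x. u n x \<partial>M) \<le> c n" and c: "c \<longlonglongrightarrow> (C::ennreal)"
  shows "(\<integral>\<^sup>+x. U x \<partial>M) \<le> C"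
proof -
  have "(\<integral>\<^sup>+x. U x \<partial>M) = (\<integral>\<^sup>+x. liminf (\<lambda>n. u n x) \<partial>M)"
    using lim by (intro nn_integral_cong_AE) (auto elim!: eventually_mono dest!: lim_imp_Liminf[OF trivial_limit_sequentially])
  also have "\<dots> \<le> liminf (\<lambda>n. \<integral>\<^sup>+x. u n x \<partial>M)" by (rule nn_integral_liminf) simp
  also have "\<dots> \<le> liminf c" using le by (intro Liminf_mono) auto
  also have "\<dots> = C" using c by (rule lim_imp_Liminf[OF trivial_limit_sequentially])
  finally show ?thesis .
qed

lemma Re_cosh: "Re (cosh z) = cosh (Re z) * cos (Im z)"
  by (simp add: cosh_def Re_exp scaleR_conv_of_real field_simps)

lemma one_minus_cos_le: "1 - cos u \<le> u^2 / 2" for u :: real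
proof -
  have "1 - cos u = 2 * (sin (u/2))^2"
    using cos_double_sin[of "u/2"] by simp
  also have "\<dots> \<le> 2 * (u/2)^2" using abs_sin_x_le_abs_x[of "u/2"] 
    by (intro mult_left_mono) (auto simp only: abs_le_square_iff zero_le_numeral)
  finally show ?thesis by (simp add: power2_eq_square)
qed

text \<open>The real part of \<open>cosh (v - \<i> u) - 1\<close> is \<open>cos u * (cosh v - 1) - (1 - cos u)\<close>, with \<open>cos u \<ge> 1 / 2\<close> and
  \<open>1 - cos u \<le> u / 2\<close> because \<open>0 \<le> u \<le> 1\<close>.\<close>

lemma nn_integral_cosh_conj_conv_bounded_support:
  assumes e: "e > 0" and f: "integrable lborel f" "\<And>y. 0 \<le> f y" "\<And>y. f y \<le> 1"
    and R: "\<And>y. \<bar>y\<bar> > R \<Longrightarrow> f y = 0"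
  shows "(\<integral>\<^sup>+x. ennreal (cosh (conj_conv f e x) - 1) \<partial>lborel) \<le> ennreal (LINT y|lborel. f y)"
proof -
  define I where "I = (LINT y|lborel. f y)"
  have I0: "I \<ge> 0" unfolding I_def using f by (intro integral_nonneg_AE) auto
  \<comment> \<open>On the line of height \<open>e\<close> this is \<open>v - \<i> * u\<close>, by
    \<open>cauchy_transform_eq\<close>.\<close>
  define W where "W = (\<lambda>z. cauchy_transform f z / pi)"
  define G where "G = (\<lambda>z. cosh (W z) - 1)"
  define v where "v = conj_conv f e"
  define u where "u = poisson_conv f e"
  have [measurable]: "f \<in> borel_measurable borel" using f by auto
  have cv: "continuous_on UNIV v" and cu: "continuous_on UNIV u"
    unfolding u_def v_def by (rule continuous_on_conv[OF f(1) e])+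
  have holW: "W holomorphic_on {z. Im z > 0}"
    unfolding W_def by (intro holomorphic_intros cauchy_transform_holomorphic f) auto
  have holG: "G holomorphic_on {z. Im z > 0}"
    unfolding G_def cosh_def by (intro holomorphic_intros holW)
  \<comment> \<open>The term \<open>2 * \<bar>R\<bar>\<close> keeps \<open>z\<close> at distance at
    least \<open>norm z / 2\<close> from the support of \<open>f\<close>; the term
    \<open>2 * I\<close> forces \<open>norm (W z) \<le> 1\<close>, as
    \<open>norm_cosh_minus_1_le\<close> requires.\<close>
  define R0 where "R0 = 2 * \<bar>R\<bar> + 2 * I + 1"
  have Wb: "norm (W z) \<le> 2 * I / (pi * norm z)" if z: "Im z > 0" "norm z \<ge> R0" for z
  proof -
    have "norm (cauchy_transform f z) \<le> (LINT y|lborel. f y * (2 / norm z))"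
      unfolding cauchy_transform_def
    proof (rule Bochner_Integration.integral_norm_bound_integral[OF integrable_cauchy_transform[OF f(1) z(1)]])
      fix y
      show "norm (of_real (f y) / (z - of_real y)) \<le> f y * (2 / norm z)"
      proof (cases "\<bar>y\<bar> > R")
        case False
        have "norm z / 2 \<le> norm (z - of_real y)"
          using norm_triangle_ineq2[of z "of_real y"] z(2) False I0 unfolding R0_def norm_of_real by linarith
        moreover have "norm z > 0" using z by auto
        ultimately have "1 / norm (z - of_real y) \<le> 1 / (norm z / 2)" by (intro divide_left_mono mult_pos_pos) auto
        then have "f y * (1 / norm (z - of_real y)) \<le> f y * (1 / (norm z / 2))" using f by (intro mult_left_mono) auto
        then show ?thesis using f by (simp add: norm_divide)
      qed (use R in auto)
    qed (use f in auto)
    then show ?thesis by (simp add: W_def norm_divide I_def field_simps)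
  qed
  have lim0: "(\<lambda>n. integral {-real n..real n} (\<lambda>x. G (Complex x e))) \<longlonglongrightarrow> 0"
  proof (rule half_plane_line_integral_tendsto_0[OF holG e])
    fix z assume z: "Im z > 0" "norm z \<ge> R0"
    have "norm z > 0" using z by auto
    have "2 * I \<le> 1 * norm z" using z I0 by (simp add: R0_def)
    also have "\<dots> \<le> pi * norm z" using pi_ge_two by (intro mult_right_mono) auto
    finally have "2 * I / (pi * norm z) \<le> 1" using \<open>norm z > 0\<close> by (simp add: field_simps)
    then have "norm (G z) \<le> exp 1 * (norm (W z))^2" 
      unfolding G_def using Wb[OF z] by (intro norm_cosh_minus_1_le) linarith
    also have "\<dots> \<le> exp 1 * (2 * I / (pi * norm z))^2"
      using Wb[OF z] by (intro mult_left_mono power_mono) auto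
    also have "\<dots> = (exp 1 * (2 * I / pi)^2) / (norm z)^2" by (simp add: power_divide power_mult_distrib)
    finally show "norm (G z) \<le> (exp 1 * (2 * I / pi)^2) / (norm z)^2" .
  qed simp
  have ReG: "Re (G (Complex x e)) = cosh (v x) * cos (u x) - 1" for x
    using cauchy_transform_eq[OF f(1) e] by (simp add: G_def W_def Re_cosh v_def u_def)
  have cG: "continuous_on {-real n..real n} (\<lambda>x. G (Complex x e))" for n
    using e by (intro continuous_on_compose2[OF holomorphic_on_imp_continuous_on[OF holG]])
      (auto simp: Complex_eq intro!: continuous_intros)
  define J where "J = (\<lambda>n. integral {-real n..real n} (\<lambda>x. Re (G (Complex x e))))"
  have J0: "J \<longlonglongrightarrow> 0"
  proof -
    have "J n = Re (integral {-real n..real n} (\<lambda>x. G (Complex x e)))" for n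
      unfolding J_def 
      using integral_linear[OF integrable_continuous_interval[OF cG] bounded_linear_Re] by (simp add: o_def)
    then have "J = (\<lambda>n. Re (integral {-real n..real n} (\<lambda>x. G (Complex x e))))" by (rule ext)
    then show ?thesis using tendsto_Re[OF lim0] by simp
  qed
  have main: "integral {-real n..real n} (\<lambda>x. cosh (v x) - 1) \<le> 2 * J n + I" for n
  proof -
    have ci: "continuous_on {-real n..real n} v" "continuous_on {-real n..real n} u"
      using cv cu by (auto intro: continuous_on_subset)
    have "integral {-real n..real n} (\<lambda>x. cosh (v x) - 1) \<le> integral {-real n..real n} (\<lambda>x. 2 * Re (G (Complex x e)) + u x)"
    proof (rule integral_le)
      show "(\<lambda>x. cosh (v x) - 1) integrable_on {- real n..real n}"
        by (intro integrable_continuous_interval continuous_intros ci)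
      show "(\<lambda>x. 2 * Re (G (Complex x e)) + u x) integrable_on {- real n..real n}"
        unfolding ReG by (intro integrable_continuous_interval continuous_intros ci)
      fix x
      have u: "0 \<le> u x" "u x \<le> 1" unfolding u_def by (rule poisson_conv_bounds[OF e f])+
      have "cos (1::real) \<le> cos (u x)" using u pi_ge_two by (intro cos_monotone_0_pi_le) auto
      moreover have "1 / 2 \<le> cos (1::real)"
        using one_minus_cos_le[of 1] by simp
      ultimately have "(1/2) * (cosh (v x) - 1) \<le> cos (u x) * (cosh (v x) - 1)"
        by (intro mult_right_mono) (auto simp: cosh_real_ge_1)
      also have "\<dots> = Re (G (Complex x e)) + (1 - cos (u x))" by (simp add: ReG algebra_simps)
      also have "1 - cos (u x) \<le> u x / 2"
        using one_minus_cos_le[of "u x"] u mult_left_le[of "u x" "u x"] by (simp add: power2_eq_square)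
      finally show "cosh (v x) - 1 \<le> 2 * Re (G (Complex x e)) + u x" by simp
    qed
    also have "\<dots> = 2 * J n + integral {-real n..real n} u"
      unfolding J_def ReG
      by (subst Henstock_Kurzweil_Integration.integral_add)
        (intro integrable_continuous_interval continuous_intros ci, intro integrable_continuous_interval ci,
          simp only: Henstock_Kurzweil_Integration.integral_mult_right)
    \<comment> \<open>Poisson integrals preserve the total mass and \<open>u\<close> is nonnegative;
      this is how the mass of \<open>f\<close> enters the final bound.\<close>
    also have "integral {-real n..real n} u \<le> I"
    proof -
      have iu: "integrable lborel u" "(LINT x|lborel. u x) = I"
        using has_bochner_integral_poisson_conv[OF e f(1)] by (auto simp: u_def I_def has_bochner_integral_iff)
      have "integral {-real n..real n} u = (LINT x|lborel. indicator {-real n..real n} x *\<^sub>R u x)"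
        by (rule integral_Icc_eq_lborel[OF integrable_mult_indicator[OF _ iu(1)]]) simp
      also have "\<dots> \<le> (LINT x|lborel. u x)"
        using iu(1) integrable_mult_indicator[OF _ iu(1), of "{-real n..real n}"] poisson_conv_bounds[OF e f]
        by (intro integral_mono) (auto simp: indicator_def u_def)
      finally show ?thesis using iu by simp
    qed
    finally show ?thesis by simp
  qed
  have nn: "(\<integral>\<^sup>+x. ennreal (cosh (v x) - 1) * indicator {-real n..real n} x \<partial>lborel) \<le> ennreal (2 * J n + I)" for n
  proof -
    have c: "continuous_on {-real n..real n} (\<lambda>x. cosh (v x) - 1)"
      using cv by (intro continuous_intros continuous_on_subset[OF cv]) auto
    have "set_integrable lborel {-real n..real n} (\<lambda>x. cosh (v x) - 1)"
      by (rule borel_integrable_atLeastAtMost') (rule c)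
    then have i: "integrable lborel (\<lambda>x. indicator {-real n..real n} x *\<^sub>R (cosh (v x) - 1))" by (simp add: set_integrable_def)
    have "(\<integral>\<^sup>+x. ennreal (cosh (v x) - 1) * indicator {-real n..real n} x \<partial>lborel) 
       = (\<integral>\<^sup>+x. ennreal (indicator {-real n..real n} x *\<^sub>R (cosh (v x) - 1)) \<partial>lborel)"
      by (intro nn_integral_cong) (auto simp: indicator_def)
    also have "\<dots> = ennreal (LINT x|lborel. indicator {-real n..real n} x *\<^sub>R (cosh (v x) - 1))"
      using i by (intro nn_integral_eq_integral) (auto simp: cosh_real_ge_1)
    also have "(LINT x|lborel. indicator {-real n..real n} x *\<^sub>R (cosh (v x) - 1)) = integral {-real n..real n} (\<lambda>x. cosh (v x) - 1)"
      using integral_Icc_eq_lborel[OF i] by simp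
    finally show ?thesis using main by (simp add: ennreal_leI)
  qed
  have "(\<integral>\<^sup>+x. ennreal (cosh (v x) - 1) \<partial>lborel) \<le> ennreal (2 * 0 + I)"
  proof (rule nn_integral_tendsto_le[OF _ _ _ nn])
    show "(\<lambda>n. ennreal (2 * J n + I)) \<longlonglongrightarrow> ennreal (2 * 0 + I)"
      by (intro tendsto_intros J0)
    have vm [measurable]: "v \<in> borel_measurable borel" unfolding v_def by measurable
    have [measurable]: "(\<lambda>x. cosh (v x)) \<in> borel_measurable borel" unfolding cosh_def by measurable
    show "(\<lambda>x. ennreal (cosh (v x) - 1) * indicator {- real n..real n} x) \<in> borel_measurable lborel" for n by measurable
    show "(\<lambda>x. ennreal (cosh (v x) - 1)) \<in> borel_measurable lborel" by measurable
    have "(\<lambda>n. ennreal (cosh (v x) - 1) * indicator {- real n..real n} x) \<longlonglongrightarrow> ennreal (cosh (v x) - 1)" for x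
      by (rule tendsto_eventually, rule eventually_mono[OF eventually_mem_Icc[of x]]) simp
    then show "AE x in lborel. (\<lambda>n. ennreal (cosh (v x) - 1) * indicator {- real n..real n} x) \<longlonglongrightarrow> ennreal (cosh (v x) - 1)" by simp
  qed
  then show ?thesis by (simp add: v_def I_def)
qed

text \<open>Bounded support was needed for decay at infinity. It is removed by cutting
  \<open>f\<close> off outside \<open>{-n..n}\<close>: the conjugate integrals converge pointwise,
  and Fatou's lemma keeps the bound.\<close>

lemma nn_integral_cosh_conj_conv:
  assumes e: "e > 0" and f: "integrable lborel f" "\<And>y. 0 \<le> f y" "\<And>y. f y \<le> 1"
  shows "(\<integral>\<^sup>+x. ennreal (cosh (conj_conv f e x) - 1) \<partial>lborel) \<le> ennreal (LINT y|lborel. f y)"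
proof -
  define g where "g = (\<lambda>n::nat. \<lambda>y. indicator {-real n..real n} y * f y)"
  have [measurable]: "f \<in> borel_measurable borel" using f by auto
  have ig: "integrable lborel (g n)" for n
    using integrable_mult_indicator[OF _ f(1), of "{-real n..real n}"] by (simp add: g_def)
  have glim: "(\<lambda>n. g n y) \<longlonglongrightarrow> f y" for y
    by (rule tendsto_eventually, rule eventually_mono[OF eventually_mem_Icc[of y]]) (simp add: g_def)
  have vlim: "(\<lambda>n. conj_conv (g n) e x) \<longlonglongrightarrow> conj_conv f e x" for x
    unfolding conj_conv_def
  proof (rule integral_dominated_convergence[where w="\<lambda>y. \<bar>conj_poisson e (x - y) * f y\<bar>"])
    show "integrable lborel (\<lambda>y. \<bar>conj_poisson e (x - y) * f y\<bar>)"
      using integrable_conj_poisson_mult[OF e f(1)] by (rule integrable_abs)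
    show "AE y in lborel. (\<lambda>n. conj_poisson e (x - y) * g n y) \<longlonglongrightarrow> conj_poisson e (x - y) * f y"
      using glim by (auto intro!: tendsto_intros)
    show "AE y in lborel. norm (conj_poisson e (x - y) * g n y) \<le> \<bar>conj_poisson e (x - y) * f y\<bar>" for n
      by (auto simp: g_def indicator_def)
  qed (auto simp: g_def)
  have "(\<integral>\<^sup>+x. ennreal (cosh (conj_conv (g n) e x) - 1) \<partial>lborel) \<le> ennreal (LINT y|lborel. g n y)" for n
    using f by (intro nn_integral_cosh_conj_conv_bounded_support[where R="real n"] e ig) (auto simp: g_def indicator_def)
  also have "ennreal (LINT y|lborel. g n y) \<le> ennreal (LINT y|lborel. f y)" for n
    using f by (intro ennreal_leI integral_mono ig) (auto simp: g_def indicator_def)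
  finally have le: "(\<integral>\<^sup>+x. ennreal (cosh (conj_conv (g n) e x) - 1) \<partial>lborel) \<le> ennreal (LINT y|lborel. f y)" for n .
  show ?thesis
  proof (rule nn_integral_tendsto_le[OF _ _ _ le tendsto_const])
    have [measurable]: "g n \<in> borel_measurable borel" for n unfolding g_def by measurable
    have "(\<lambda>x. cosh (h x)) \<in> borel_measurable borel" if "h \<in> borel_measurable borel" for h :: "real \<Rightarrow> real"
      using that unfolding cosh_def by measurable
    from this[of "conj_conv _ e"]
    show "(\<lambda>x. ennreal (cosh (conj_conv (g n) e x) - 1)) \<in> borel_measurable lborel" 
      "(\<lambda>x. ennreal (cosh (conj_conv f e x) - 1)) \<in> borel_measurable lborel" for n by measurable
    have "(\<lambda>n. cosh (conj_conv (g n) e x)) \<longlonglongrightarrow> cosh (conj_conv f e x)" for x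
      unfolding cosh_def by (intro tendsto_intros vlim)
    then show "AE x in lborel. (\<lambda>n. ennreal (cosh (conj_conv (g n) e x) - 1)) \<longlonglongrightarrow> ennreal (cosh (conj_conv f e x) - 1)"
      by (intro AE_I2 tendsto_intros vlim)
  qed
qed

subsection \<open>Lebesgue points\<close>

text \<open>The upper half of Lebesgue's differentiation theorem is enough, as it will be applied to \<open>\<bar>w - q\<bar>\<close> for all
  rational \<open>q\<close>. A Vitali cover of the exceptional set by balls of large average, inside an open set in which the
  points with \<open>g \<ge> c\<close> carry little mass, has small total measure.\<close>

lemma null_upper_density:
  fixes g :: "real \<Rightarrow> ennreal" and c d :: real
  assumes [measurable]: "g \<in> borel_measurable borel" and cd: "0 \<le> c" "c < d"
    and loc: "\<And>R. (\<integral>\<^sup>+x\<in>{-R..R}. g x \<partial>lborel) < \<infinity>"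
  shows "negligible {x. g x < c \<and> (\<forall>s>0. \<exists>h>0. h < s \<and> ennreal (d * (2 * h)) \<le> (\<integral>\<^sup>+y\<in>cball x h. g y \<partial>lborel))}"
    (is "negligible {x. ?P x}")
proof -
  have "negligible {x. ?P x \<and> \<bar>x\<bar> < R}" for R
    unfolding negligible_outer_le
  proof safe
    fix \<eta> :: real assume \<eta>: "\<eta> > 0"
    define W where "W = {-R<..<R}"
    define \<mu> where "\<mu> = density lborel (\<lambda>x. g x * indicator W x)"
    define E0 where "E0 = {x\<in>W. g x < c}"
    have [measurable]: "W \<in> sets borel" by (simp add: W_def)
    have E0m [measurable]: "E0 \<in> sets borel" unfolding E0_def by measurable
    have \<mu>s: "sets \<mu> = sets borel" by (simp add: \<mu>_def)
    have em: "emeasure \<mu> A = (\<integral>\<^sup>+x. g x * indicator W x * indicator A x \<partial>lborel)" if "A \<in> sets borel" for A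
      using that by (simp add: \<mu>_def emeasure_density)
    have fin: "emeasure \<mu> (space \<mu>) \<noteq> \<infinity>"
    proof -
      have "emeasure \<mu> (space \<mu>) \<le> (\<integral>\<^sup>+x\<in>{-R..R}. g x \<partial>lborel)"
        by (subst em) (auto simp: \<mu>_def W_def indicator_def intro!: nn_integral_mono)
      then show ?thesis using loc[of R] by (auto simp: top_unique)
    qed
    \<comment> \<open>The covering argument will end with
      \<open>(d - c) * m \<le> \<epsilon>\<close> for the measure \<open>m\<close> of the cover, so
      this choice yields \<open>m \<le> \<eta>\<close>.\<close>
    define \<epsilon> where "\<epsilon> = \<eta> * (d - c)"
    have e0: "\<epsilon> > 0" using \<eta> cd by (simp add: \<epsilon>_def)
    obtain U where U: "open U" "E0 \<subseteq> U" "emeasure \<mu> U \<le> emeasure \<mu> E0 + ennreal \<epsilon>"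
    proof -
      have "emeasure \<mu> E0 = (INF U\<in>{U. E0 \<subseteq> U \<and> open U}. emeasure \<mu> U)"
        by (rule outer_regular[OF \<mu>s fin E0m])
      moreover have "emeasure \<mu> E0 < emeasure \<mu> E0 + ennreal \<epsilon>"
      proof -
        have "emeasure \<mu> E0 < \<infinity>" using fin emeasure_space[of \<mu> E0] by (auto simp: top_unique less_top)
        then show ?thesis using e0
          by (cases "emeasure \<mu> E0") (auto simp: ennreal_less_iff simp flip: ennreal_plus)
      qed
      ultimately obtain U where "E0 \<subseteq> U" "open U" "emeasure \<mu> U < emeasure \<mu> E0 + ennreal \<epsilon>"
        unfolding INF_less_iff by (metis (mono_tags) INF_less_iff mem_Collect_eq)
      then show ?thesis using that by (auto simp: less_imp_le)
    qed
    define S where "S = {x. ?P x \<and> \<bar>x\<bar> < R}"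
    \<comment> \<open>Balls that lie in the good open set and have average at least
      \<open>d\<close>. Arbitrarily small ones exist around every point of \<open>S\<close>, which
      makes this a Vitali cover.\<close>
    define K where "K = {(x,h). h > 0 \<and> cball x h \<subseteq> U \<inter> W \<and> ennreal (d * (2 * h)) \<le> (\<integral>\<^sup>+y\<in>cball x h. g y \<partial>lborel)}"
    have SU: "S \<subseteq> U \<inter> W" using U(2) by (auto simp: S_def E0_def W_def)
    have oW: "open (U \<inter> W)" using U(1) by (auto simp: W_def)
    have "\<exists>i. i \<in> K \<and> x \<in> cball (fst i) (snd i) \<and> snd i < s" if xS: "x \<in> S" and s0: "s > 0" for x s
    proof -
      have "x \<in> U \<inter> W" using SU xS by (rule subsetD)
      then have "\<exists>t>0. cball x t \<subseteq> U \<inter> W" using oW unfolding open_contains_cball by (rule bspec[rotated])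
      then obtain t where t: "t > 0" "cball x t \<subseteq> U \<inter> W" by (elim exE conjE)
      obtain h where h: "0 < h" "h < min s t" "ennreal (d * (2 * h)) \<le> (\<integral>\<^sup>+y\<in>cball x h. g y \<partial>lborel)"
      proof -
        have "\<forall>s>0. \<exists>h>0. h < s \<and> ennreal (d * (2 * h)) \<le> (\<integral>\<^sup>+y\<in>cball x h. g y \<partial>lborel)"
          using \<open>x \<in> S\<close> unfolding S_def by blast
        moreover have "min s t > 0" using t s0 by simp
        ultimately obtain h where "0 < h" "h < min s t" "ennreal (d * (2 * h)) \<le> (\<integral>\<^sup>+y\<in>cball x h. g y \<partial>lborel)"
          by meson
        then show ?thesis by (rule that)
      qed
      have "cball x h \<subseteq> cball x t" using h by (intro subset_cball) auto
      then have "(x, h) \<in> K" using h t(2) unfolding K_def by blast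
      moreover have "x \<in> cball (fst (x, h)) (snd (x, h)) \<and> snd (x, h) < s" using h by simp
      ultimately show ?thesis by blast
    qed
    then have vit: "\<And>x s. x \<in> S \<Longrightarrow> 0 < s \<Longrightarrow> \<exists>i. i \<in> K \<and> x \<in> cball (fst i) (snd i) \<and> snd i < s" .
    have Kpos: "\<And>i. i \<in> K \<Longrightarrow> 0 < snd i" by (auto simp: K_def)
    obtain C where C: "countable C" "C \<subseteq> K" 
      "pairwise (\<lambda>i j. disjnt (cball (fst i) (snd i)) (cball (fst j) (snd j))) C"
      "negligible (S - (\<Union>i\<in>C. cball (fst i) (snd i)))"
      using Vitali_covering_theorem_cballs[of K snd S fst, OF Kpos vit] .
    define B where "B = (\<lambda>i::real\<times>real. cball (fst i) (snd i))"
    define V where "V = (\<Union>i\<in>C. B i)"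
    have [measurable]: "B i \<in> sets borel" for i by (simp add: B_def)
    have Vm [measurable]: "V \<in> sets borel" unfolding V_def using C(1) by (intro sets.countable_UN'') auto
    have "B i \<subseteq> U \<inter> W" if "i \<in> C" for i
    proof -
      have "i \<in> K" using that C(2) by (rule rev_subsetD)
      then show ?thesis unfolding K_def B_def by (simp add: case_prod_beta)
    qed
    then have VU: "V \<subseteq> U \<inter> W" unfolding V_def by (rule UN_least)
    have disj: "disjoint_family_on B C"
      using C(3) by (auto simp: disjoint_family_on_def pairwise_def disjnt_def B_def)
    have leb: "emeasure lborel (B i) = ennreal (2 * snd i)" if "i \<in> C" for i
    proof -
      have "i \<in> K" using that C(2) by (rule rev_subsetD)
      then show ?thesis using Kpos[of i] by (simp add: B_def cball_eq_atLeastAtMost)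
    qed
    have "ennreal d * emeasure lborel V = ennreal d * (\<integral>\<^sup>+i. emeasure lborel (B i) \<partial>count_space C)"
      unfolding V_def using C(1) disj by (subst emeasure_UN_countable) auto
    also have "\<dots> = (\<integral>\<^sup>+i. ennreal d * emeasure lborel (B i) \<partial>count_space C)"
      by (rule nn_integral_cmult[symmetric]) simp
    also have "\<dots> \<le> (\<integral>\<^sup>+i. emeasure \<mu> (B i) \<partial>count_space C)"
    proof (rule nn_integral_mono)
      fix i assume "i \<in> space (count_space C)"
      then have i: "i \<in> C" by simp
      then have iK: "snd i > 0" "B i \<subseteq> U \<inter> W" "ennreal (d * (2 * snd i)) \<le> (\<integral>\<^sup>+y\<in>B i. g y \<partial>lborel)"
      proof -
        have "i \<in> K" using i C(2) by (rule rev_subsetD)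
        then show "snd i > 0" "B i \<subseteq> U \<inter> W" "ennreal (d * (2 * snd i)) \<le> (\<integral>\<^sup>+y\<in>B i. g y \<partial>lborel)"
          unfolding K_def B_def by (simp_all add: case_prod_beta)
      qed
      have "ennreal d * emeasure lborel (B i) = ennreal (d * (2 * snd i))"
        using leb[OF i] iK cd by (simp add: ennreal_mult)
      also have "\<dots> \<le> emeasure \<mu> (B i)"
        using iK by (subst em) (auto intro!: order_trans[OF iK(3)] nn_integral_mono simp: indicator_def)
      finally show "ennreal d * emeasure lborel (B i) \<le> emeasure \<mu> (B i)" .
    qed
    also have "\<dots> = emeasure \<mu> V"
      unfolding V_def using C(1) disj \<mu>s by (subst emeasure_UN_countable) auto
    \<comment> \<open>On \<open>E0\<close> the density is below \<open>c\<close>, and what lies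
      outside \<open>E0\<close> is part of \<open>U - E0\<close>, of mass at most
      \<open>\<epsilon>\<close>. Comparison with the lower bound \<open>d\<close> leaves a gap
      \<open>d - c\<close>.\<close>
    also have "\<dots> = emeasure \<mu> (V \<inter> E0) + emeasure \<mu> (V - E0)"
    proof -
      have "V \<inter> E0 \<inter> (V - E0) = {}" by blast
      then show ?thesis using plus_emeasure[of "V \<inter> E0" \<mu> "V - E0"] \<mu>s by (simp add: Int_Diff_Un)
    qed
    also have "emeasure \<mu> (V - E0) \<le> ennreal \<epsilon>"
    proof -
      have "emeasure \<mu> (V - E0) \<le> emeasure \<mu> (U - E0)" using VU U(1) \<mu>s by (intro emeasure_mono) auto
      also have "\<dots> = emeasure \<mu> U - emeasure \<mu> E0"
        using U \<mu>s fin emeasure_space[of \<mu> E0] by (intro emeasure_Diff) (auto simp: top_unique)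
      also have "\<dots> \<le> ennreal \<epsilon>" using U(3) fin emeasure_space[of \<mu> E0] by (auto simp: ennreal_minus_le_iff top_unique)
      finally show ?thesis .
    qed
    also have "emeasure \<mu> (V \<inter> E0) \<le> ennreal c * emeasure lborel V"
    proof -
      have "emeasure \<mu> (V \<inter> E0) \<le> (\<integral>\<^sup>+x. ennreal c * indicator V x \<partial>lborel)"
        by (subst em) (auto simp: indicator_def E0_def intro!: nn_integral_mono)
      then show ?thesis by (simp add: nn_integral_cmult)
    qed
    finally have main: "ennreal d * emeasure lborel V \<le> ennreal c * emeasure lborel V + ennreal \<epsilon>"
      by (simp add: add_mono)
    have Vfin: "emeasure lborel V < \<infinity>"
    proof -
      have "emeasure lborel V \<le> emeasure lborel {-R..R}" using VU by (intro emeasure_mono) (auto simp: W_def)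
      then show ?thesis using emeasure_lborel_Icc_eq[of "-R" R] by (auto simp: less_top[symmetric] top_unique)
    qed
    define m where "m = measure lborel V"
    have mV: "emeasure lborel V = ennreal m" using Vfin by (simp add: m_def emeasure_eq_ennreal_measure)
    have "ennreal (d * m) \<le> ennreal (c * m + \<epsilon>)"
      using main cd e0 unfolding mV by (simp add: ennreal_mult m_def)
    then have "d * m \<le> c * m + \<epsilon>" using cd e0 by (subst (asm) ennreal_le_iff) (auto simp: m_def)
    then have "(d - c) * m \<le> (d - c) * \<eta>" by (simp add: algebra_simps \<epsilon>_def)
    then have m\<eta>: "m \<le> \<eta>" using cd by simp
    define T where "T = V \<union> (S - V)"
    have ng: "negligible (S - V)" using C(4) by (simp add: V_def B_def)
    have Vl: "V \<in> lmeasurable" using Vfin by (auto simp: fmeasurable_def)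
    show "\<exists>T. {x. ?P x \<and> \<bar>x\<bar> < R} \<subseteq> T \<and> T \<in> lmeasurable \<and> measure lebesgue T \<le> \<eta>"
    proof (intro exI conjI)
      show "{x. ?P x \<and> \<bar>x\<bar> < R} \<subseteq> T" by (auto simp: T_def S_def)
      show "T \<in> lmeasurable" unfolding T_def using Vl ng by (intro fmeasurable.Un) (auto intro: negligible_imp_measurable)
      have "measure lebesgue T = measure lebesgue V"
        unfolding T_def using ng Vl by (intro measure_Un_null_set) (auto simp: negligible_iff_null_sets)
      also have "\<dots> = m" by (simp add: m_def)
      finally show "measure lebesgue T \<le> \<eta>" using m\<eta> by simp
    qed
  qed
  then have "negligible (\<Union>n::nat. {x. ?P x \<and> \<bar>x\<bar> < real n})" 
    by (auto simp: negligible_iff_null_sets)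
  moreover have "{x. ?P x} \<subseteq> (\<Union>n::nat. {x. ?P x \<and> \<bar>x\<bar> < real n})"
    using reals_Archimedean2 by fastforce
  ultimately show ?thesis by (rule negligible_subset)
qed

lemma AE_lebesgue_point:
  fixes w :: "real \<Rightarrow> real"
  assumes [measurable]: "w \<in> borel_measurable borel"
    and loc: "\<And>R. (\<integral>\<^sup>+x\<in>{-R..R}. ennreal \<bar>w x\<bar> \<partial>lborel) < \<infinity>"
  shows "AE x in lborel. \<forall>\<eta>>0. \<exists>s>0. \<forall>h. 0 < h \<and> h < s \<longrightarrow>
    (\<integral>\<^sup>+y\<in>cball x h. ennreal \<bar>w y - w x\<bar> \<partial>lborel) \<le> ennreal (\<eta> * (2 * h))"
proof -
  define P where "P = (\<lambda>(q::real, c::real, d::real) x. ennreal \<bar>w x - q\<bar> < c \<and>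
    (\<forall>s>0. \<exists>h>0. h < s \<and> ennreal (d * (2 * h)) \<le> (\<integral>\<^sup>+y\<in>cball x h. ennreal \<bar>w y - q\<bar> \<partial>lborel)))"
  define Q where "Q = (\<rat> :: real set) \<times> {(c::real, d). c \<in> \<rat> \<and> d \<in> \<rat> \<and> 0 \<le> c \<and> c < d}"
  have cQ: "countable Q"
  proof (rule countable_subset)
    show "Q \<subseteq> \<rat> \<times> \<rat> \<times> \<rat>" by (auto simp: Q_def)
  qed (intro countable_SIGMA countable_rat)
  have "AE x in lebesgue. \<not> P i x" if iQ: "i \<in> Q" for i
  proof -
    obtain q c d where i: "i = (q,c,d)" "0 \<le> c" "c < d" using iQ by (cases i) (auto simp: Q_def)
    have "(\<integral>\<^sup>+x\<in>{-R..R}. ennreal \<bar>w x - q\<bar> \<partial>lborel) < \<infinity>" for R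
    proof -
      have "(\<integral>\<^sup>+x\<in>{-R..R}. ennreal \<bar>w x - q\<bar> \<partial>lborel) 
        \<le> (\<integral>\<^sup>+x. ennreal \<bar>w x\<bar> * indicator {-R..R} x + ennreal \<bar>q\<bar> * indicator {-R..R} x \<partial>lborel)"
        by (intro nn_integral_mono) (auto simp: indicator_def simp flip: ennreal_plus intro!: ennreal_leI)
      also have "\<dots> = (\<integral>\<^sup>+x\<in>{-R..R}. ennreal \<bar>w x\<bar> \<partial>lborel) + ennreal \<bar>q\<bar> * emeasure lborel {-R..R}"
        by (subst nn_integral_add) (auto simp: nn_integral_cmult)
      also have "\<dots> < \<infinity>" using loc[of R] emeasure_lborel_Icc_eq[of "-R" R] by (auto simp: ennreal_mult_less_top)
      finally show ?thesis .
    qed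
    then have "negligible {x. P i x}"
      unfolding i(1) P_def prod.case by (intro null_upper_density i) auto
    then have "{x. P i x} \<in> null_sets lebesgue" by (simp add: negligible_iff_null_sets)
    then show ?thesis by (rule AE_I'[of "{x. P i x}"]) auto
  qed
  then have "AE x in lebesgue. \<forall>i\<in>Q. \<not> P i x" using cQ by (simp add: AE_ball_countable)
  then have "AE x in lborel. \<forall>i\<in>Q. \<not> P i x" by (simp add: AE_completion_iff)
  then show ?thesis
  proof (rule AE_mp, intro AE_I2 impI allI)
    fix x \<eta> :: real assume Q: "\<forall>i\<in>Q. \<not> P i x" and \<eta>: "0 < \<eta>"
    \<comment> \<open>The rationals satisfy
      \<open>\<bar>w x - q\<bar> < c < \<eta> / 4 < d < \<eta> / 2\<close>. Averages of
      \<open>\<bar>w - q\<bar>\<close> then stay below \<open>d\<close> on small balls, and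
      replacing \<open>q\<close> by \<open>w x\<close> costs at most \<open>\<eta> / 4\<close>
      more.\<close>
    obtain q where q: "q \<in> \<rat>" "\<bar>w x - q\<bar> < \<eta> / 4"
      using Rats_dense_in_real[of "w x" "w x + \<eta> / 4"] \<eta> by auto
    obtain c where c: "c \<in> \<rat>" "\<bar>w x - q\<bar> < c" "c < \<eta> / 4" using Rats_dense_in_real[OF q(2)] by auto
    obtain d where d: "d \<in> \<rat>" "\<eta> / 4 < d" "d < \<eta> / 2" using Rats_dense_in_real[of "\<eta>/4" "\<eta>/2"] \<eta> by auto
    have "(q, c, d) \<in> Q" using q c d by (auto simp: Q_def)
    then have "\<not> P (q, c, d) x" using Q by blast
    moreover have "ennreal \<bar>w x - q\<bar> < ennreal c" using c by (simp add: ennreal_lessI)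
    ultimately have "\<exists>s>0. \<forall>h>0. h < s \<longrightarrow> (\<integral>\<^sup>+y\<in>cball x h. ennreal \<bar>w y - q\<bar> \<partial>lborel) < ennreal (d * (2 * h))"
      unfolding P_def prod.case by (auto simp add: not_le)
    then obtain s where s: "s > 0" "\<And>h. 0 < h \<Longrightarrow> h < s \<Longrightarrow> (\<integral>\<^sup>+y\<in>cball x h. ennreal \<bar>w y - q\<bar> \<partial>lborel) < ennreal (d * (2 * h))"
      by blast
    show "\<exists>s>0. \<forall>h. 0 < h \<and> h < s \<longrightarrow> (\<integral>\<^sup>+y\<in>cball x h. ennreal \<bar>w y - w x\<bar> \<partial>lborel) \<le> ennreal (\<eta> * (2 * h))"
    proof (intro exI[of _ s] conjI allI impI s(1))
      fix h assume h: "0 < h \<and> h < s"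
      have [measurable]: "cball x h \<in> sets borel" by simp
      have "(\<integral>\<^sup>+y\<in>cball x h. ennreal \<bar>w y - w x\<bar> \<partial>lborel) 
        \<le> (\<integral>\<^sup>+y. ennreal \<bar>w y - q\<bar> * indicator (cball x h) y + ennreal (\<eta>/4) * indicator (cball x h) y \<partial>lborel)"
      proof (intro nn_integral_mono)
        fix y
        have "\<bar>w y - w x\<bar> \<le> \<bar>w y - q\<bar> + \<eta>/4" using q(2) by linarith
        then show "ennreal \<bar>w y - w x\<bar> * indicator (cball x h) y \<le> ennreal \<bar>w y - q\<bar> * indicator (cball x h) y + ennreal (\<eta>/4) * indicator (cball x h) y"
          using \<eta> by (auto simp: indicator_def simp flip: ennreal_plus intro!: ennreal_leI)
      qed
      also have "\<dots> = (\<integral>\<^sup>+y\<in>cball x h. ennreal \<bar>w y - q\<bar> \<partial>lborel) + ennreal (\<eta>/4) * emeasure lborel (cball x h)"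
        by (subst nn_integral_add) (auto simp: nn_integral_cmult)
      also have "\<dots> \<le> ennreal (d * (2 * h)) + ennreal (\<eta>/4) * ennreal (2 * h)"
        using s(2)[of h] h by (intro add_mono) (auto simp: cball_eq_atLeastAtMost less_imp_le)
      also have "\<dots> = ennreal (d * (2 * h)) + ennreal (\<eta>/4 * (2 * h))"
        using h \<eta> by (subst ennreal_mult[symmetric]) auto
      also have "\<dots> = ennreal (d * (2 * h) + \<eta>/4 * (2 * h))"
        using h d \<eta> by (subst ennreal_plus) auto
      also have "\<dots> \<le> ennreal (\<eta> * (2 * h))"
      proof (rule ennreal_leI)
        have "(d + \<eta>/4) * (2 * h) \<le> \<eta> * (2 * h)" using h d \<eta> by (intro mult_right_mono) auto
        then show "d * (2 * h) + \<eta>/4 * (2 * h) \<le> \<eta> * (2 * h)" by (simp add: algebra_simps)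
      qed
      finally show "(\<integral>\<^sup>+y\<in>cball x h. ennreal \<bar>w y - w x\<bar> \<partial>lborel) \<le> ennreal (\<eta> * (2 * h))" .
    qed
  qed
qed

text \<open>The superlevel sets of the Poisson kernel are intervals centred at \<open>x\<close>, so its layer cake decomposition
  reduces the claim to averages over such intervals.\<close>

lemma nn_integral_poisson_near_le:
  fixes k :: "real \<Rightarrow> ennreal"
  assumes [measurable]: "k \<in> borel_measurable borel" and e: "e > 0" and \<eta>: "\<eta> \<ge> 0" and s: "s > 0"
    and k: "\<And>h. 0 < h \<Longrightarrow> h < s \<Longrightarrow> (\<integral>\<^sup>+y\<in>cball x h. k y \<partial>lborel) \<le> ennreal (\<eta> * (2 * h))"
    and h1: "0 < h1" "h1 < s"
  shows "(\<integral>\<^sup>+y\<in>cball x h1. ennreal (poisson e (x - y)) * k y \<partial>lborel) \<le> ennreal \<eta>"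
proof -
  define B where "B = (\<lambda>l. {y. \<bar>x - y\<bar> \<le> h1 \<and> l < poisson e (x - y)})"
  have [measurable, simp]: "B l \<in> sets borel" for l unfolding B_def by measurable
  have Bm: "{(l, y). y \<in> B l} \<in> sets (borel \<Otimes>\<^sub>M borel)"
  proof -
    have "{(l, y). y \<in> B l} = {p \<in> space (borel \<Otimes>\<^sub>M borel). \<bar>x - snd p\<bar> \<le> h1 \<and> fst p < poisson e (x - snd p)}"
      by (auto simp: B_def space_pair_measure)
    also have "\<dots> \<in> sets (borel \<Otimes>\<^sub>M borel)" by measurable
    finally show ?thesis .
  qed
  have layer: "ennreal (poisson e (x - y)) * indicator (cball x h1) y = (\<integral>\<^sup>+l\<in>{0..}. indicator (B l) y \<partial>lborel)" for y
  proof (cases "\<bar>x - y\<bar> \<le> h1")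
    case True
    have "(\<integral>\<^sup>+l\<in>{0..}. indicator (B l) y \<partial>lborel) = (\<integral>\<^sup>+l. indicator {0..<poisson e (x - y)} l \<partial>lborel)"
      using True by (intro nn_integral_cong) (auto simp: B_def indicator_def)
    then show ?thesis using True poisson_nonneg[OF e] by (simp add: dist_real_def)
  next
    case False
    then show ?thesis by (auto simp: B_def dist_real_def)
  qed
  have Bk: "(\<integral>\<^sup>+y. k y * indicator (B l) y \<partial>lborel) \<le> ennreal \<eta> * emeasure lborel (B l)" if l: "0 < l" for l
  proof -
    \<comment> \<open>The square of the radius of the superlevel set of the kernel at height
      \<open>l\<close>; the set is empty if this is not positive.\<close>
    define a where "a = e / (pi * l) - e^2"
    have iff: "l < poisson e (x - y) \<longleftrightarrow> (x - y)^2 < a" for y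
    proof -
      have "(x - y)^2 + e^2 > 0" using e by (simp add: add_nonneg_pos)
      then have "l < poisson e (x - y) \<longleftrightarrow> l * (pi * ((x - y)^2 + e^2)) < e"
        unfolding poisson_def by (intro pos_less_divide_eq) simp
      also have "\<dots> \<longleftrightarrow> (x - y)^2 + e^2 < e / (pi * l)"
        using l by (subst pos_less_divide_eq) (auto simp: mult_ac)
      finally show ?thesis unfolding a_def by linarith
    qed
    show ?thesis
    proof (cases "a \<le> 0")
      case True
      then have "B l = {}" using iff by (auto simp: B_def) (meson dual_order.trans not_less zero_le_power2)
      then show ?thesis by simp
    next
      case False
      define r where "r = min h1 (sqrt a)"
      have r: "0 < r" "r < s" using False h1 by (auto simp: r_def)
      have iff2: "(x - y)^2 < a \<longleftrightarrow> \<bar>x - y\<bar> < sqrt a" for y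
        using real_sqrt_less_iff[of "(x-y)^2" a] by simp
      \<comment> \<open>\<open>B l\<close> lies between \<open>ball x r\<close> and
        \<open>cball x r\<close>, and both have length \<open>2 * r\<close>.\<close>
      have "(\<integral>\<^sup>+y. k y * indicator (B l) y \<partial>lborel) \<le> (\<integral>\<^sup>+y\<in>cball x r. k y \<partial>lborel)"
        by (intro nn_integral_mono) (auto simp: indicator_def B_def iff iff2 r_def dist_real_def)
      also have "\<dots> \<le> ennreal (\<eta> * (2 * r))" using k r by auto
      also have "\<dots> = ennreal \<eta> * emeasure lborel (ball x r)"
        using r \<eta> by (simp add: ball_eq_greaterThanLessThan ennreal_mult)
      also have "\<dots> \<le> ennreal \<eta> * emeasure lborel (B l)"
        by (intro mult_left_mono emeasure_mono) (auto simp: B_def iff iff2 r_def dist_real_def)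
      finally show ?thesis .
    qed
  qed
  have [measurable]: "Measurable.pred borel (\<lambda>l. y \<in> B l)" for y unfolding B_def by measurable
  have [measurable]: "Measurable.pred (borel \<Otimes>\<^sub>M borel) (\<lambda>x. fst x \<in> B (snd x))" unfolding B_def by measurable
  have im: "(\<lambda>(l, y). indicator (B l) y :: ennreal) \<in> borel_measurable (borel \<Otimes>\<^sub>M borel)"
  proof -
    have "(\<lambda>(l, y). indicator (B l) y :: ennreal) = indicator {(l, y). y \<in> B l}" by (auto simp: indicator_def fun_eq_iff)
    then show ?thesis using Bm by simp
  qed
  have [measurable]: "(\<lambda>(l, y). k y * (indicator (B l) y * indicator {0..} l)) \<in> borel_measurable (lborel \<Otimes>\<^sub>M lborel)"
    using im by measurable
  have "(\<integral>\<^sup>+y\<in>cball x h1. ennreal (poisson e (x - y)) * k y \<partial>lborel) = (\<integral>\<^sup>+y. k y * (\<integral>\<^sup>+l\<in>{0..}. indicator (B l) y \<partial>lborel) \<partial>lborel)"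
    unfolding layer[symmetric] by (intro nn_integral_cong) (auto simp: mult_ac)
  also have "\<dots> = (\<integral>\<^sup>+y. (\<integral>\<^sup>+l. k y * (indicator (B l) y * indicator {0..} l) \<partial>lborel) \<partial>lborel)"
    using im by (intro nn_integral_cong nn_integral_cmult[symmetric]) measurable
  also have "\<dots> = (\<integral>\<^sup>+l. (\<integral>\<^sup>+y. k y * (indicator (B l) y * indicator {0..} l) \<partial>lborel) \<partial>lborel)"
    by (rule lborel_pair.Fubini') simp
  also have "\<dots> \<le> (\<integral>\<^sup>+l. ennreal \<eta> * (emeasure lborel (B l) * indicator {0..} l) \<partial>lborel)"
  \<comment> \<open>The level \<open>l = 0\<close> is discarded as a null set, since
    \<open>Bk\<close> divides by \<open>l\<close>.\<close>
  proof (rule nn_integral_mono_AE, rule AE_mp[OF AE_lborel_singleton[of 0]], intro AE_I2 impI)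
    fix l :: real assume "l \<noteq> 0"
    show "(\<integral>\<^sup>+y. k y * (indicator (B l) y * indicator {0..} l) \<partial>lborel) \<le> ennreal \<eta> * (emeasure lborel (B l) * indicator {0..} l)"
      using Bk[of l] \<open>l \<noteq> 0\<close> by (cases "l < 0") auto
  qed
  also have "\<dots> = (\<integral>\<^sup>+l. (\<integral>\<^sup>+y. ennreal \<eta> * (indicator (B l) y * indicator {0..} l) \<partial>lborel) \<partial>lborel)"
    by (intro nn_integral_cong) (simp add: nn_integral_cmult nn_integral_multc)
  also have "\<dots> = (\<integral>\<^sup>+y. (\<integral>\<^sup>+l. ennreal \<eta> * (indicator (B l) y * indicator {0..} l) \<partial>lborel) \<partial>lborel)"
    using im by (intro lborel_pair.Fubini') measurable
  also have "\<dots> = (\<integral>\<^sup>+y. ennreal \<eta> * (ennreal (poisson e (x - y)) * indicator (cball x h1) y) \<partial>lborel)"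
    unfolding layer using im by (intro nn_integral_cong nn_integral_cmult) measurable
  also have "\<dots> \<le> (\<integral>\<^sup>+y. ennreal \<eta> * ennreal (poisson e (x - y)) \<partial>lborel)"
    by (intro nn_integral_mono) (auto simp: indicator_def)
  also have "\<dots> = ennreal \<eta> * (\<integral>\<^sup>+y. ennreal (poisson e (x - y)) \<partial>lborel)"
    by (rule nn_integral_cmult) simp
  also have "(\<integral>\<^sup>+y. ennreal (poisson e (x - y)) \<partial>lborel) = 1"
    using has_bochner_integral_poisson[OF e, of x] poisson_nonneg[OF e] 
    by (subst nn_integral_eq_integral) (auto simp: has_bochner_integral_iff)
  finally show ?thesis by simp
qed

lemma tendsto_0_ennreal_I:
  assumes "\<And>r::real. r > 0 \<Longrightarrow> eventually (\<lambda>x. f x < ennreal r) F"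
  shows "(f \<longlongrightarrow> (0::ennreal)) F"
proof (rule order_tendstoI)
  fix a :: ennreal assume "0 < a"
  then obtain b where b: "0 < b" "b < a" using dense by blast
  then obtain r where r: "b = ennreal r" "r \<ge> 0" by (cases b) auto
  then have "r > 0" using b by (auto simp: less_le)
  from assms[OF this] show "eventually (\<lambda>x. f x < a) F" using b r by (auto elim!: eventually_mono)
qed auto

text \<open>One quantity that controls two errors: it bounds both
  \<open>poisson_conv f e x - f x\<close> and \<open>hilbert_trunc f e x - conj_conv f e x\<close>.
  Lebesgue points enter only through its convergence to 0.\<close>

definition poisson_dev :: "(real \<Rightarrow> real) \<Rightarrow> real \<Rightarrow> real \<Rightarrow> ennreal" where
  "poisson_dev f x e = (\<integral>\<^sup>+y. ennreal (poisson e (x - y) * \<bar>f y - f x\<bar>) \<partial>lborel)"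

text \<open>The Poisson integral is split at a small distance \<open>h1\<close> from a Lebesgue
  point. The near part is at most \<open>\<eta>\<close>, and the far part is at most a multiple of
  \<open>e\<close>. Integrability is assumed only against the Poisson kernel of height 1, because
  this is what is known of the boundary function of the conjugate integrals.\<close>

lemma AE_poisson_lebesgue_point:
  fixes w :: "real \<Rightarrow> real"
  assumes [measurable]: "w \<in> borel_measurable borel"
    and loc: "\<And>x. (\<integral>\<^sup>+y. ennreal (poisson 1 (x - y) * \<bar>w y\<bar>) \<partial>lborel) < \<infinity>"
  shows "AE x in lborel. (poisson_dev w x \<longlongrightarrow> 0) (at_right 0)"
proof -
  have loc': "(\<integral>\<^sup>+x\<in>{-R..R}. ennreal \<bar>w x\<bar> \<partial>lborel) < \<infinity>" for R
  proof -
    define C where "C = pi * (R^2 + 1)"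
    have C: "C > 0" by (simp add: C_def add_nonneg_pos)
    have "(\<integral>\<^sup>+x\<in>{-R..R}. ennreal \<bar>w x\<bar> \<partial>lborel) \<le> (\<integral>\<^sup>+y. ennreal C * ennreal (poisson 1 (0 - y) * \<bar>w y\<bar>) \<partial>lborel)"
    proof (intro nn_integral_mono)
      fix y
      show "ennreal \<bar>w y\<bar> * indicator {-R..R} y \<le> ennreal C * ennreal (poisson 1 (0 - y) * \<bar>w y\<bar>)"
      proof (cases "y \<in> {-R..R}")
        case True
        then have "y^2 \<le> R^2" by (auto simp: abs_le_square_iff[symmetric])
        moreover have p: "y^2 + 1 > 0" by (simp add: add_nonneg_pos)
        moreover have "C * poisson 1 (0 - y) = (R^2 + 1) / (y^2 + 1)" by (simp add: poisson_def C_def)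
        ultimately have "1 \<le> C * poisson 1 (0 - y)" by simp
        then have "\<bar>w y\<bar> \<le> C * poisson 1 (0 - y) * \<bar>w y\<bar>" by (simp add: mult_left_le mult_le_cancel_right1)
        then show ?thesis using True C by (simp add: ennreal_mult'[symmetric] mult.assoc ennreal_leI)
      qed simp
    qed
    also have "\<dots> = ennreal C * (\<integral>\<^sup>+y. ennreal (poisson 1 (0 - y) * \<bar>w y\<bar>) \<partial>lborel)"
      by (rule nn_integral_cmult) measurable
    also have "\<dots> < \<infinity>" using loc[of 0] by (simp add: ennreal_mult_less_top)
    finally show ?thesis .
  qed
  have "AE x in lborel. \<forall>\<eta>>0. \<exists>s>0. \<forall>h. 0 < h \<and> h < s \<longrightarrow>
    (\<integral>\<^sup>+y\<in>cball x h. ennreal \<bar>w y - w x\<bar> \<partial>lborel) \<le> ennreal (\<eta> * (2 * h))"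
    by (rule AE_lebesgue_point) (use loc' in auto)
  then show ?thesis
  proof (rule AE_mp, intro AE_I2 impI)
    fix x assume *: "\<forall>\<eta>>0. \<exists>s>0. \<forall>h. 0 < h \<and> h < s \<longrightarrow>
      (\<integral>\<^sup>+y\<in>cball x h. ennreal \<bar>w y - w x\<bar> \<partial>lborel) \<le> ennreal (\<eta> * (2 * h))"
    define k where "k = (\<lambda>y. ennreal \<bar>w y - w x\<bar>)"
    have [measurable]: "k \<in> borel_measurable borel" unfolding k_def by measurable
    define M where "M = (\<integral>\<^sup>+y. ennreal (poisson 1 (x - y)) * k y \<partial>lborel)"
    have Mfin: "M < \<infinity>"
    proof -
      have "M \<le> (\<integral>\<^sup>+y. ennreal (poisson 1 (x - y) * \<bar>w y\<bar>) + ennreal \<bar>w x\<bar> * ennreal (poisson 1 (x - y)) \<partial>lborel)"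
        unfolding M_def k_def 
      proof (intro nn_integral_mono)
        fix y
        have "poisson 1 (x - y) * \<bar>w y - w x\<bar> \<le> poisson 1 (x - y) * (\<bar>w y\<bar> + \<bar>w x\<bar>)"
          by (intro mult_left_mono poisson_nonneg) auto
        then show "ennreal (poisson 1 (x - y)) * ennreal \<bar>w y - w x\<bar> \<le> ennreal (poisson 1 (x - y) * \<bar>w y\<bar>) + ennreal \<bar>w x\<bar> * ennreal (poisson 1 (x - y))"
          by (simp add: ennreal_mult'[symmetric] poisson_nonneg ennreal_leI algebra_simps flip: ennreal_plus)
      qed
      also have "\<dots> = (\<integral>\<^sup>+y. ennreal (poisson 1 (x - y) * \<bar>w y\<bar>) \<partial>lborel) + ennreal \<bar>w x\<bar> * (\<integral>\<^sup>+y. ennreal (poisson 1 (x - y)) \<partial>lborel)"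
        by (subst nn_integral_add) (auto simp: nn_integral_cmult)
      also have "(\<integral>\<^sup>+y. ennreal (poisson 1 (x - y)) \<partial>lborel) = 1"
        using has_bochner_integral_poisson[of 1 x] poisson_nonneg[of 1] 
        by (subst nn_integral_eq_integral) (auto simp: has_bochner_integral_iff)
      finally show ?thesis using loc[of x] by (auto simp: less_top[symmetric] top_unique)
    qed
    define m where "m = enn2real M"
    have m: "M = ennreal m" "m \<ge> 0" using Mfin by (auto simp: m_def)
    have near: "\<exists>C\<ge>0. \<forall>e. 0 < e \<and> e \<le> 1 \<longrightarrow> (\<integral>\<^sup>+y. ennreal (poisson e (x - y)) * k y \<partial>lborel) \<le> ennreal (\<eta> + C * e)" if \<eta>: "\<eta> > 0" for \<eta> :: real
    proof -
      obtain s where s: "s > 0" "\<And>h. 0 < h \<Longrightarrow> h < s \<Longrightarrow> (\<integral>\<^sup>+y\<in>cball x h. k y \<partial>lborel) \<le> ennreal (\<eta> * (2 * h))"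
      proof -
        from *[rule_format, OF \<eta>] obtain s where "s > 0" "\<forall>h. 0 < h \<and> h < s \<longrightarrow> (\<integral>\<^sup>+y\<in>cball x h. k y \<partial>lborel) \<le> ennreal (\<eta> * (2 * h))"
          unfolding k_def by (elim exE conjE)
        then show ?thesis using that by simp
      qed
      define h1 where "h1 = s / 2"
      have h1: "0 < h1" "h1 < s" using s by (auto simp: h1_def)
      have [measurable]: "cball x h1 \<in> sets borel" by simp
      \<comment> \<open>Chosen such that \<open>(x - y)^2 + 1 \<le> C * (x - y)^2\<close> at
        distance at least \<open>h1\<close>; hence the kernel of height \<open>e\<close> is at most
        \<open>e * C\<close> times the one of height 1 there.\<close>
      define C where "C = 1 + 1 / h1^2"
      have C: "C > 0" by (simp add: C_def add_pos_nonneg)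
      have "(\<integral>\<^sup>+y. ennreal (poisson e (x - y)) * k y \<partial>lborel) \<le> ennreal (\<eta> + C * m * e)" if e: "0 < e" "e \<le> 1" for e
      proof -
        have far: "poisson e (x - y) \<le> e * C * poisson 1 (x - y)" if "\<not> \<bar>x - y\<bar> \<le> h1" for y
        proof -
          define z where "z = (x - y)^2"
          have z: "h1^2 \<le> z" "h1^2 > 0" unfolding z_def using that h1 by (auto simp: abs_le_square_iff[symmetric])
          have "z + 1 \<le> C * z" using z unfolding C_def by (simp add: field_simps)
          also have "\<dots> \<le> C * (z + e^2)" using C by simp
          finally have "z + 1 \<le> C * (z + e^2)" .
          moreover have "z > 0" using z by linarith
          then have "0 < z + e^2" "0 < z + 1" by (auto intro: add_pos_nonneg)
          ultimately have "1 / (z + e^2) \<le> C / (z + 1)" by (simp add: divide_le_eq le_divide_eq mult.commute)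
          then have "(e / pi) * (1 / (z + e^2)) \<le> (e / pi) * (C / (z + 1))" using e by (intro mult_left_mono) auto
          then show ?thesis by (simp add: poisson_def z_def)
        qed
        have "(\<integral>\<^sup>+y. ennreal (poisson e (x - y)) * k y \<partial>lborel)
          \<le> (\<integral>\<^sup>+y. ennreal (poisson e (x - y)) * k y * indicator (cball x h1) y + ennreal (e * C) * (ennreal (poisson 1 (x - y)) * k y) \<partial>lborel)"
        proof (intro nn_integral_mono)
          fix y
          show "ennreal (poisson e (x - y)) * k y \<le> ennreal (poisson e (x - y)) * k y * indicator (cball x h1) y + ennreal (e * C) * (ennreal (poisson 1 (x - y)) * k y)"
          proof (cases "\<bar>x - y\<bar> \<le> h1")
            case True then show ?thesis by (simp add: dist_real_def)
          next
            case False
            have "ennreal (poisson e (x - y)) \<le> ennreal (e * C * poisson 1 (x - y))" using far[OF False] by (rule ennreal_leI)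
            also have "\<dots> = ennreal (e * C) * ennreal (poisson 1 (x - y))" using e C by (simp add: ennreal_mult poisson_nonneg)
            finally have "ennreal (poisson e (x - y)) * k y \<le> ennreal (e * C) * ennreal (poisson 1 (x - y)) * k y" by (intro mult_right_mono) auto
            then show ?thesis by (simp add: mult.assoc add_increasing)
          qed
        qed
        also have "\<dots> = (\<integral>\<^sup>+y\<in>cball x h1. ennreal (poisson e (x - y)) * k y \<partial>lborel) + ennreal (e * C) * M"
          unfolding M_def by (subst nn_integral_add) (auto simp: nn_integral_cmult)
        also have "\<dots> \<le> ennreal \<eta> + ennreal (e * C) * M"
          by (intro add_right_mono nn_integral_poisson_near_le[where s=s] e(1) s h1) (use \<eta> in auto)
        also have "\<dots> = ennreal (\<eta> + C * m * e)"
          using e C m \<eta> by (simp add: ennreal_mult'[symmetric] ennreal_plus[symmetric] mult_ac del: ennreal_plus)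
        finally show ?thesis .
      qed
      then show ?thesis using C m by (intro exI[of _ "C * m"]) auto
    qed
    have "((\<lambda>e. \<integral>\<^sup>+y. ennreal (poisson e (x - y)) * k y \<partial>lborel) \<longlongrightarrow> 0) (at_right 0)"
    proof (rule tendsto_0_ennreal_I)
      fix r :: real assume r: "r > 0"
      obtain C where C: "C \<ge> 0" "\<And>e. 0 < e \<Longrightarrow> e \<le> 1 \<Longrightarrow> (\<integral>\<^sup>+y. ennreal (poisson e (x - y)) * k y \<partial>lborel) \<le> ennreal (r/2 + C * e)"
        using near[of "r/2"] r by auto
      define b where "b = min 1 (r / (2 * (C + 1)))"
      have b: "b > 0" using r C by (simp add: b_def)
      show "eventually (\<lambda>e. (\<integral>\<^sup>+y. ennreal (poisson e (x - y)) * k y \<partial>lborel) < ennreal r) (at_right 0)"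
        unfolding eventually_at_right_field
      proof (intro exI[of _ b] conjI allI impI b)
        fix e assume e: "0 < e" "e < b"
        have "C * e \<le> (C + 1) * e" using e by simp
        also have "\<dots> < (C + 1) * (r / (2 * (C + 1)))" using e C by (intro mult_strict_left_mono) (auto simp: b_def)
        also have "\<dots> = r / 2"
        proof -
          have "c * (r / (2 * c)) = r / 2" if "c > 0" for c using that by simp
          from this[of "C + 1"] show ?thesis using C(1) by simp
        qed
        finally have "r / 2 + C * e < r" by simp
        then have "ennreal (r/2 + C * e) < ennreal r" using r by (intro ennreal_lessI) auto
        then show "(\<integral>\<^sup>+y. ennreal (poisson e (x - y)) * k y \<partial>lborel) < ennreal r"
          using C(2)[of e] e by (auto simp: b_def)
      qed
    qed
    moreover have "poisson_dev w x e = (\<integral>\<^sup>+y. ennreal (poisson e (x - y)) * k y \<partial>lborel)" if "e > 0" for e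
      unfolding k_def poisson_dev_def using that by (simp add: ennreal_mult'[symmetric] poisson_nonneg)
    ultimately show "(poisson_dev w x \<longlongrightarrow> 0) (at_right 0)"
      by (subst filterlim_cong[OF refl refl]) (auto intro: eventually_at_right_less simp: eventually_at_filter)
  qed
qed

subsection \<open>Existence of principal values\<close>

text \<open>Fubini for kernels whose \<open>L\<^sup>1\<close> norm in the first variable is
  uniformly bounded. The last conclusion has the form of the hypothesis on the kernel, so that
  applications can be nested.\<close>

lemma kernel_Fubini:
  fixes k :: "real \<Rightarrow> real \<Rightarrow> real"
  assumes km [measurable]: "case_prod k \<in> borel_measurable (borel \<Otimes>\<^sub>M borel)" and g: "integrable lborel g"
    and k: "\<And>z. integrable lborel (\<lambda>x. k x z)" "\<And>z. (LINT x|lborel. \<bar>k x z\<bar>) \<le> C"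
  shows "integrable lborel (\<lambda>x. LINT z|lborel. k x z * g z)"
    "(LINT x|lborel. LINT z|lborel. k x z * g z) = (LINT z|lborel. (LINT x|lborel. k x z) * g z)"
    "(LINT x|lborel. \<bar>LINT z|lborel. k x z * g z\<bar>) \<le> C * (LINT z|lborel. \<bar>g z\<bar>)"
proof -
  have [measurable]: "g \<in> borel_measurable borel" using g by auto
  have C0: "C \<ge> 0" using k(2)[of 0] by (rule order_trans[rotated]) (intro integral_nonneg_AE, auto)
  have I: "(LINT x|lborel. \<bar>k x z * g z\<bar>) = (LINT x|lborel. \<bar>k x z\<bar>) * \<bar>g z\<bar>" for z
    by (simp add: abs_mult)
  have m2: "integrable lborel (\<lambda>z. (LINT x|lborel. \<bar>k x z\<bar>) * \<bar>g z\<bar>)"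
  proof (rule Bochner_Integration.integrable_bound)
    show "integrable lborel (\<lambda>z. C * g z)" using g by simp
    show "(\<lambda>z. (LINT x|lborel. \<bar>k x z\<bar>) * \<bar>g z\<bar>) \<in> borel_measurable lborel" by measurable
    have "\<bar>LINT x|lborel. \<bar>k x z\<bar>\<bar> \<le> C" for z
      using k(2)[of z] by (subst abs_of_nonneg) (auto intro!: integral_nonneg_AE)
    then show "AE z in lborel. norm ((LINT x|lborel. \<bar>k x z\<bar>) * \<bar>g z\<bar>) \<le> norm (C * g z)"
      using C0 by (auto simp: abs_mult intro!: mult_right_mono)
  qed
  have int: "integrable (lborel \<Otimes>\<^sub>M lborel) (\<lambda>(z, x). k x z * g z)"
  proof (rule lborel_pair.Fubini_integrable)
    show "integrable lborel (\<lambda>z. LINT x|lborel. norm (case (z, x) of (z, x) \<Rightarrow> k x z * g z))"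
      using m2 by (simp add: I)
    show "AE z in lborel. integrable lborel (\<lambda>x. case (z, x) of (z, x) \<Rightarrow> k x z * g z)"
      using k(1) by auto
  qed measurable
  show "integrable lborel (\<lambda>x. LINT z|lborel. k x z * g z)"
    using lborel_pair.integrable_snd[OF int] by simp
  show "(LINT x|lborel. LINT z|lborel. k x z * g z) = (LINT z|lborel. (LINT x|lborel. k x z) * g z)"
    using lborel_pair.Fubini_integral[OF int] by simp
  have inta: "integrable (lborel \<Otimes>\<^sub>M lborel) (\<lambda>(z, x). \<bar>k x z * g z\<bar>)"
    using integrable_norm[OF int] by (simp add: case_prod_beta')
  have "(LINT x|lborel. \<bar>LINT z|lborel. k x z * g z\<bar>) \<le> (LINT x|lborel. LINT z|lborel. \<bar>k x z * g z\<bar>)"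
    using lborel_pair.integrable_snd[OF int] lborel_pair.integrable_snd[OF inta]
    by (intro integral_mono) auto
  also have "\<dots> = (LINT z|lborel. LINT x|lborel. \<bar>k x z * g z\<bar>)"
    using lborel_pair.Fubini_integral[OF inta] by simp
  also have "\<dots> = (LINT z|lborel. (LINT x|lborel. \<bar>k x z\<bar>) * \<bar>g z\<bar>)" by (simp add: I)
  also have "\<dots> \<le> (LINT z|lborel. C * \<bar>g z\<bar>)"
    using m2 g k(2) by (intro integral_mono) (auto intro!: mult_right_mono)
  finally show "(LINT x|lborel. \<bar>LINT z|lborel. k x z * g z\<bar>) \<le> C * (LINT z|lborel. \<bar>g z\<bar>)" by simp
qed

lemma conj_conv_semigroup:
  assumes "e > 0" "d > 0" "integrable lborel f"
  shows "(LINT y|lborel. poisson e (x - y) * conj_conv f d y) = conj_conv f (e + d) x"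
proof -
  have "(LINT y|lborel. LINT z|lborel. (poisson e (x - y) * conj_poisson d (y - z)) * f z)
     = (LINT z|lborel. (LINT y|lborel. poisson e (x - y) * conj_poisson d (y - z)) * f z)"
  proof (rule kernel_Fubini(2)[OF _ assms(3)])
    show i: "integrable lborel (\<lambda>y. poisson e (x - y) * conj_poisson d (y - z))" for z
      using poisson_convolution_conj_poisson[OF assms(1,2)] by (auto simp: has_bochner_integral_iff)
    define c where "c = 1 / (pi * d)"
    show "(LINT y|lborel. \<bar>poisson e (x - y) * conj_poisson d (y - z)\<bar>) \<le> c" for z
    proof -
      have "(LINT y|lborel. \<bar>poisson e (x - y) * conj_poisson d (y - z)\<bar>) \<le> (LINT y|lborel. poisson e (x - y) * c)"
        using i has_bochner_integral_poisson[OF assms(1), of x] abs_conj_poisson_le[OF assms(2), folded c_def] poisson_nonneg[OF assms(1)]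
        by (intro integral_mono integrable_abs) (auto simp: has_bochner_integral_iff abs_mult intro!: mult_left_mono)
      also have "\<dots> = c"
        using has_bochner_integral_poisson[OF assms(1), of x] by (simp add: has_bochner_integral_iff)
      finally show ?thesis .
    qed
  qed measurable
  moreover have "(LINT y|lborel. poisson e (x - y) * conj_poisson d (y - z)) = conj_poisson (e + d) (x - z)" for z
    using poisson_convolution_conj_poisson[OF assms(1,2)] by (auto simp: has_bochner_integral_iff)
  ultimately show ?thesis by (simp add: conj_conv_def mult.assoc)
qed

text \<open>Two nested applications of Fubini reduce the pairing to
  \<open>conj_poisson_convolution\<close>. Since the right-hand side depends only on
  \<open>d + e\<close> and converges as this sum tends to 0 for bounded \<open>f\<close>, squared
  \<open>L\<^sup>2\<close> distances of conjugate integrals become small.\<close>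

lemma has_bochner_integral_conj_conv_mult:
  assumes e: "e > 0" and d: "d > 0" and f: "integrable lborel f"
  shows "has_bochner_integral lborel (\<lambda>x. conj_conv f d x * conj_conv f e x) (LINT y|lborel. f y * poisson_conv f (d + e) y)"
proof -
  have [measurable]: "f \<in> borel_measurable borel" using f by auto
  \<comment> \<open>The sum of the squared \<open>L\<^sup>2\<close> norms of the two kernels, again
    by \<open>conj_poisson_convolution\<close>; it bounds the integral of the product because
    \<open>\<bar>p * q\<bar> \<le> p * p + q * q\<close>.\<close>
  define C where "C = poisson (d + d) 0 + poisson (e + e) 0"
  have i: "integrable lborel (\<lambda>x. conj_poisson d (x - y) * conj_poisson e (x - z))" for y z
    using conj_poisson_convolution[OF d e] by (auto simp: has_bochner_integral_iff)
  have iC: "(LINT x|lborel. \<bar>conj_poisson d (x - y) * conj_poisson e (x - z)\<bar>) \<le> C" for y z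
  proof -
    have D: "has_bochner_integral lborel (\<lambda>x. conj_poisson d (x - y) * conj_poisson d (x - y) + conj_poisson e (x - z) * conj_poisson e (x - z)) C"
      unfolding C_def using conj_poisson_convolution[OF d d, of y y] conj_poisson_convolution[OF e e, of z z]
      by (intro has_bochner_integral_add) auto
    have "\<bar>p * q\<bar> \<le> p * p + q * q" for p q :: real
      using sum_squares_bound[of "\<bar>p\<bar>" "\<bar>q\<bar>"] mult_nonneg_nonneg[of "\<bar>p\<bar>" "\<bar>q\<bar>"] unfolding power2_abs power2_eq_square abs_mult by linarith
    then have "(LINT x|lborel. \<bar>conj_poisson d (x - y) * conj_poisson e (x - z)\<bar>) \<le> 
       (LINT x|lborel. conj_poisson d (x - y) * conj_poisson d (x - y) + conj_poisson e (x - z) * conj_poisson e (x - z))"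
      using i D by (intro integral_mono integrable_abs) (auto simp: has_bochner_integral_iff)
    then show ?thesis using D by (simp add: has_bochner_integral_iff)
  qed
  have P: "(LINT x|lborel. conj_poisson d (x - y) * conj_poisson e (x - z)) = poisson (d + e) (y - z)" for y z
    using conj_poisson_convolution[OF d e] by (auto simp: has_bochner_integral_iff)
  have v: "(LINT z|lborel. conj_poisson d (x - y) * conj_poisson e (x - z) * f z) = conj_poisson d (x - y) * conj_conv f e x" for x y
    by (simp add: conj_conv_def mult.assoc)
  have km: "(\<lambda>(x, z). conj_poisson d (x - y) * conj_poisson e (x - z)) \<in> borel_measurable (borel \<Otimes>\<^sub>M borel)" for y
    by measurable
  note K = kernel_Fubini[OF km f i iC, unfolded v P]
  have u: "(LINT x|lborel. conj_poisson d (x - y) * conj_conv f e x) = poisson_conv f (d + e) y" for y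
    using K(2)[of y] by (simp add: poisson_conv_def)
  have km2: "(\<lambda>(x, y). conj_poisson d (x - y) * conj_conv f e x) \<in> borel_measurable (borel \<Otimes>\<^sub>M borel)"
    by measurable
  have v2: "(LINT y|lborel. conj_poisson d (x - y) * conj_conv f e x * f y) = conj_conv f d x * conj_conv f e x" for x
  proof -
    have "(LINT y|lborel. conj_poisson d (x - y) * conj_conv f e x * f y) = (LINT y|lborel. conj_conv f e x * (conj_poisson d (x - y) * f y))"
      by (simp add: mult_ac)
    also have "\<dots> = conj_conv f e x * (LINT y|lborel. conj_poisson d (x - y) * f y)" by (rule integral_mult_right_zero)
    finally show ?thesis by (simp add: conj_conv_def[of f d] mult.commute)
  qed
  note K2 = kernel_Fubini[OF km2 f K(1) K(3), unfolded v2 u]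
  show ?thesis using K2(1,2) by (simp add: has_bochner_integral_iff mult.commute)
qed

lemma poisson_conv_minus:
  assumes e: "e > 0" and f: "integrable lborel f"
  shows "ennreal \<bar>poisson_conv f e x - f x\<bar> \<le> poisson_dev f x e"
proof -
  have P: "integrable lborel (\<lambda>y. poisson e (x - y))" "(LINT y|lborel. poisson e (x - y)) = 1"
    using has_bochner_integral_poisson[OF e, of x] by (auto simp: has_bochner_integral_iff)
  have i: "integrable lborel (\<lambda>y. poisson e (x - y) * (f y - f x))"
    using integrable_poisson_mult[OF e f, of x] P by (simp add: right_diff_distrib)
  have "poisson_conv f e x - f x = (LINT y|lborel. poisson e (x - y) * (f y - f x))"
    unfolding poisson_conv_def using integrable_poisson_mult[OF e f, of x] P by (simp add: right_diff_distrib)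
  then have "\<bar>poisson_conv f e x - f x\<bar> \<le> (LINT y|lborel. \<bar>poisson e (x - y) * (f y - f x)\<bar>)"
    by simp
  also have "\<dots> = (LINT y|lborel. poisson e (x - y) * \<bar>f y - f x\<bar>)"
    using poisson_nonneg[OF e] by (simp add: abs_mult)
  finally have "ennreal \<bar>poisson_conv f e x - f x\<bar> \<le> ennreal (LINT y|lborel. poisson e (x - y) * \<bar>f y - f x\<bar>)" by (rule ennreal_leI)
  also have "\<dots> = poisson_dev f x e"
    unfolding poisson_dev_def using integrable_abs[OF i] poisson_nonneg[OF e] by (subst nn_integral_eq_integral) (auto simp: abs_mult)
  finally show ?thesis .
qed

lemma nn_integral_poisson_finite:
  assumes f: "integrable lborel f"
  shows "(\<integral>\<^sup>+y. ennreal (poisson 1 (x - y) * \<bar>f y\<bar>) \<partial>lborel) < \<infinity>"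
  using integrable_poisson_mult[OF zero_less_one integrable_abs[OF f], of x] poisson_nonneg[of 1]
  by (subst nn_integral_eq_integral) auto

lemma AE_lebesgue_point_integrable:
  assumes f: "integrable lborel f"
  shows "AE x in lborel. (poisson_dev f x \<longlongrightarrow> 0) (at_right 0)"
  using f nn_integral_poisson_finite[OF f] by (intro AE_poisson_lebesgue_point) auto

lemma tendsto_0_ennreal_abs:
  assumes "((\<lambda>e. g e) \<longlongrightarrow> (0::ennreal)) F" "eventually (\<lambda>e. ennreal \<bar>h e\<bar> \<le> g e) F"
  shows "(h \<longlongrightarrow> (0::real)) F"
proof (rule tendsto_rabs_zero_cancel, rule order_tendstoI)
  fix a :: real assume "0 < a"
  then have "eventually (\<lambda>e. g e < ennreal a) F" using order_tendstoD(2)[OF assms(1), of "ennreal a"] by simp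
  then show "eventually (\<lambda>e. \<bar>h e\<bar> < a) F" using assms(2)
  proof eventually_elim
    case (elim e)
    then have "ennreal \<bar>h e\<bar> < ennreal a" by (rule le_less_trans[rotated])
    then show ?case by (simp add: ennreal_less_iff)
  qed
qed (simp add: less_le_trans[OF _ abs_ge_zero])

lemma eventually_at_right_0_pos: "eventually (\<lambda>e::real. e > 0) (at_right 0)"
  by (auto simp: eventually_at_filter)

lemma AE_poisson_conv_tendsto:
  assumes f: "integrable lborel f"
  shows "AE x in lborel. ((\<lambda>e. poisson_conv f e x) \<longlongrightarrow> f x) (at_right 0)"
  using AE_lebesgue_point_integrable[OF f]
proof (rule AE_mp, intro AE_I2 impI)
  fix x assume *: "(poisson_dev f x \<longlongrightarrow> 0) (at_right 0)"
  have "((\<lambda>e. poisson_conv f e x - f x) \<longlongrightarrow> 0) (at_right 0)"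
    by (rule tendsto_0_ennreal_abs[OF *]) (use poisson_conv_minus[OF _ f] eventually_at_right_0_pos in \<open>auto elim: eventually_mono\<close>)
  then show "((\<lambda>e. poisson_conv f e x) \<longlongrightarrow> f x) (at_right 0)" by (simp add: LIM_zero_iff)
qed

lemma abs_poisson_conv_le:
  assumes e: "e > 0" and f: "integrable lborel f" and B: "\<And>y. \<bar>f y\<bar> \<le> B"
  shows "\<bar>poisson_conv f e x\<bar> \<le> B"
proof -
  have "\<bar>poisson_conv f e x\<bar> \<le> (LINT y|lborel. poisson e (x - y) * B)"
    unfolding poisson_conv_def real_norm_def[symmetric]
    using has_bochner_integral_poisson[OF e, of x] integrable_poisson_mult[OF e f, of x] B poisson_nonneg[OF e]
    by (intro Bochner_Integration.integral_norm_bound_integral) (auto simp: has_bochner_integral_iff abs_mult intro!: mult_left_mono)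
  then show ?thesis using has_bochner_integral_poisson[OF e, of x] by (simp add: has_bochner_integral_iff)
qed

lemma integral_poisson_conv_mult_tendsto:
  assumes f: "integrable lborel f" and B: "\<And>y. \<bar>f y\<bar> \<le> B"
  shows "((\<lambda>e. LINT y|lborel. f y * poisson_conv f e y) \<longlongrightarrow> (LINT y|lborel. f y * f y)) (at_right 0)"
proof (rule tendsto_at_right_sequentially[of 0 1])
  fix S :: "nat \<Rightarrow> real" assume S: "\<And>n. 0 < S n" "S \<longlonglongrightarrow> 0"
  have [measurable]: "f \<in> borel_measurable borel" using f by auto
  have S0: "filterlim S (at_right 0) sequentially"
    using S(2) by (simp add: filterlim_at S(1) less_imp_neq[OF S(1), symmetric])
  show "(\<lambda>n. LINT y|lborel. f y * poisson_conv f (S n) y) \<longlonglongrightarrow> (LINT y|lborel. f y * f y)"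
  proof (rule integral_dominated_convergence[where w="\<lambda>y. B * \<bar>f y\<bar>"])
    show "AE x in lborel. (\<lambda>i. f x * poisson_conv f (S i) x) \<longlonglongrightarrow> f x * f x"
      using AE_poisson_conv_tendsto[OF f] by (auto elim!: eventually_mono intro!: tendsto_mult filterlim_compose[OF _ S0])
    show "AE x in lborel. norm (f x * poisson_conv f (S n) x) \<le> B * \<bar>f x\<bar>" for n
      using abs_poisson_conv_le[OF S(1) f B] by (auto simp: abs_mult mult.commute[of B] intro!: mult_left_mono)
  qed (use f in auto)
qed simp

lemma conj_conv_continuous_at_right:
  assumes e: "e > 0" and f: "integrable lborel f" and d: "\<And>n. d n > 0" "d \<longlonglongrightarrow> 0"
  shows "(\<lambda>n. conj_conv f (e + d n) x) \<longlonglongrightarrow> conj_conv f e x"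
proof -
  have "continuous_on {z. Im z > 0} (cauchy_transform f)"
    by (rule holomorphic_on_imp_continuous_on[OF cauchy_transform_holomorphic[OF f]])
  then have "isCont (cauchy_transform f) (Complex x e)"
    using e by (intro continuous_on_interior[of "{z. Im z > 0}"]) (auto simp: interior_open open_halfspace_Im_gt)
  moreover have "(\<lambda>n. Complex x (e + d n)) \<longlonglongrightarrow> Complex x (e + 0)"
    unfolding Complex_eq by (intro tendsto_intros d)
  ultimately have "(\<lambda>n. cauchy_transform f (Complex x (e + d n))) \<longlonglongrightarrow> cauchy_transform f (Complex x e)"
    by (auto intro: isCont_tendsto_compose)
  from tendsto_Re[OF this] have "(\<lambda>n. pi * conj_conv f (e + d n) x) \<longlonglongrightarrow> pi * conj_conv f e x"
    using e d by (simp add: cauchy_transform_eq[OF f] add_pos_pos)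
  from tendsto_divide[OF this tendsto_const[of pi]] show ?thesis by simp
qed

text \<open>The functions \<open>conj_conv f e\<close> are Cauchy in \<open>L\<^sup>2\<close> as \<open>e \<rightarrow> 0\<close>; a rapidly convergent subsequence
  converges almost everywhere, and by the semigroup property its limit has \<open>conj_conv f e\<close> as
  Poisson integrals.\<close>

lemma conj_conv_boundary_function:
  assumes f: "integrable lborel f" and B: "\<And>y. \<bar>f y\<bar> \<le> B"
  obtains w where "w \<in> borel_measurable borel"
    "\<And>e x. e > 0 \<Longrightarrow> integrable lborel (\<lambda>y. poisson e (x - y) * w y)"
    "\<And>e x. e > 0 \<Longrightarrow> conj_conv f e x = (LINT y|lborel. poisson e (x - y) * w y)"
proof -
  have [measurable]: "f \<in> borel_measurable borel" using f by auto
  define \<phi> where "\<phi> = (\<lambda>e. LINT y|lborel. f y * poisson_conv f e y)"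
  define L where "L = (LINT y|lborel. f y * f y)"
  have lim: "(\<phi> \<longlongrightarrow> L) (at_right 0)" unfolding \<phi>_def L_def by (rule integral_poisson_conv_mult_tendsto[OF f B])
  \<comment> \<open>The squared \<open>L\<^sup>2\<close> distance of two consecutive functions is a
    combination of four values of \<open>\<phi>\<close> at sums of heights, which explains the range
    up to \<open>2 * d\<close>. Each value is within \<open>(1/4)^n\<close> of \<open>L\<close>, so
    the distance squared is at most \<open>4 * (1/4)^n\<close>.\<close>
  define P where "P = (\<lambda>n d. 0 < d \<and> d \<le> 1 / (real n + 1) \<and> (\<forall>s. 0 < s \<and> s \<le> 2 * d \<longrightarrow> \<bar>\<phi> s - L\<bar> \<le> (1/4)^n))"
  have ex: "\<exists>d. P n d \<and> d \<le> b" if "b > 0" for n b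
  proof -
    have "eventually (\<lambda>s. dist (\<phi> s) L < (1/4)^n) (at_right 0)" by (rule tendstoD[OF lim]) simp
    then obtain c where c: "c > 0" "\<And>s. 0 < s \<Longrightarrow> s < c \<Longrightarrow> \<bar>\<phi> s - L\<bar> < (1/4)^n"
      unfolding eventually_at_right_field by (auto simp: dist_real_def)
    show ?thesis using c that
      by (intro exI[of _ "min b (min (1 / (real n + 1)) (c/3))"]) (auto simp: P_def min_def intro!: less_imp_le)
  qed
  obtain d where d: "\<And>n. P n (d n)" "\<And>n. d (Suc n) \<le> d n"
  proof -
    have "\<exists>d. P 0 d" using ex[of 1 0] by auto
    moreover have "\<exists>y. P (Suc n) y \<and> y \<le> x" if "P n x" for n x using that by (intro ex) (auto simp: P_def)
    ultimately obtain d where "\<forall>n. P n (d n) \<and> d (Suc n) \<le> d n"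
      using dependent_nat_choice[of P "\<lambda>n x y. y \<le> x"] by metis
    then show ?thesis using that by auto
  qed
  have dpos: "d n > 0" for n using d(1)[of n] by (simp add: P_def)
  have d0: "d \<longlonglongrightarrow> 0"
  proof (rule tendsto_sandwich[OF _ _ tendsto_const])
    show "\<forall>\<^sub>F n in sequentially. d n \<le> 1 / (real n + 1)" using d(1) by (auto simp: P_def)
    show "\<forall>\<^sub>F n in sequentially. 0 \<le> d n" by (simp add: less_imp_le[OF dpos])
    show "(\<lambda>n. 1 / (real n + 1)) \<longlonglongrightarrow> 0" by real_asymp
  qed
  define v where "v = (\<lambda>n. conj_conv f (d n))"
  define D where "D = (\<lambda>n x. v (Suc n) x - v n x)"
  have [measurable]: "v n \<in> borel_measurable borel" "D n \<in> borel_measurable borel" for n unfolding D_def v_def by measurable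
  have ivv: "has_bochner_integral lborel (\<lambda>x. v i x * v j x) (\<phi> (d i + d j))" for i j
    unfolding v_def \<phi>_def by (rule has_bochner_integral_conj_conv_mult[OF dpos dpos f])
  have DD: "(\<integral>\<^sup>+x. ennreal ((D n x)^2) \<partial>lborel) \<le> ennreal (4 * (1/4)^n)" for n
  proof -
    have "has_bochner_integral lborel (\<lambda>x. v (Suc n) x * v (Suc n) x - v (Suc n) x * v n x - (v n x * v (Suc n) x - v n x * v n x))
       (\<phi> (d (Suc n) + d (Suc n)) - \<phi> (d (Suc n) + d n) - (\<phi> (d n + d (Suc n)) - \<phi> (d n + d n)))"
      by (intro has_bochner_integral_diff ivv)
    also have "(\<lambda>x. v (Suc n) x * v (Suc n) x - v (Suc n) x * v n x - (v n x * v (Suc n) x - v n x * v n x)) = (\<lambda>x. (D n x)^2)"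
      by (auto simp: D_def power2_eq_square algebra_simps)
    finally have hb: "has_bochner_integral lborel (\<lambda>x. (D n x)^2)
       (\<phi> (d (Suc n) + d (Suc n)) - \<phi> (d (Suc n) + d n) - (\<phi> (d n + d (Suc n)) - \<phi> (d n + d n)))" .
    have "\<bar>\<phi> s - L\<bar> \<le> (1/4)^n" if "0 < s" "s \<le> 2 * d n" for s using d(1)[of n] that by (simp add: P_def)
    from this[of "d (Suc n) + d (Suc n)"] this[of "d (Suc n) + d n"] this[of "d n + d (Suc n)"] this[of "d n + d n"]
    have "\<phi> (d (Suc n) + d (Suc n)) - \<phi> (d (Suc n) + d n) - (\<phi> (d n + d (Suc n)) - \<phi> (d n + d n)) \<le> 4 * (1/4)^n"
      using d(2)[of n] dpos[of n] dpos[of "Suc n"] by (simp only: abs_le_iff) linarith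
    then show ?thesis using hb by (subst nn_integral_eq_integral) (auto simp: has_bochner_integral_iff intro!: ennreal_leI)
  qed
  \<comment> \<open>The weight \<open>2^n\<close> still leaves a summable series of integrals, and
    it gives absolute convergence through
    \<open>\<bar>D n x\<bar> \<le> (1/2)^n + 2^n * (D n x)^2\<close>.\<close>
  define S where "S = (\<lambda>x. \<Sum>n. ennreal (2^n * (D n x)^2))"
  have [measurable]: "S \<in> borel_measurable borel" unfolding S_def by measurable
  have Sfin: "(\<integral>\<^sup>+x. S x \<partial>lborel) < \<infinity>"
  proof -
    have "(\<integral>\<^sup>+x. S x \<partial>lborel) = (\<Sum>n. \<integral>\<^sup>+x. ennreal (2^n * (D n x)^2) \<partial>lborel)"
      unfolding S_def by (rule nn_integral_suminf) measurable
    also have "\<dots> \<le> (\<Sum>n. ennreal (4 * (1/2)^n))"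
    proof (intro suminf_le allI)
      fix n
      have "(\<integral>\<^sup>+x. ennreal (2^n * (D n x)^2) \<partial>lborel) = ennreal (2^n) * (\<integral>\<^sup>+x. ennreal ((D n x)^2) \<partial>lborel)"
        by (subst nn_integral_cmult[symmetric]) (auto simp: ennreal_mult)
      also have "\<dots> \<le> ennreal (2^n) * ennreal (4 * (1/4)^n)" by (intro mult_left_mono DD) auto
      also have "\<dots> = ennreal (4 * (2^n * (1/4)^n))" by (subst ennreal_mult[symmetric]) (auto simp: mult_ac)
      also have "(2::real)^n * (1/4)^n = (1/2)^n" by (simp flip: power_mult_distrib)
      finally show "(\<integral>\<^sup>+x. ennreal (2^n * (D n x)^2) \<partial>lborel) \<le> ennreal (4 * (1/2)^n)" .
    qed auto
    also have "\<dots> = ennreal (\<Sum>n. 4 * (1/2)^n)"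
      by (intro suminf_ennreal2 summable_mult summable_geometric) auto
    also have "\<dots> < \<infinity>" by simp
    finally show ?thesis .
  qed
  define s where "s = (\<lambda>x. enn2real (S x))"
  have [measurable]: "s \<in> borel_measurable borel" unfolding s_def by measurable
  have AES: "AE x in lborel. S x = ennreal (s x)"
  proof -
    have "AE x in lborel. S x \<noteq> \<infinity>" using Sfin by (intro nn_integral_noteq_infinite) auto
    then show ?thesis
    proof eventually_elim
      case (elim x)
      then show ?case by (simp add: s_def less_top)
    qed
  qed
  have s_int: "integrable lborel s"
  proof (rule integrableI_bounded)
    have "(\<integral>\<^sup>+x. ennreal (norm (s x)) \<partial>lborel) = (\<integral>\<^sup>+x. S x \<partial>lborel)"
    proof (rule nn_integral_cong_AE)
      show "AE x in lborel. ennreal (norm (s x)) = S x"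
        using AES
      proof eventually_elim
        case (elim x)
        then show ?case by (simp add: s_def)
      qed
    qed
    then show "(\<integral>\<^sup>+x. ennreal (norm (s x)) \<partial>lborel) < \<infinity>" using Sfin by simp
  qed simp
  \<comment> \<open>A majorant of all \<open>v n\<close>: 2 is the sum of the geometric series, 1
    comes from \<open>\<bar>v 0 x\<bar> \<le> 1 + v 0 x * v 0 x\<close>. As a constant plus an
    integrable function it is integrable against every Poisson kernel.\<close>
  define h where "h = (\<lambda>x. 3 + (v 0 x * v 0 x + s x))"
  have conv: "AE x in lborel. convergent (\<lambda>n. v n x) \<and> (\<forall>n. \<bar>v n x\<bar> \<le> h x)"
    using AES
  proof (rule AE_mp, intro AE_I2 impI conjI allI)
    fix x assume Sx: "S x = ennreal (s x)"
    have s1: "summable (\<lambda>n. 2^n * (D n x)^2)" and s2: "(\<Sum>n. 2^n * (D n x)^2) = s x"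
    proof -
      have "(\<Sum>n. ennreal (2^n * (D n x)^2)) = ennreal (s x)" using Sx unfolding S_def .
      then have "(\<Sum>n. ennreal (2^n * (D n x)^2)) \<noteq> top" by (simp only: ennreal_neq_top not_False_eq_True)
      then show sm: "summable (\<lambda>n. 2^n * (D n x)^2)"
        by (rule summable_suminf_not_top[rotated]) simp
      then have "S x = ennreal (\<Sum>n. 2^n * (D n x)^2)" unfolding S_def by (intro suminf_ennreal2) auto
      then show "(\<Sum>n. 2^n * (D n x)^2) = s x" 
        using suminf_nonneg[OF sm] by (simp add: s_def)
    qed
    have Dle: "\<bar>D n x\<bar> \<le> (1/2)^n + 2^n * (D n x)^2" for n
    proof (cases "\<bar>D n x\<bar> \<le> (1/2)^n")
      case True then show ?thesis by (simp add: add_increasing2)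
    next
      case False
      then have "(1/2)^n * \<bar>D n x\<bar> \<le> \<bar>D n x\<bar> * \<bar>D n x\<bar>" by (intro mult_right_mono) auto
      then have "2^n * ((1/2)^n * \<bar>D n x\<bar>) \<le> 2^n * (\<bar>D n x\<bar> * \<bar>D n x\<bar>)" by (intro mult_left_mono) auto
      moreover have "2^n * ((1/2)^n * \<bar>D n x\<bar>) = \<bar>D n x\<bar>" by (simp add: power_one_over)
      ultimately have "\<bar>D n x\<bar> \<le> 2^n * (D n x)^2" by (simp add: power2_eq_square)
      then show ?thesis by (simp add: add_increasing)
    qed
    have sm: "summable (\<lambda>n. (1/2)^n + 2^n * (D n x)^2)" using s1 by (intro summable_add summable_geometric) auto
    have sD: "summable (\<lambda>n. \<bar>D n x\<bar>)"
      by (rule summable_comparison_test'[OF sm]) (use Dle in auto)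
    have tel: "v n x = v 0 x + (\<Sum>i<n. D i x)" for n
      by (induction n) (auto simp: D_def)
    have "summable (\<lambda>n. D n x)" using sD by (rule summable_rabs_cancel)
    then have "(\<lambda>n. v 0 x + (\<Sum>i<n. D i x)) \<longlonglongrightarrow> v 0 x + (\<Sum>i. D i x)"
      by (intro tendsto_add tendsto_const summable_LIMSEQ)
    then show "convergent (\<lambda>n. v n x)" unfolding tel[symmetric] by (auto simp: convergent_def)
    fix n
    have "\<bar>\<Sum>i<n. D i x\<bar> \<le> (\<Sum>i<n. \<bar>D i x\<bar>)" by (rule sum_abs)
    also have "\<dots> \<le> (\<Sum>i. \<bar>D i x\<bar>)" by (rule sum_le_suminf[OF sD]) auto
    also have "\<dots> \<le> (\<Sum>n. (1/2)^n + 2^n * (D n x)^2)" by (rule suminf_le[OF Dle sD sm])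
    also have "\<dots> = (\<Sum>n. (1/2)^n) + s x" using s1 s2 by (subst suminf_add[symmetric]) (auto intro: summable_geometric)
    also have "(\<Sum>n. (1/2::real)^n) = 2" by (subst suminf_geometric) auto
    finally have "\<bar>\<Sum>i<n. D i x\<bar> \<le> 2 + s x" .
    moreover have "\<bar>v 0 x\<bar> \<le> 1 + v 0 x * v 0 x"
      using sum_squares_bound[of "\<bar>v 0 x\<bar>" 1] by (simp add: power2_eq_square)
    ultimately show "\<bar>v n x\<bar> \<le> h x" unfolding tel[of n] h_def by linarith
  qed
  define w where "w = (\<lambda>x. lim (\<lambda>n. v n x))"
  have wm [measurable]: "w \<in> borel_measurable borel" unfolding w_def by measurable
  have vw: "AE x in lborel. (\<lambda>n. v n x) \<longlonglongrightarrow> w x" 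
    using conv by (auto simp: w_def convergent_LIMSEQ_iff elim!: eventually_mono)
  have Ph: "integrable lborel (\<lambda>y. poisson e (x - y) * h y)" if e: "e > 0" for e x
  proof -
    have "integrable lborel (\<lambda>y. 3 * poisson e (x - y) + poisson e (x - y) * (v 0 y * v 0 y + s y))"
      using has_bochner_integral_poisson[OF e, of x] ivv[of 0 0] s_int
      by (intro Bochner_Integration.integrable_add integrable_poisson_mult e) (auto simp: has_bochner_integral_iff)
    then show ?thesis by (simp add: h_def algebra_simps)
  qed
  have wh: "AE x in lborel. \<bar>w x\<bar> \<le> h x"
    using vw conv
  proof eventually_elim
    case (elim x)
    then show ?case by (intro Lim_bounded[of "\<lambda>n. \<bar>v n x\<bar>"] tendsto_rabs) auto
  qed
  have Pw: "integrable lborel (\<lambda>y. poisson e (x - y) * w y)" if e: "e > 0" for e x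
  proof (rule Bochner_Integration.integrable_bound[OF Ph[OF e, of x]])
    show "AE y in lborel. norm (poisson e (x - y) * w y) \<le> norm (poisson e (x - y) * h y)"
      using wh poisson_nonneg[OF e] by (auto simp: abs_mult elim!: eventually_mono intro!: mult_left_mono)
  qed measurable
  have "conj_conv f e x = (LINT y|lborel. poisson e (x - y) * w y)" if e: "e > 0" for e x
  proof -
    have "(\<lambda>n. LINT y|lborel. poisson e (x - y) * v n y) \<longlonglongrightarrow> (LINT y|lborel. poisson e (x - y) * w y)"
    proof (rule integral_dominated_convergence[OF _ _ Ph[OF e, of x]])
      show "AE y in lborel. (\<lambda>n. poisson e (x - y) * v n y) \<longlonglongrightarrow> poisson e (x - y) * w y"
        using vw by (auto elim!: eventually_mono intro!: tendsto_intros)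
      show "AE y in lborel. norm (poisson e (x - y) * v n y) \<le> poisson e (x - y) * h y" for n
        using conv
      proof eventually_elim
        case (elim y)
        then have "\<bar>v n y\<bar> \<le> h y" by blast
        then show ?case using poisson_nonneg[OF e] by (simp add: abs_mult mult_left_mono)
      qed
    qed measurable
    then have "(\<lambda>n. conj_conv f (e + d n) x) \<longlonglongrightarrow> (LINT y|lborel. poisson e (x - y) * w y)"
      unfolding v_def by (simp add: conj_conv_semigroup[OF e dpos f])
    with conj_conv_continuous_at_right[OF e f dpos d0] show ?thesis by (rule LIMSEQ_unique)
  qed
  then show ?thesis using that[OF wm Pw] by blast
qed

text \<open>The truncated kernel minus the conjugate Poisson kernel of the same height is odd, so
  constants may be subtracted from \<open>f\<close>; and it is dominated by the Poisson kernel,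
  inside the truncation as well as outside.\<close>

lemma hilbert_trunc_minus_conj_conv:
  assumes e: "e > 0" and f: "integrable lborel f" and [measurable]: "f \<in> borel_measurable borel"
  shows "ennreal \<bar>hilbert_trunc f e x - conj_conv f e x\<bar> \<le> poisson_dev f x e"
proof -
  define k where "k = (\<lambda>s. (if e < \<bar>s\<bar> then 1 / (pi * s) else 0) - conj_poisson e s)"
  have [measurable]: "k \<in> borel_measurable borel" unfolding k_def by measurable
  have kP: "\<bar>k s\<bar> \<le> poisson e s" for s
  proof -
    have q: "s^2 + e^2 > 0" using e by (simp add: add_nonneg_pos)
    show ?thesis
    proof (cases "e < \<bar>s\<bar>")
      case True
      then have s0: "s \<noteq> 0" using e by auto
      have "k s = e^2 / (pi * s * (s^2 + e^2))"
      proof -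
        have "1 / s - s / D = (D - s * s) / (s * D)" if "D \<noteq> 0" for D using that s0 by (simp add: field_simps)
        from this[of "s^2 + e^2"] have "1 / s - s / (s^2 + e^2) = e^2 / (s * (s^2 + e^2))"
          using less_imp_neq[OF q, symmetric] by (simp add: power2_eq_square)
        then have "(1 / s - s / (s^2 + e^2)) / pi = e^2 / (s * (s^2 + e^2)) / pi" by simp
        then show ?thesis using True by (simp add: k_def conj_poisson_def diff_divide_distrib mult_ac)
      qed
      then have "\<bar>k s\<bar> = (e / \<bar>s\<bar>) * poisson e s"
        using e q by (simp add: poisson_def abs_mult power2_eq_square)
      also have "\<dots> \<le> 1 * poisson e s" using True e poisson_nonneg[OF e] by (intro mult_right_mono) auto
      finally show ?thesis by simp
    next
      case False
      then have "\<bar>k s\<bar> = \<bar>s\<bar> / (pi * (s^2 + e^2))" by (simp add: k_def conj_poisson_def abs_mult)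
      also have "\<dots> \<le> e / (pi * (s^2 + e^2))" using False by (intro divide_right_mono) auto
      finally show ?thesis by (simp add: poisson_def)
    qed
  qed
  have P: "integrable lborel (\<lambda>y. poisson e (x - y))" for x
    using has_bochner_integral_poisson[OF e, of x] by (auto simp: has_bochner_integral_iff)
  have ki: "integrable lborel (\<lambda>y. k (x - y))" for x
    by (rule Bochner_Integration.integrable_bound[OF P[of x]]) (use kP poisson_nonneg[OF e] in auto)
  have k0: "(LINT y|lborel. k (x - y)) = 0"
  proof -
    have "(LINT y|lborel. k (x - y)) = (LINT y|lborel. k y)"
      using lborel_integral_real_affine[of "-1" "\<lambda>y. k y" x] by simp
    moreover have "(LINT y|lborel. k y) = (LINT y|lborel. k (- y))"
      using lborel_integral_real_affine[of "-1" "\<lambda>y. k y" 0] by simp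
    moreover have "k (- y) = - k y" for y by (simp add: k_def conj_poisson_def)
    then have "(LINT y|lborel. k (- y)) = - (LINT y|lborel. k y)" by simp
    ultimately show ?thesis by linarith
  qed
  have kb: "\<bar>k s\<bar> \<le> 1 / (pi * e)" for s using kP[of s] poisson_le[OF e, of s] by linarith
  have kf: "integrable lborel (\<lambda>y. k (x - y) * f y)"
    by (rule integrable_bounded_mult[OF f]) (use kb in auto)
  define t where "t = (\<lambda>y. indicator {y. e < \<bar>x - y\<bar>} y * f y / (x - y))"
  have tm: "t \<in> borel_measurable borel" unfolding t_def by measurable
  have tq: "k (x - y) * f y + conj_poisson e (x - y) * f y = t y / pi" for y
    by (simp add: k_def t_def algebra_simps)
  have "hilbert_trunc f e x = (LINT y|lborel. t y) / pi"
    unfolding hilbert_trunc_def t_def[symmetric] using tm by (simp add: integral_completion)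
  also have "\<dots> = (LINT y|lborel. k (x - y) * f y) + conj_conv f e x"
    unfolding conj_conv_def using kf integrable_conj_poisson_mult[OF e f, of x]
    by (subst Bochner_Integration.integral_add[symmetric]) (auto simp: tq)
  finally have "hilbert_trunc f e x - conj_conv f e x = (LINT y|lborel. k (x - y) * f y)" by simp
  also have "\<dots> = (LINT y|lborel. k (x - y) * (f y - f x))"
    using kf ki[of x] k0 by (simp add: right_diff_distrib)
  finally have eq: "hilbert_trunc f e x - conj_conv f e x = (LINT y|lborel. k (x - y) * (f y - f x))" .
  have i: "integrable lborel (\<lambda>y. poisson e (x - y) * \<bar>f y - f x\<bar>)"
  proof -
    have "integrable lborel (\<lambda>y. poisson e (x - y) * (f y - f x))"
      using integrable_poisson_mult[OF e f, of x] P[of x] by (simp add: right_diff_distrib)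
    from integrable_abs[OF this] show ?thesis using poisson_nonneg[OF e] by (simp add: abs_mult)
  qed
  have "\<bar>LINT y|lborel. k (x - y) * (f y - f x)\<bar> \<le> (LINT y|lborel. poisson e (x - y) * \<bar>f y - f x\<bar>)"
    unfolding real_norm_def[symmetric]
  proof (rule Bochner_Integration.integral_norm_bound_integral)
    show "integrable lborel (\<lambda>y. k (x - y) * (f y - f x))"
      using kf ki[of x] by (simp add: right_diff_distrib)
  qed (use i kP in \<open>auto simp: abs_mult intro!: mult_right_mono\<close>)
  then have "ennreal \<bar>LINT y|lborel. k (x - y) * (f y - f x)\<bar> \<le> ennreal (LINT y|lborel. poisson e (x - y) * \<bar>f y - f x\<bar>)" by (rule ennreal_leI)
  also have "\<dots> = poisson_dev f x e"
    unfolding poisson_dev_def using i poisson_nonneg[OF e] by (subst nn_integral_eq_integral) auto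
  finally show ?thesis unfolding eq .
qed

text \<open>At a common Lebesgue point of \<open>f\<close> and of the boundary function
  \<open>w\<close> the conjugate integrals tend to \<open>w x\<close>, and the truncations differ
  from them by a null sequence. Only such convergence gives the \<open>Lim\<close> in the definition
  of \<open>hilbert\<close> a meaning.\<close>

lemma AE_conj_conv_tendsto_hilbert:
  assumes f: "integrable lborel f" and B: "\<And>y. \<bar>f y\<bar> \<le> B"
  shows "AE x in lborel. ((\<lambda>e. conj_conv f e x) \<longlongrightarrow> hilbert f x) (at_right 0)"
proof -
  have fm: "f \<in> borel_measurable borel" using f by auto
  obtain w where wm: "w \<in> borel_measurable borel" and w1: "\<And>e x. e > 0 \<Longrightarrow> integrable lborel (\<lambda>y. poisson e (x - y) * w y)"
    and wv: "\<And>e x. e > 0 \<Longrightarrow> conj_conv f e x = (LINT y|lborel. poisson e (x - y) * w y)"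
    using conj_conv_boundary_function[OF f B] by metis
  have "AE x in lborel. (poisson_dev w x \<longlongrightarrow> 0) (at_right 0)"
  proof (rule AE_poisson_lebesgue_point[OF wm])
    fix x
    show "(\<integral>\<^sup>+y. ennreal (poisson 1 (x - y) * \<bar>w y\<bar>) \<partial>lborel) < \<infinity>"
      using integrable_abs[OF w1[OF zero_less_one, of x]] poisson_nonneg[of 1]
      by (subst nn_integral_eq_integral) (auto simp: abs_mult)
  qed
  then show ?thesis using AE_lebesgue_point_integrable[OF f]
  proof eventually_elim
    case (elim x)
    have "((\<lambda>e. conj_conv f e x - w x) \<longlongrightarrow> 0) (at_right 0)"
    proof (rule tendsto_0_ennreal_abs[OF elim(1)], rule eventually_mono[OF eventually_at_right_0_pos])
      fix e :: real assume e: "e > 0"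
      have P: "integrable lborel (\<lambda>y. poisson e (x - y))" "(LINT y|lborel. poisson e (x - y)) = 1"
        using has_bochner_integral_poisson[OF e, of x] by (auto simp: has_bochner_integral_iff)
      have i: "integrable lborel (\<lambda>y. poisson e (x - y) * (w y - w x))"
        using w1[OF e, of x] P by (simp add: right_diff_distrib)
      have "conj_conv f e x - w x = (LINT y|lborel. poisson e (x - y) * (w y - w x))"
        unfolding wv[OF e] using w1[OF e, of x] P by (simp add: right_diff_distrib)
      then have "\<bar>conj_conv f e x - w x\<bar> \<le> (LINT y|lborel. \<bar>poisson e (x - y) * (w y - w x)\<bar>)" by simp
      also have "\<dots> = (LINT y|lborel. poisson e (x - y) * \<bar>w y - w x\<bar>)"
        using poisson_nonneg[OF e] by (simp add: abs_mult)
      finally have "ennreal \<bar>conj_conv f e x - w x\<bar> \<le> ennreal (LINT y|lborel. poisson e (x - y) * \<bar>w y - w x\<bar>)" by (rule ennreal_leI)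
      also have "\<dots> = poisson_dev w x e"
        unfolding poisson_dev_def using integrable_abs[OF i] poisson_nonneg[OF e] by (subst nn_integral_eq_integral) (auto simp: abs_mult)
      finally show "ennreal \<bar>conj_conv f e x - w x\<bar> \<le> poisson_dev w x e" .
    qed
    then have c: "((\<lambda>e. conj_conv f e x) \<longlongrightarrow> w x) (at_right 0)" by (simp add: LIM_zero_iff)
    have "((\<lambda>e. hilbert_trunc f e x - conj_conv f e x) \<longlongrightarrow> 0) (at_right 0)"
      by (rule tendsto_0_ennreal_abs[OF elim(2)], rule eventually_mono[OF eventually_at_right_0_pos])
        (rule hilbert_trunc_minus_conj_conv[OF _ f fm])
    from tendsto_add[OF this c] have "((\<lambda>e. hilbert_trunc f e x) \<longlongrightarrow> w x) (at_right 0)" by simp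
    then have "hilbert f x = w x" unfolding hilbert_def by (intro tendsto_Lim) auto
    then show ?case using c by simp
  qed
qed

subsection \<open>Set estimates for the conjugate Poisson integral\<close>

text \<open>Beyond the threshold \<open>cosh v - 1 \<ge> exp \<bar>v\<bar> / 4\<close>, which is
  where \<open>L \<ge> 2\<close> enters, and then \<open>exp s \<ge> 1 + s\<close> for the excess
  \<open>s = \<bar>v\<bar> - L\<close>.\<close>

lemma abs_le_cosh: 
  fixes v :: real
  assumes L: "L \<ge> 2"
  shows "\<bar>v\<bar> \<le> L + 4 * exp (- L) * (cosh v - 1)"
proof (cases "\<bar>v\<bar> \<le> L")
  case True
  have "0 \<le> 4 * exp (- L) * (cosh v - 1)" using cosh_real_ge_1[of v] by simp
  then show ?thesis using True by linarith
next
  case False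
  define a where "a = \<bar>v\<bar>"
  have a: "a > L" using False by (simp add: a_def)
  have "cosh v = cosh a" by (simp add: a_def)
  also have "\<dots> = (exp a + exp (-a)) / 2" by (simp add: cosh_field_def)
  finally have ch: "cosh v \<ge> exp a / 2" by simp
  have "(1 + 1)^2 \<le> (exp (1::real))^2" using exp_ge_add_one_self[of 1] by (intro power_mono) auto
  also have "\<dots> = exp 2" by (simp flip: exp_of_nat_mult)
  also have "\<dots> \<le> exp a" using a L by simp
  finally have "exp a \<ge> 4" by simp
  then have "exp a / 4 \<le> cosh v - 1" using ch by simp
  then have "4 * exp (-L) * (exp a / 4) \<le> 4 * exp (-L) * (cosh v - 1)" by (intro mult_left_mono) auto
  moreover have "4 * exp (-L) * (exp a / 4) = exp (a - L)" by (simp add: exp_diff exp_minus field_simps)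
  moreover have "exp (a - L) \<ge> 1 + (a - L)" by (rule exp_ge_add_one_self)
  ultimately have "1 + (a - L) \<le> 4 * exp (-L) * (cosh v - 1)" by linarith
  then show ?thesis unfolding a_def by linarith
qed

lemma set_nn_integral_conj_conv_le:
  assumes e: "e > 0" and f: "integrable lborel f" "\<And>y. 0 \<le> f y" "\<And>y. f y \<le> 1" "(LINT y|lborel. f y) \<le> m"
    and A [measurable]: "A \<in> sets borel" "emeasure lborel A \<le> ennreal t" and t: "t > 0"
  shows "(\<integral>\<^sup>+x\<in>A. ennreal \<bar>conj_conv f e x\<bar> \<partial>lborel) \<le> ennreal (t * (3 + ln (1 + m / t)))"
proof -
  have [measurable]: "f \<in> borel_measurable borel" using f by auto
  define v where "v = conj_conv f e"
  have vm [measurable]: "v \<in> borel_measurable borel" unfolding v_def by measurable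
  have [measurable]: "(\<lambda>x. cosh (v x)) \<in> borel_measurable borel" unfolding cosh_def by measurable
  have "0 \<le> (LINT y|lborel. f y)" using f by (intro integral_nonneg_AE) auto
  then have m: "m \<ge> 0" using f by linarith
  \<comment> \<open>This threshold balances the two contributions: the \<open>cosh\<close> part then
    adds at most \<open>t\<close> to \<open>L * t\<close>.\<close>
  define L where "L = 2 + ln (1 + m / t)"
  have mt: "m / t \<ge> 0" using m t by simp
  have L2: "L \<ge> 2" unfolding L_def using mt by simp
  have "(\<integral>\<^sup>+x\<in>A. ennreal \<bar>v x\<bar> \<partial>lborel) \<le> (\<integral>\<^sup>+x. ennreal L * indicator A x + ennreal (4 * exp (-L)) * ennreal (cosh (v x) - 1) \<partial>lborel)"
  proof (rule nn_integral_mono)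
    fix x
    have "ennreal \<bar>v x\<bar> \<le> ennreal (L + 4 * exp (- L) * (cosh (v x) - 1))" by (intro ennreal_leI abs_le_cosh L2)
    also have "\<dots> = ennreal L + ennreal (4 * exp (-L)) * ennreal (cosh (v x) - 1)"
      using L2 cosh_real_ge_1[of "v x"] by (subst ennreal_plus) (auto simp: ennreal_mult)
    finally show "ennreal \<bar>v x\<bar> * indicator A x \<le> ennreal L * indicator A x + ennreal (4 * exp (-L)) * ennreal (cosh (v x) - 1)"
      by (auto simp: indicator_def)
  qed
  also have "\<dots> = ennreal L * emeasure lborel A + ennreal (4 * exp (-L)) * (\<integral>\<^sup>+x. ennreal (cosh (v x) - 1) \<partial>lborel)"
    by (subst nn_integral_add) (auto simp: nn_integral_cmult)
  also have "\<dots> \<le> ennreal L * ennreal t + ennreal (4 * exp (-L)) * ennreal m"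
  proof (intro add_mono mult_left_mono)
    have "(\<integral>\<^sup>+x. ennreal (cosh (v x) - 1) \<partial>lborel) \<le> ennreal (LINT y|lborel. f y)"
      unfolding v_def by (rule nn_integral_cosh_conj_conv[OF e f(1-3)])
    also have "\<dots> \<le> ennreal m" using f(4) by (rule ennreal_leI)
    finally show "(\<integral>\<^sup>+x. ennreal (cosh (v x) - 1) \<partial>lborel) \<le> ennreal m" .
  qed (use A in auto)
  also have "\<dots> = ennreal (L * t + 4 * exp (-L) * m)"
    using L2 t m by (subst ennreal_plus) (auto simp: ennreal_mult)
  also have "\<dots> \<le> ennreal (t * (3 + ln (1 + m / t)))"
  proof (rule ennreal_leI)
    have "exp (-L) = exp (-2) / (1 + m / t)" using mt by (simp add: L_def exp_diff exp_minus exp_add field_simps)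
    moreover have "4 * exp (-2::real) \<le> 1"
    proof -
      have "(1 + 1)^2 \<le> (exp (1::real))^2" using exp_ge_add_one_self[of 1] by (intro power_mono) auto
      also have "\<dots> = exp 2" by (simp flip: exp_of_nat_mult)
      finally show ?thesis by (simp add: exp_minus field_simps)
    qed
    moreover have "m / (1 + m / t) \<ge> 0" using m mt by simp
    ultimately have "4 * exp (-2) * (m / (1 + m / t)) \<le> 1 * (m / (1 + m / t))" by (intro mult_right_mono)
    moreover have "4 * exp (-L) * m = 4 * exp (-2) * (m / (1 + m / t))" unfolding \<open>exp (-L) = _\<close> by simp
    ultimately have "4 * exp (-L) * m \<le> 1 * (m / (1 + m / t))" by linarith
    also have "\<dots> \<le> t" using t m by (simp add: field_simps)
    finally show "L * t + 4 * exp (- L) * m \<le> t * (3 + ln (1 + m / t))" by (simp add: L_def algebra_simps)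
  qed
  finally show ?thesis by (simp add: v_def)
qed

lemma integrable_indicator_finite:
  assumes "E \<in> sets borel" "emeasure lborel E < \<infinity>"
  shows "integrable lborel (indicator E :: real \<Rightarrow> real)"
  using assms by (auto simp: integrable_indicator_iff)

lemma integrable_bounded_finite_support:
  fixes f :: "real \<Rightarrow> real"
  assumes [measurable]: "f \<in> borel_measurable borel" and B: "\<And>x. \<bar>f x\<bar> \<le> B" and "emeasure lborel {x. f x \<noteq> 0} < \<infinity>"
  shows "integrable lborel f"
proof (rule Bochner_Integration.integrable_bound)
  show "integrable lborel (\<lambda>x. B * indicator {x. f x \<noteq> 0} x)"
    using assms by (intro integrable_mult_right integrable_indicator_finite) auto
  show "AE x in lborel. norm (f x) \<le> norm (B * indicator {x. f x \<noteq> 0} x)"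
    using B by (auto simp: indicator_def intro: order_trans[OF _ abs_ge_self])
qed simp

lemma conj_conv_antisymmetric:
  assumes e: "e > 0" and f: "integrable lborel f" and g: "integrable lborel g" "\<And>x. \<bar>g x\<bar> \<le> 1"
  shows "(LINT x|lborel. g x * conj_conv f e x) = - (LINT y|lborel. f y * conj_conv g e y)"
proof -
  have [measurable]: "f \<in> borel_measurable borel" "g \<in> borel_measurable borel" using f g by auto
  have km: "(\<lambda>(x, y). conj_poisson e (x - y) * g x) \<in> borel_measurable (borel \<Otimes>\<^sub>M borel)" by measurable
  have i: "integrable lborel (\<lambda>x. conj_poisson e (x - y) * g x)" for y
    using abs_conj_poisson_le[OF e] by (intro integrable_bounded_mult[OF g(1), where B="1 / (pi * e)"]) auto
  have b: "(LINT x|lborel. \<bar>conj_poisson e (x - y) * g x\<bar>) \<le> 1 / (pi * e) * (LINT x|lborel. \<bar>g x\<bar>)" for y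
  proof -
    have "(LINT x|lborel. \<bar>conj_poisson e (x - y) * g x\<bar>) \<le> (LINT x|lborel. 1 / (pi * e) * \<bar>g x\<bar>)"
    proof (rule integral_mono)
      show "integrable lborel (\<lambda>x. \<bar>conj_poisson e (x - y) * g x\<bar>)" using i by (rule integrable_abs)
      show "\<bar>conj_poisson e (x - y) * g x\<bar> \<le> 1 / (pi * e) * \<bar>g x\<bar>" for x
        unfolding abs_mult by (intro mult_right_mono abs_conj_poisson_le e) auto
    qed (use g in auto)
    then show ?thesis by simp
  qed
  have "(LINT x|lborel. g x * conj_conv f e x) = (LINT x|lborel. LINT y|lborel. conj_poisson e (x - y) * g x * f y)"
  proof (intro Bochner_Integration.integral_cong refl)
    fix x
    have "g x * conj_conv f e x = (LINT y|lborel. g x * (conj_poisson e (x - y) * f y))"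
      unfolding conj_conv_def by (rule integral_mult_right_zero[symmetric])
    then show "g x * conj_conv f e x = (LINT y|lborel. conj_poisson e (x - y) * g x * f y)" by (simp add: mult_ac)
  qed
  also have "\<dots> = (LINT y|lborel. (LINT x|lborel. conj_poisson e (x - y) * g x) * f y)"
    by (rule kernel_Fubini(2)[OF km f i b])
  also have "\<dots> = (LINT y|lborel. - (f y * conj_conv g e y))"
  proof (intro Bochner_Integration.integral_cong refl)
    fix y
    have "(LINT x|lborel. conj_poisson e (x - y) * g x) = (LINT x|lborel. - (conj_poisson e (y - x) * g x))"
    proof (intro Bochner_Integration.integral_cong refl)
      fix x
      have "conj_poisson e (- s) = - conj_poisson e s" for s by (simp add: conj_poisson_def)
      from this[of "y - x"] show "conj_poisson e (x - y) * g x = - (conj_poisson e (y - x) * g x)" by simp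
    qed
    then show "(LINT x|lborel. conj_poisson e (x - y) * g x) * f y = - (f y * conj_conv g e y)"
      by (simp add: conj_conv_def)
  qed
  finally show ?thesis by simp
qed

text \<open>Antisymmetry of the kernel exchanges the roles of \<open>A\<close> and \<open>E\<close>.\<close>

lemma set_nn_integral_conj_conv_dual_le:
  assumes e: "e > 0" and E [measurable]: "E \<in> sets borel" and Em: "emeasure lborel E \<le> ennreal m" and m: "m > 0"
    and A [measurable]: "A \<in> sets borel" and At: "emeasure lborel A \<le> ennreal t" and t: "t > 0"
  shows "(\<integral>\<^sup>+x\<in>A. ennreal \<bar>conj_conv (indicator E) e x\<bar> \<partial>lborel) \<le> ennreal (2 * (m * (3 + ln (1 + t / m))))"
proof -
  define v where "v = conj_conv (indicator E) e"
  have iE: "integrable lborel (indicator E :: real \<Rightarrow> real)"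
    using Em by (intro integrable_indicator_finite) (auto simp: less_top[symmetric] top_unique)
  have vm [measurable]: "v \<in> borel_measurable borel" unfolding v_def by measurable
  have EI: "(LINT y|lborel. indicator E y) \<le> m" using Em m by (simp add: measure_def enn2real_leI)
  have fin: "(\<integral>\<^sup>+x\<in>A. ennreal \<bar>v x\<bar> \<partial>lborel) < \<infinity>"
    using set_nn_integral_conj_conv_le[OF e iE _ _ EI A At t] unfolding v_def by (rule le_less_trans) auto
  \<comment> \<open>On a set where \<open>v\<close> has one sign the absolute value moves outside
    the integral. Antisymmetry then makes it an integral over \<open>E\<close> of the conjugate
    integral of an indicator, with \<open>m\<close> and \<open>t\<close> interchanged. The two signs
    produce the factor 2.\<close>
  have part: "(\<integral>\<^sup>+x\<in>A \<inter> S. ennreal \<bar>v x\<bar> \<partial>lborel) \<le> ennreal (m * (3 + ln (1 + t / m)))" 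
    if S [measurable]: "S \<in> sets borel" and S': "S = {x. v x > 0} \<or> S = {x. v x < 0}" for S
  proof -
    define g where "g = (indicator (A \<inter> S) :: real \<Rightarrow> real)"
    have AS: "emeasure lborel (A \<inter> S) \<le> ennreal t" using At emeasure_mono[of "A \<inter> S" A lborel] by auto
    have ig: "integrable lborel g" unfolding g_def
      using AS by (intro integrable_indicator_finite) (auto simp: less_top[symmetric] top_unique)
    have gm [measurable]: "g \<in> borel_measurable borel" using ig by auto
    have gt: "(LINT x|lborel. g x) \<le> t" using AS t by (simp add: g_def measure_def enn2real_leI)
    have igv: "integrable lborel (\<lambda>x. \<bar>g x * v x\<bar>)"
    proof (rule integrableI_bounded)
      have "(\<integral>\<^sup>+x. ennreal (norm \<bar>g x * v x\<bar>) \<partial>lborel) \<le> (\<integral>\<^sup>+x\<in>A. ennreal \<bar>v x\<bar> \<partial>lborel)"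
        by (intro nn_integral_mono) (auto simp: g_def indicator_def)
      then show "(\<integral>\<^sup>+x. ennreal (norm \<bar>g x * v x\<bar>) \<partial>lborel) < \<infinity>" using fin by (rule le_less_trans)
    qed measurable
    have "(\<integral>\<^sup>+x\<in>A \<inter> S. ennreal \<bar>v x\<bar> \<partial>lborel) = (\<integral>\<^sup>+x. ennreal \<bar>g x * v x\<bar> \<partial>lborel)"
      by (intro nn_integral_cong) (auto simp: g_def indicator_def)
    also have "\<dots> = ennreal (LINT x|lborel. \<bar>g x * v x\<bar>)"
      using igv by (intro nn_integral_eq_integral) auto
    also have "(LINT x|lborel. \<bar>g x * v x\<bar>) = \<bar>LINT x|lborel. g x * v x\<bar>"
      using S'
    proof
      assume S: "S = {x. v x > 0}"
      then have eq: "\<bar>g x * v x\<bar> = g x * v x" for x by (auto simp: g_def indicator_def)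
      have "0 \<le> (LINT x|lborel. \<bar>g x * v x\<bar>)" by (intro integral_nonneg_AE) auto
      then show ?thesis unfolding eq by simp
    next
      assume S: "S = {x. v x < 0}"
      then have eq: "\<bar>g x * v x\<bar> = - (g x * v x)" for x by (auto simp: g_def indicator_def)
      have "0 \<le> (LINT x|lborel. \<bar>g x * v x\<bar>)" by (intro integral_nonneg_AE) auto
      then show ?thesis unfolding eq by simp
    qed
    also have "\<dots> = \<bar>LINT y|lborel. indicator E y * conj_conv g e y\<bar>"
      unfolding v_def by (subst conj_conv_antisymmetric[OF e iE ig]) (auto simp: g_def)
    also have "ennreal \<dots> \<le> (\<integral>\<^sup>+y. ennreal (norm (indicator E y * conj_conv g e y)) \<partial>lborel)"
    proof (cases "integrable lborel (\<lambda>y. indicator E y * conj_conv g e y)")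
      case True
      then show ?thesis using integral_norm_bound_ennreal[OF True] by simp
    next
      \<comment> \<open>A function that is not integrable has integral 0 by convention, so the bound
        is trivial.\<close>
      case False
      then show ?thesis by (simp add: not_integrable_integral_eq)
    qed
    also have "\<dots> = (\<integral>\<^sup>+y\<in>E. ennreal \<bar>conj_conv g e y\<bar> \<partial>lborel)"
      by (intro nn_integral_cong) (auto simp: indicator_def)
    also have "\<dots> \<le> ennreal (m * (3 + ln (1 + t / m)))"
      by (rule set_nn_integral_conj_conv_le[OF e ig _ _ gt E Em m]) (auto simp: g_def)
    finally show ?thesis .
  qed
  define p where "p = m * (3 + ln (1 + t / m))"
  have p0: "p \<ge> 0" unfolding p_def using m t by simp
  have "(\<integral>\<^sup>+x\<in>A. ennreal \<bar>v x\<bar> \<partial>lborel) \<le> (\<integral>\<^sup>+x. ennreal \<bar>v x\<bar> * indicator (A \<inter> {x. v x > 0}) x + ennreal \<bar>v x\<bar> * indicator (A \<inter> {x. v x < 0}) x \<partial>lborel)"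
    by (intro nn_integral_mono) (auto simp: indicator_def)
  also have "\<dots> = (\<integral>\<^sup>+x\<in>A \<inter> {x. v x > 0}. ennreal \<bar>v x\<bar> \<partial>lborel) + (\<integral>\<^sup>+x\<in>A \<inter> {x. v x < 0}. ennreal \<bar>v x\<bar> \<partial>lborel)"
    by (rule nn_integral_add) measurable
  also have "\<dots> \<le> ennreal p + ennreal p"
    unfolding p_def by (intro add_mono part) auto
  also have "\<dots> = ennreal (2 * p)" using p0 by (simp flip: ennreal_plus)
  finally show ?thesis by (simp add: v_def p_def)
qed

text \<open>Replacing the logarithms by sums over the thresholds \<open>r\<^sup>k t < m\<close>, \<open>k \<in> \<int>\<close>, makes the layer cake integral over
  \<open>m = \<bar>{l < f}\<bar>\<close> a sum of values of the rearrangement of \<open>f\<close>.\<close>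

lemma log_le_step_sum:
  fixes r t m :: real
  assumes r: "r \<ge> 2" and t: "t > 0" and m: "m > 0"
  shows "ennreal (min (t * (3 + ln (1 + m / t))) (2 * (m * (3 + ln (1 + t / m))))) \<le> 
    (\<Sum>n. ennreal (t * ((if r ^ n * t < m then 4 + ln r else 0) +
       (if t / r ^ n < m then 2 * r * (4 + ln r) * (real n + 1) / r ^ n else 0))))"
proof -
  define T where "T = (\<lambda>n. t * ((if r ^ n * t < m then 4 + ln r else 0) +
       (if t / r ^ n < m then 2 * r * (4 + ln r) * (real n + 1) / r ^ n else 0)))"
  have lr: "ln r \<ge> 0" using r by simp
  have T0: "T n \<ge> 0" for n unfolding T_def using r t lr by auto
  have part: "ennreal (\<Sum>n\<in>I. T n) \<le> (\<Sum>n. ennreal (T n))" if "finite I" for I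
  proof -
    have "ennreal (\<Sum>n\<in>I. T n) = (\<Sum>n\<in>I. ennreal (T n))" by (rule sum_ennreal[symmetric]) (rule T0)
    also have "\<dots> \<le> (\<Sum>n. ennreal (T n))" by (rule sum_le_suminf) (use that in auto)
    finally show ?thesis .
  qed
  have lim: "\<exists>n. c \<le> r ^ n" for c using real_arch_pow[of r c] r by (auto intro: less_imp_le)
  have "ennreal (min (t * (3 + ln (1 + m / t))) (2 * (m * (3 + ln (1 + t / m))))) \<le> (\<Sum>n. ennreal (T n))"
  proof -
    have ln2: "ln (2::real) \<le> 1" using ln_le_minus_one[of "2::real"] by simp
    show ?thesis
    proof (cases "m > t")
      case True
      \<comment> \<open>All thresholds \<open>r ^ k * t\<close> with \<open>k < n\<close> lie below
        \<open>m\<close>, and their number times \<open>4 + ln r\<close> already exceeds the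
        logarithmic factor; \<open>n \<ge> 1\<close> absorbs the constant 3 together with
        \<open>ln 2\<close>.\<close>
      define n where "n = (LEAST n. m \<le> r ^ n * t)"
      have "\<exists>n. m / t \<le> r ^ n" by (rule lim)
      then have "\<exists>n. m \<le> r ^ n * t" using t by (simp add: pos_divide_le_eq)
      then have n: "m \<le> r ^ n * t" unfolding n_def by (rule LeastI_ex)
      have less: "r ^ k * t < m" if "k < n" for k using not_less_Least[OF that[unfolded n_def]] by simp
      have n1: "n \<ge> 1" using n True by (cases n) auto
      have "ln (1 + m / t) \<le> ln (2 * r ^ n)"
      proof -
        have "m / t \<le> r ^ n" using n t by (simp add: pos_divide_le_eq)
        moreover have "1 \<le> r ^ n" using r by simp
        ultimately have "1 + m / t \<le> 2 * r ^ n" by linarith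
        then show ?thesis using m t r by (subst ln_le_cancel_iff) (auto intro: add_pos_pos)
      qed
      also have "\<dots> = ln 2 + real n * ln r" using r by (simp add: ln_mult ln_realpow)
      finally have "3 + ln (1 + m / t) \<le> real n * (4 + ln r)" using ln2 n1 by (simp add: algebra_simps)
      then have "t * (3 + ln (1 + m / t)) \<le> t * (real n * (4 + ln r))" using t by (intro mult_left_mono) auto
      also have "\<dots> = (\<Sum>k<n. t * (4 + ln r))" by simp
      also have "\<dots> \<le> (\<Sum>k<n. T k)"
        unfolding T_def using less r t lr by (intro sum_mono mult_left_mono) auto
      finally have "ennreal (min (t * (3 + ln (1 + m / t))) (2 * (m * (3 + ln (1 + t / m))))) \<le> ennreal (\<Sum>k<n. T k)"
        by (intro ennreal_leI) simp
      also have "\<dots> \<le> (\<Sum>n. ennreal (T n))" by (rule part) simp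
      finally show ?thesis .
    next
      case False
      \<comment> \<open>Here the single term with index \<open>n\<close> suffices. Minimality gives
        \<open>m \<le> t / r ^ (n - 1)\<close>; this shift by one is the origin of the factor
        \<open>r\<close> in the weight.\<close>
      define n where "n = (LEAST n. t / r ^ n < m)"
      have "\<exists>n. t / m + 1 \<le> r ^ n" by (rule lim)
      then obtain n0 where "t / m + 1 \<le> r ^ n0" by (elim exE)
      then have "t / r ^ n0 < m" using m t r by (simp add: field_simps)
      then have n: "t / r ^ n < m" unfolding n_def by (rule LeastI)
      have n1: "n \<noteq> 0" using n False by (intro notI) simp
      then obtain k where k: "n = Suc k" by (cases n) auto
      have "\<not> t / r ^ k < m" using not_less_Least[of k "\<lambda>n. t / r ^ n < m"] k by (simp add: n_def)
      then have mk: "m \<le> t / r ^ k" by simp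
      have "t / m \<le> r ^ n" using n m r t by (simp add: field_simps)
      have "ln (1 + t / m) \<le> ln (2 * r ^ n)"
      proof -
        have "1 \<le> r ^ n" using r by simp
        then have "1 + t / m \<le> 2 * r ^ n" using \<open>t / m \<le> r ^ n\<close> by linarith
        then show ?thesis using m t r by (subst ln_le_cancel_iff) (auto intro: add_pos_pos)
      qed
      also have "\<dots> = ln 2 + real n * ln r" using r by (simp add: ln_mult ln_realpow)
      finally have "3 + ln (1 + t / m) \<le> (real n + 1) * (4 + ln r)" using ln2 lr by (simp add: algebra_simps)
      moreover have "0 \<le> 3 + ln (1 + t / m)" using m t by (simp add: add_nonneg_nonneg)
      ultimately have "2 * (m * (3 + ln (1 + t / m))) \<le> 2 * (t / r ^ k * ((real n + 1) * (4 + ln r)))"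
        using mk m t r by (intro mult_left_mono mult_mono) auto
      also have "\<dots> = t * (2 * r * (4 + ln r) * (real n + 1) / r ^ n)" using r by (simp add: k)
      also have "\<dots> \<le> T n" unfolding T_def using n lr r t by (intro mult_left_mono) auto
      finally have "ennreal (min (t * (3 + ln (1 + m / t))) (2 * (m * (3 + ln (1 + t / m))))) \<le> ennreal (\<Sum>k\<in>{n}. T k)"
        by (intro ennreal_leI) simp
      also have "\<dots> \<le> (\<Sum>n. ennreal (T n))" by (rule part) simp
      finally show ?thesis .
    qed
  qed
  then show ?thesis unfolding T_def .
qed

lemma set_nn_integral_conj_conv_indicator_le:
  assumes e: "e > 0" and r: "r \<ge> 2" and E [measurable]: "E \<in> sets borel" and Em: "emeasure lborel E \<le> M" and M: "M < \<infinity>"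
    and A [measurable]: "A \<in> sets borel" and At: "emeasure lborel A \<le> ennreal t" and t: "t > 0"
  shows "(\<integral>\<^sup>+x\<in>A. ennreal \<bar>conj_conv (indicator E) e x\<bar> \<partial>lborel) \<le> 
    (\<Sum>n. ennreal (t * ((if ennreal (r ^ n * t) < M then 4 + ln r else 0) +
       (if ennreal (t / r ^ n) < M then 2 * r * (4 + ln r) * (real n + 1) / r ^ n else 0))))"
proof -
  obtain m where m: "M = ennreal m" "m \<ge> 0" using M by (cases M) auto
  show ?thesis
  proof (cases "m = 0")
    \<comment> \<open>Sets of measure 0 are treated apart, because the dual estimate divides by
      \<open>m\<close>.\<close>
    case True
    then have "emeasure lborel E = 0" using Em m by simp
    then have "AE y in lborel. conj_poisson e (x - y) * indicator E y = 0" for x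
      by (intro AE_I'[of E]) (auto simp: null_sets_def indicator_def split: if_splits)
    then have "conj_conv (indicator E) e x = 0" for x
      unfolding conj_conv_def by (subst integral_cong_AE[where g="\<lambda>_. 0"]) auto
    then show ?thesis by simp
  next
    case False
    then have m0: "m > 0" using m by simp
    have iE: "integrable lborel (indicator E :: real \<Rightarrow> real)"
      using Em M by (intro integrable_indicator_finite) (auto simp: less_top[symmetric] top_unique)
    have EI: "(LINT y|lborel. indicator E y) \<le> m" using Em m by (simp add: measure_def enn2real_leI)
    have "(\<integral>\<^sup>+x\<in>A. ennreal \<bar>conj_conv (indicator E) e x\<bar> \<partial>lborel) \<le> ennreal (min (t * (3 + ln (1 + m / t))) (2 * (m * (3 + ln (1 + t / m)))))"
      using set_nn_integral_conj_conv_le[OF e iE _ _ EI A At t] 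
        set_nn_integral_conj_conv_dual_le[OF e E Em[unfolded m] m0 A At t] by (simp add: min_def)
    also note log_le_step_sum[OF r t m0]
    finally show ?thesis using r t m by (simp add: ennreal_less_iff)
  qed
qed

text \<open>The layers are written as a kernel \<open>k\<close> normalised by \<open>f y\<close>, so
  that it has mass 1 in \<open>l\<close> wherever \<open>f y > 0\<close>. Fubini then applies with
  the integrable factor \<open>conj_poisson e (x - y) * f y\<close>.\<close>

lemma conj_conv_layer_cake:
  assumes e: "e > 0" and f: "integrable lborel f" "\<And>y. 0 \<le> f y"
  shows "ennreal \<bar>conj_conv f e x\<bar> \<le> (\<integral>\<^sup>+l\<in>{0<..}. ennreal \<bar>conj_conv (indicator {y. l < f y}) e x\<bar> \<partial>lborel)"
proof -
  have [measurable]: "f \<in> borel_measurable borel" using f by auto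
  define k where "k = (\<lambda>l y. indicator {0<..<f y} l / f y)"
  define g where "g = (\<lambda>y. conj_poisson e (x - y) * f y)"
  have g: "integrable lborel g" unfolding g_def by (rule integrable_conj_poisson_mult[OF e f(1)])
  have km: "case_prod k \<in> borel_measurable (borel \<Otimes>\<^sub>M borel)"
  proof -
    have "case_prod k = (\<lambda>p. (if 0 < fst p \<and> fst p < f (snd p) then 1 else 0) / f (snd p))"
      by (auto simp: k_def indicator_def fun_eq_iff)
    also have "\<dots> \<in> borel_measurable (borel \<Otimes>\<^sub>M borel)" by measurable
    finally show ?thesis .
  qed
  have ind: "integrable lborel (\<lambda>l. indicator {0<..<f y} l :: real)" for y
    using f(2)[of y] by (intro integrable_indicator_finite) auto
  have ki: "integrable lborel (\<lambda>l. k l y)" for y unfolding k_def using ind by (rule Bochner_Integration.integrable_divide_zero)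
  have kI: "(LINT l|lborel. k l y) = (if f y = 0 then 0 else 1)" for y
    using f(2)[of y] by (simp add: k_def measure_def)
  have ka: "\<bar>k l y\<bar> = k l y" for l y using f(2)[of y] by (simp add: k_def indicator_def)
  have kb: "(LINT l|lborel. \<bar>k l y\<bar>) \<le> 1" for y by (simp add: ka kI)
  note K = kernel_Fubini[OF km g ki kb]
  have eq: "(LINT y|lborel. k l y * g y) = indicator {0<..} l * conj_conv (indicator {y. l < f y}) e x" for l
  proof -
    have "(LINT y|lborel. k l y * g y) = (LINT y|lborel. indicator {0<..} l * (conj_poisson e (x - y) * indicator {y. l < f y} y))"
      by (intro Bochner_Integration.integral_cong) (auto simp: k_def g_def indicator_def)
    then show ?thesis by (simp add: conj_conv_def)
  qed
  have "conj_conv f e x = (LINT y|lborel. (LINT l|lborel. k l y) * g y)"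
    unfolding conj_conv_def by (intro Bochner_Integration.integral_cong) (auto simp: kI g_def)
  also have "\<dots> = (LINT l|lborel. indicator {0<..} l * conj_conv (indicator {y. l < f y}) e x)"
    using K(2) by (simp add: eq)
  finally have "ennreal \<bar>conj_conv f e x\<bar> \<le> (\<integral>\<^sup>+l. ennreal (norm (indicator {0<..} l * conj_conv (indicator {y. l < f y}) e x)) \<partial>lborel)"
    using integral_norm_bound_ennreal[OF K(1)[unfolded eq]] by simp
  also have "\<dots> = (\<integral>\<^sup>+l\<in>{0<..}. ennreal \<bar>conj_conv (indicator {y. l < f y}) e x\<bar> \<partial>lborel)"
    by (intro nn_integral_cong) (auto simp: indicator_def)
  finally show ?thesis .
qed

text \<open>The weight of the threshold \<open>t / r ^ n\<close> in \<open>log_le_step_sum\<close>: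
  \<open>real n + 1\<close> is the trace of the logarithm, and \<open>1 / r ^ n\<close> is the decay
  that must beat the norm of the dilation by \<open>1 / r ^ n\<close>.\<close>

definition step_weight :: "real \<Rightarrow> nat \<Rightarrow> real" where
  "step_weight r n = 2 * r * (4 + ln r) * (real n + 1) / r ^ n"

text \<open>Integrating the indicator of a threshold over the levels \<open>l\<close> gives the
  measure of the levels with \<open>s < M l\<close>, that is, a value of a rearrangement.
  \<open>M\<close> and \<open>F\<close> are kept abstract so that the positive and the negative part
  of a function can share the distribution function of its absolute value.\<close>

lemma set_nn_integral_conj_conv_layer_le:
  fixes M :: "real \<Rightarrow> ennreal"
  assumes e: "e > 0" and r: "r \<ge> 2" and f: "integrable lborel f" "\<And>y. 0 \<le> f y"
    and M: "\<And>l. l > 0 \<Longrightarrow> emeasure lborel {y. l < f y} \<le> M l" "\<And>l. l > 0 \<Longrightarrow> M l < \<infinity>" and Mm [measurable]: "M \<in> borel_measurable borel"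
    and F: "\<And>s l. s > 0 \<Longrightarrow> l > 0 \<Longrightarrow> ennreal s < M l \<Longrightarrow> l \<le> F s"
    and A [measurable]: "A \<in> sets borel" and At: "emeasure lborel A \<le> ennreal t" and t: "t > 0"
  shows "(\<integral>\<^sup>+x\<in>A. ennreal \<bar>conj_conv f e x\<bar> \<partial>lborel) \<le> 
    (\<Sum>n. ennreal (t * (4 + ln r)) * ennreal (F (r ^ n * t)) + ennreal (t * step_weight r n) * ennreal (F (t / r ^ n)))"
proof -
  have [measurable]: "f \<in> borel_measurable borel" using f by auto
  have r0: "r > 0" using r by simp
  have lr: "ln r \<ge> 0" using r by simp
  have w0: "step_weight r n \<ge> 0" for n unfolding step_weight_def using r lr by auto
  have jm: "(\<lambda>(l, x). conj_conv (indicator {y. l < f y}) e x) \<in> borel_measurable (borel \<Otimes>\<^sub>M borel)"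
  proof -
    have "(\<lambda>(l, x). conj_conv (indicator {y. l < f y}) e x) = (\<lambda>p. LINT y|lborel. conj_poisson e (snd p - y) * (if fst p < f y then 1 else 0))"
      by (auto simp: conj_conv_def fun_eq_iff indicator_def intro!: Bochner_Integration.integral_cong)
    also have "\<dots> \<in> borel_measurable (borel \<Otimes>\<^sub>M borel)" by measurable
    finally show ?thesis .
  qed
  have jm2 [measurable]: "(\<lambda>(x, l). conj_conv (indicator {y. l < f y}) e x) \<in> borel_measurable (borel \<Otimes>\<^sub>M borel)"
    using measurable_compose[OF measurable_pair_swap' jm] by (simp add: case_prod_beta)
  have "(\<integral>\<^sup>+x\<in>A. ennreal \<bar>conj_conv f e x\<bar> \<partial>lborel) \<le> 
     (\<integral>\<^sup>+x. (\<integral>\<^sup>+l. ennreal \<bar>conj_conv (indicator {y. l < f y}) e x\<bar> * indicator {0<..} l * indicator A x \<partial>lborel) \<partial>lborel)"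
  proof (rule nn_integral_mono)
    fix x
    show "ennreal \<bar>conj_conv f e x\<bar> * indicator A x \<le> (\<integral>\<^sup>+l. ennreal \<bar>conj_conv (indicator {y. l < f y}) e x\<bar> * indicator {0<..} l * indicator A x \<partial>lborel)"
      using conj_conv_layer_cake[OF e f, of x] by (cases "x \<in> A") auto
  qed
  also have "\<dots> = (\<integral>\<^sup>+l. (\<integral>\<^sup>+x. ennreal \<bar>conj_conv (indicator {y. l < f y}) e x\<bar> * indicator {0<..} l * indicator A x \<partial>lborel) \<partial>lborel)"
    by (rule lborel_pair.Fubini'[symmetric]) measurable
  also have "\<dots> \<le> (\<integral>\<^sup>+l. (\<Sum>n. ennreal (t * (4 + ln r)) * indicator {l. 0 < l \<and> ennreal (r ^ n * t) < M l} l + 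
      ennreal (t * step_weight r n) * indicator {l. 0 < l \<and> ennreal (t / r ^ n) < M l} l) \<partial>lborel)"
  proof (rule nn_integral_mono)
    fix l
    show "(\<integral>\<^sup>+x. ennreal \<bar>conj_conv (indicator {y. l < f y}) e x\<bar> * indicator {0<..} l * indicator A x \<partial>lborel)
      \<le> (\<Sum>n. ennreal (t * (4 + ln r)) * indicator {l. 0 < l \<and> ennreal (r ^ n * t) < M l} l + 
      ennreal (t * step_weight r n) * indicator {l. 0 < l \<and> ennreal (t / r ^ n) < M l} l)"
    proof (cases "l > 0")
      case True
      have "(\<integral>\<^sup>+x. ennreal \<bar>conj_conv (indicator {y. l < f y}) e x\<bar> * indicator {0<..} l * indicator A x \<partial>lborel)
        = (\<integral>\<^sup>+x\<in>A. ennreal \<bar>conj_conv (indicator {y. l < f y}) e x\<bar> \<partial>lborel)" using True by simp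
      also have "\<dots> \<le> (\<Sum>n. ennreal (t * ((if ennreal (r ^ n * t) < M l then 4 + ln r else 0) +
       (if ennreal (t / r ^ n) < M l then 2 * r * (4 + ln r) * (real n + 1) / r ^ n else 0))))"
        by (rule set_nn_integral_conj_conv_indicator_le[OF e r _ M(1)[OF True] M(2)[OF True] A At t]) measurable
      also have "\<dots> = (\<Sum>n. ennreal (t * (4 + ln r)) * indicator {l. 0 < l \<and> ennreal (r ^ n * t) < M l} l + 
      ennreal (t * step_weight r n) * indicator {l. 0 < l \<and> ennreal (t / r ^ n) < M l} l)"
      proof (rule suminf_cong)
        fix n
        show "ennreal (t * ((if ennreal (r ^ n * t) < M l then 4 + ln r else 0) +
       (if ennreal (t / r ^ n) < M l then 2 * r * (4 + ln r) * (real n + 1) / r ^ n else 0))) = 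
          ennreal (t * (4 + ln r)) * indicator {l. 0 < l \<and> ennreal (r ^ n * t) < M l} l + 
      ennreal (t * step_weight r n) * indicator {l. 0 < l \<and> ennreal (t / r ^ n) < M l} l"
          using True w0[of n] lr t unfolding step_weight_def[symmetric]
          by (auto simp: indicator_def distrib_left ennreal_plus)
      qed
      finally show ?thesis .
    qed simp
  qed
  also have "\<dots> = (\<Sum>n. \<integral>\<^sup>+l. ennreal (t * (4 + ln r)) * indicator {l. 0 < l \<and> ennreal (r ^ n * t) < M l} l + 
      ennreal (t * step_weight r n) * indicator {l. 0 < l \<and> ennreal (t / r ^ n) < M l} l \<partial>lborel)"
    by (rule nn_integral_suminf) measurable
  also have "\<dots> = (\<Sum>n. ennreal (t * (4 + ln r)) * emeasure lborel {l. 0 < l \<and> ennreal (r ^ n * t) < M l} + 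
      ennreal (t * step_weight r n) * emeasure lborel {l. 0 < l \<and> ennreal (t / r ^ n) < M l})"
  proof (rule suminf_cong)
    fix n
    have [measurable]: "{l. 0 < l \<and> ennreal s < M l} \<in> sets borel" for s by measurable
    show "(\<integral>\<^sup>+l. ennreal (t * (4 + ln r)) * indicator {l. 0 < l \<and> ennreal (r ^ n * t) < M l} l + 
      ennreal (t * step_weight r n) * indicator {l. 0 < l \<and> ennreal (t / r ^ n) < M l} l \<partial>lborel) = 
      ennreal (t * (4 + ln r)) * emeasure lborel {l. 0 < l \<and> ennreal (r ^ n * t) < M l} + 
      ennreal (t * step_weight r n) * emeasure lborel {l. 0 < l \<and> ennreal (t / r ^ n) < M l}"
      by (subst nn_integral_add) (auto simp: nn_integral_cmult)
  qed
  also have "\<dots> \<le> (\<Sum>n. ennreal (t * (4 + ln r)) * ennreal (F (r ^ n * t)) + ennreal (t * step_weight r n) * ennreal (F (t / r ^ n)))"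
  proof -
    \<comment> \<open>By hypothesis these levels lie in \<open>{0..F s}\<close>. If there are none,
      nothing is known about the sign of \<open>F s\<close>, hence the case distinction.\<close>
    have "emeasure lborel {l. 0 < l \<and> ennreal s < M l} \<le> ennreal (F s)" if "s > 0" for s
    proof (cases "{l. 0 < l \<and> ennreal s < M l} = {}")
      case False
      then have F0: "F s \<ge> 0" using F[OF that] by force
      have "emeasure lborel {l. 0 < l \<and> ennreal s < M l} \<le> emeasure lborel {0..F s}"
        using F[OF that] by (intro emeasure_mono) auto
      then show ?thesis using F0 by simp
    next
      case True
      show ?thesis unfolding True by simp
    qed
    then show ?thesis using r0 t by (intro suminf_le add_mono mult_left_mono) auto
  qed
  finally show ?thesis .
qed

subsection \<open>Decreasing rearrangements\<close>

abbreviation distr_fun :: "(real \<Rightarrow> real) \<Rightarrow> real \<Rightarrow> ennreal" where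
  "distr_fun f t \<equiv> emeasure lebesgue {x. t < \<bar>f x\<bar>}"

lemma sets_lebesgue_Collect:
  assumes "{x \<in> space lebesgue. P x} \<in> sets lebesgue"
  shows "{x. P x} \<in> sets lebesgue"
  using assms by simp

text \<open>Negative levels take part in the supremum: their superlevel set is the whole line, of
  infinite measure.\<close>

lemma rearr_nonneg: "0 \<le> rearr f s"
proof (rule dense_le)
  fix z :: ereal assume z: "z < 0"
  show "z \<le> rearr f s"
  proof (cases z)
    case (real t)
    then have "{x. t < \<bar>f x\<bar>} = UNIV" using z by (auto intro: less_le_trans)
    then have "ennreal s < distr_fun f t" by simp
    then show ?thesis unfolding rearr_def real by (intro Sup_upper) blast
  qed (use z in auto)
qed

lemma rearr_mono_measure:
  assumes "\<And>t. t \<ge> 0 \<Longrightarrow> distr_fun g t \<le> distr_fun f t"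
  shows "rearr g s \<le> rearr f s"
  unfolding rearr_def
proof (intro Sup_subset_mono, clarify)
  fix t assume t: "ennreal s < distr_fun g t"
  have "distr_fun g t \<le> distr_fun f t"
  proof (cases "t \<ge> 0")
    case False
    then have "{x. t < \<bar>f x\<bar>} = UNIV" by (auto intro: less_le_trans)
    then show ?thesis by simp
  qed (rule assms)
  then show "\<exists>t'. ereal t = ereal t' \<and> ennreal s < distr_fun f t'"
    using t by (intro exI[of _ t]) auto
qed

lemma rearr_antimono: "s \<le> s' \<Longrightarrow> rearr f s' \<le> rearr f s"
  unfolding rearr_def by (intro Sup_subset_mono) (auto intro: le_less_trans[OF ennreal_leI])

text \<open>The converse direction is right-continuity of the distribution function: a strict
  superlevel set is the increasing union of those at the levels
  \<open>t + 1 / (n + 1)\<close>.\<close>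

lemma less_rearr_iff:
  assumes [measurable]: "f \<in> borel_measurable lebesgue"
  shows "ereal t < rearr f s \<longleftrightarrow> ennreal s < distr_fun f t"
proof
  assume "ereal t < rearr f s"
  then obtain t' where t': "t < t'" "ennreal s < distr_fun f t'"
    unfolding rearr_def less_Sup_iff by auto
  note t'(2)
  also have "distr_fun f t' \<le> distr_fun f t"
  proof (rule emeasure_mono)
    show "{x. t < \<bar>f x\<bar>} \<in> sets lebesgue" by (rule sets_lebesgue_Collect) measurable
  qed (use t'(1) in auto)
  finally show "ennreal s < distr_fun f t" .
next
  assume s: "ennreal s < distr_fun f t"
  define A where "A = (\<lambda>n::nat. {x. t + 1 / (real n + 1) < \<bar>f x\<bar>})"
  have Am: "range A \<subseteq> sets lebesgue"
  proof safe
    fix n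
    have "{x \<in> space lebesgue. t + 1 / (real n + 1) < \<bar>f x\<bar>} \<in> sets lebesgue" by measurable
    then show "A n \<in> sets lebesgue" by (simp add: A_def)
  qed
  have inc: "incseq A"
  proof (rule incseq_SucI)
    fix n
    have "1 / (real (Suc n) + 1) \<le> 1 / (real n + 1)" by (simp add: field_simps)
    then show "A n \<subseteq> A (Suc n)" unfolding A_def by (auto intro: le_less_trans[rotated])
  qed
  have U: "(\<Union>n. A n) = {x. t < \<bar>f x\<bar>}"
  proof safe
    fix x n assume "x \<in> A n"
    moreover have "0 < 1 / (real n + 1)" by simp
    ultimately show "t < \<bar>f x\<bar>" unfolding A_def mem_Collect_eq by linarith
  next
    fix x assume "t < \<bar>f x\<bar>"
    then obtain n where "1 / real (Suc n) < \<bar>f x\<bar> - t" using nat_approx_posE[of "\<bar>f x\<bar> - t"] by auto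
    then have "x \<in> A n" by (simp add: A_def add.commute)
    then show "x \<in> (\<Union>n. A n)" by blast
  qed
  have "(SUP n. emeasure lebesgue (A n)) = distr_fun f t"
    using SUP_emeasure_incseq[OF Am inc] U by simp
  then obtain n where n: "ennreal s < emeasure lebesgue (A n)" using s by (metis less_SUP_iff)
  have "ereal t < ereal (t + 1 / (real n + 1))" by simp
  also have "\<dots> \<le> rearr f s" unfolding rearr_def using n unfolding A_def by (intro Sup_upper) blast
  finally show "ereal t < rearr f s" .
qed

lemma rearr_le_bound:
  assumes "\<And>x. \<bar>f x\<bar> \<le> B" "s \<ge> 0"
  shows "rearr f s \<le> ereal B"
  unfolding rearr_def
proof (rule Sup_least, clarify)
  fix t assume t: "ennreal s < distr_fun f t"
  have "{x. t < \<bar>f x\<bar>} \<noteq> {}"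
  proof
    assume "{x. t < \<bar>f x\<bar>} = {}"
    then show False using t by (simp only: emeasure_empty) simp
  qed
  then obtain x where "t < \<bar>f x\<bar>" by blast
  then show "ereal t \<le> ereal B" using assms(1)[of x] by simp
qed

text \<open>For bounded \<open>f\<close> the rearrangement is finite, so \<^const>\<open>real_of_ereal\<close> does not produce junk values.\<close>

definition dec_rearr :: "(real \<Rightarrow> real) \<Rightarrow> real \<Rightarrow> real" where
  "dec_rearr f x = (if x > 0 then real_of_ereal (rearr f x) else 0)"

locale bounded_fun =
  fixes f :: "real \<Rightarrow> real" and B :: real
  assumes meas [measurable]: "f \<in> borel_measurable lebesgue" and bound: "\<And>x. \<bar>f x\<bar> \<le> B"
begin

lemma B_nonneg: "B \<ge> 0" using bound[of 0] by linarith

lemma dec_rearr_eq: "x > 0 \<Longrightarrow> ereal (dec_rearr f x) = rearr f x"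
  using rearr_nonneg[of f x] rearr_le_bound[of f B x, OF bound] unfolding dec_rearr_def by (cases "rearr f x") auto

lemma dec_rearr_nonneg: "dec_rearr f x \<ge> 0"
  using rearr_nonneg[of f x] by (simp add: dec_rearr_def real_of_ereal_pos)

lemma dec_rearr_le: "dec_rearr f x \<le> B"
proof (cases "x > 0")
  case True
  then have "ereal (dec_rearr f x) \<le> ereal B" unfolding dec_rearr_eq[OF True] by (intro rearr_le_bound bound) auto
  then show ?thesis by simp
qed (simp add: dec_rearr_def B_nonneg)

lemma dec_rearr_antimono: "0 < x \<Longrightarrow> x \<le> y \<Longrightarrow> dec_rearr f y \<le> dec_rearr f x"
proof -
  assume xy: "0 < x" "x \<le> y"
  then have "ereal (dec_rearr f y) \<le> ereal (dec_rearr f x)"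
    by (subst (1 2) dec_rearr_eq) (auto intro: rearr_antimono)
  then show ?thesis by simp
qed

lemma less_dec_rearr_iff: "x > 0 \<Longrightarrow> t < dec_rearr f x \<longleftrightarrow> ennreal x < distr_fun f t"
  using less_rearr_iff[OF meas, of t x] dec_rearr_eq[of x] by (metis ereal_less_eq(3) not_le)

lemma dec_rearr_borel [measurable]: "dec_rearr f \<in> borel_measurable borel"
proof (rule borel_measurableI_greater)
  fix t
  show "{x \<in> space borel. t < dec_rearr f x} \<in> sets borel"
  proof (cases "t < 0")
    case True
    then have "{x \<in> space borel. t < dec_rearr f x} = UNIV" using dec_rearr_nonneg by (auto intro: less_le_trans)
    then show ?thesis by simp
  next
    case False
    then have "{x \<in> space borel. t < dec_rearr f x} = {x. 0 < x \<and> ennreal x < distr_fun f t}"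
      using less_dec_rearr_iff by (auto simp: dec_rearr_def)
    also have "\<dots> \<in> sets borel" by measurable
    finally show ?thesis .
  qed
qed

text \<open>The superlevel set is an interval starting at 0 whose length is the value of the
  distribution function; a bounded function may have infinite values here.\<close>

lemma emeasure_dec_rearr:
  assumes "t \<ge> 0"
  shows "distr_fun (dec_rearr f) t = distr_fun f t"
proof -
  define m where "m = distr_fun f t"
  have eq: "{x. t < \<bar>dec_rearr f x\<bar>} = {x. 0 < x \<and> ennreal x < m}"
    using less_dec_rearr_iff dec_rearr_nonneg assms unfolding m_def by (auto simp: dec_rearr_def abs_of_nonneg split: if_splits)
  show ?thesis
  proof (cases m)
    case (real c)
    then have "{x. 0 < x \<and> ennreal x < m} = {0<..<c}" by (auto simp: ennreal_less_iff)
    then show ?thesis unfolding eq using real by (simp add: m_def)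
  next
    case top
    then have "{x. 0 < x \<and> ennreal x < m} = {0<..}" by (auto simp: less_top[symmetric])
    moreover have "emeasure lebesgue {0::real<..} = \<infinity>"
    proof -
      have "ennreal r \<le> emeasure lebesgue {0::real<..}" if "r \<ge> 0" for r
      proof -
        have "ennreal r = emeasure lebesgue {0<..<r}" using that by simp
        also have "\<dots> \<le> emeasure lebesgue {0::real<..}" by (intro emeasure_mono) auto
        finally show ?thesis .
      qed
      note * = this
      show ?thesis
      proof (cases "emeasure lebesgue {0::real<..}")
        case (real c)
        then show ?thesis using *[of "c + 1"] by simp
      qed simp
    qed
    ultimately show ?thesis unfolding eq using top by (simp add: m_def)
  qed
qed

lemma dec_rearr_eq_0:
  assumes "emeasure lebesgue {x. f x \<noteq> 0} \<le> ennreal M" "x \<ge> M"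
  shows "dec_rearr f x = 0"
proof (cases "x > 0")
  case True
  have "\<not> 0 < dec_rearr f x"
  proof
    assume "0 < dec_rearr f x"
    then have "ennreal x < distr_fun f 0" using less_dec_rearr_iff True by blast
    also have "\<dots> \<le> ennreal M" using assms(1) by simp
    finally show False using assms(2) by (simp add: ennreal_leI leD)
  qed
  then show ?thesis using dec_rearr_nonneg[of x] by linarith
qed (simp add: dec_rearr_def)

end

subsection \<open>Dilations\<close>

lemma borel_measurable_lebesgue_ident: "(\<lambda>x::real. x) \<in> borel_measurable lebesgue"
  by (rule measurable_completion) simp

lemma measurable_dil [measurable]:
  "f \<in> borel_measurable lebesgue \<Longrightarrow> dil a f \<in> borel_measurable lebesgue"
  unfolding dil_def using measurable_compose[OF lebesgue_measurable_scaling[of a], of f borel] by simp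

lemma emeasure_dil:
  assumes a: "a > 0"
  shows "distr_fun (dil a f) t = ennreal (1 / a) * distr_fun f t"
proof -
  have eq: "{x. t < \<bar>dil a f x\<bar>} = (\<lambda>x. (1 / a) *\<^sub>R x + 0) ` {x. t < \<bar>f x\<bar>}"
  proof safe
    fix x assume "t < \<bar>dil a f x\<bar>"
    then show "x \<in> (\<lambda>x. (1 / a) *\<^sub>R x + 0) ` {x. t < \<bar>f x\<bar>}"
      using a by (intro image_eqI[of _ _ "a * x"]) (auto simp: dil_def)
  qed (use a in \<open>auto simp: dil_def\<close>)
  show ?thesis unfolding eq using emeasure_lebesgue_affine[of "1 / a" 0 "{x. t < \<bar>f x\<bar>}"] a by simp
qed

lemma dil_dil: "dil a (dil b f) = dil (b * a) f"
  by (simp add: dil_def fun_eq_iff mult.assoc)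

subsection \<open>Rearrangement invariant spaces\<close>

locale ri =
  fixes X :: "(real \<Rightarrow> real) set" and N :: "(real \<Rightarrow> real) \<Rightarrow> real" and K :: real
  assumes ri: "ri_space X N" and K1: "K \<ge> 1"
    and quasi: "\<And>f g. f \<in> X \<Longrightarrow> g \<in> X \<Longrightarrow> N (\<lambda>x. f x + g x) \<le> K * (N f + N g)"
begin

lemmas ri_conj1 = ri[unfolded ri_space_def, THEN conjunct2]
lemmas ri_conj2 = ri_conj1[THEN conjunct2, THEN conjunct2]
lemmas ri_conj3 = ri_conj2[THEN conjunct2, THEN conjunct2]
lemmas ri_conj4 = ri_conj3[THEN conjunct2, THEN conjunct2]

lemma X_meas: "f \<in> X \<Longrightarrow> f \<in> borel_measurable lebesgue"
  using ri[unfolded ri_space_def, THEN conjunct1] by (rule subsetD)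

lemma N_nonneg: "f \<in> X \<Longrightarrow> 0 \<le> N f"
  using ri_conj1[THEN conjunct1] by (rule bspec)

lemma N_eq_0: "f \<in> X \<Longrightarrow> N f = 0 \<longleftrightarrow> (AE x in lebesgue. f x = 0)"
  using ri_conj1[THEN conjunct2, THEN conjunct1] by (rule bspec)

lemma scale: "f \<in> X \<Longrightarrow> (\<lambda>x. c * f x) \<in> X" and N_scale: "f \<in> X \<Longrightarrow> N (\<lambda>x. c * f x) = \<bar>c\<bar> * N f"
  using ri_conj2[THEN conjunct1] by blast+

lemma add: "f \<in> X \<Longrightarrow> g \<in> X \<Longrightarrow> (\<lambda>x. f x + g x) \<in> X"
  using ri_conj2[THEN conjunct2, THEN conjunct1] by blast

lemma complete:
  assumes "\<And>n. u n \<in> X" "\<And>e. e > 0 \<Longrightarrow> \<exists>M. \<forall>m\<ge>M. \<forall>n\<ge>M. N (\<lambda>x. u m x - u n x) < e"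
  shows "\<exists>f\<in>X. (\<lambda>n. N (\<lambda>x. u n x - f x)) \<longlonglongrightarrow> 0"
  by (rule ri_conj3[THEN conjunct1, rule_format]) (use assms in auto)

lemma lattice: "g \<in> X" and N_lattice: "N g \<le> N f"
  if "f \<in> X" "g \<in> borel_measurable lebesgue" "\<And>s. s \<ge> 0 \<Longrightarrow> rearr g s \<le> rearr f s"
proof -
  have "g \<in> X \<and> N g \<le> N f"
    by (rule ri_conj3[THEN conjunct2, THEN conjunct1, rule_format]) (use that in auto)
  then show "g \<in> X" "N g \<le> N f" by auto
qed

lemma simple: "g \<in> borel_measurable lebesgue \<Longrightarrow> finite (range g) \<Longrightarrow> emeasure lebesgue {x. g x \<noteq> 0} < \<infinity> \<Longrightarrow> g \<in> X"
  by (rule ri_conj4[THEN conjunct1, rule_format]) (assumption | intro conjI)+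

lemmas order_continuous_or_fatou = ri_conj4[THEN conjunct2]

lemma measure_lattice:
  assumes "f \<in> X" "g \<in> borel_measurable lebesgue"
    "\<And>t. t \<ge> 0 \<Longrightarrow> distr_fun g t \<le> distr_fun f t"
  shows "g \<in> X" "N g \<le> N f"
  using assms by (auto intro!: lattice[of f] N_lattice[of f] rearr_mono_measure)

lemma AE_lattice:
  assumes "f \<in> X" and [measurable]: "g \<in> borel_measurable lebesgue" and ae: "AE x in lebesgue. \<bar>g x\<bar> \<le> \<bar>f x\<bar>"
  shows "g \<in> X" "N g \<le> N f"
proof -
  have [measurable]: "f \<in> borel_measurable lebesgue" using assms(1) by (rule X_meas)
  have "distr_fun g t \<le> distr_fun f t" for t
  proof (rule emeasure_mono_AE)
    show "AE x in lebesgue. x \<in> {x. t < \<bar>g x\<bar>} \<longrightarrow> x \<in> {x. t < \<bar>f x\<bar>}"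
      using ae by eventually_elim auto
    show "{x. t < \<bar>f x\<bar>} \<in> sets lebesgue" by (rule sets_lebesgue_Collect) measurable
  qed
  then show "g \<in> X" "N g \<le> N f" using measure_lattice[OF assms(1,2)] by auto
qed

lemma abs_lattice:
  assumes "f \<in> X" "g \<in> borel_measurable lebesgue" "\<And>x. \<bar>g x\<bar> \<le> \<bar>f x\<bar>"
  shows "g \<in> X" "N g \<le> N f"
  using AE_lattice[OF assms(1,2)] assms(3) by auto

lemma diff: "f \<in> X \<Longrightarrow> g \<in> X \<Longrightarrow> (\<lambda>x. f x - g x) \<in> X"
  using add[of f "\<lambda>x. (-1) * g x"] scale[of g "-1"] by simp

lemma N_uminus: "f \<in> X \<Longrightarrow> N (\<lambda>x. - f x) = N f"
  using N_scale[of f "-1"] by simp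

lemma indicator_in_X:
  assumes "E \<in> sets lebesgue" "emeasure lebesgue E < \<infinity>"
  shows "(indicator E :: real \<Rightarrow> real) \<in> X"
proof (rule simple)
  have "range (indicator E :: real \<Rightarrow> real) \<subseteq> {0, 1}" by (auto simp: indicator_def)
  then show "finite (range (indicator E :: real \<Rightarrow> real))" by (rule finite_subset) simp
  have "{x. (indicator E x :: real) \<noteq> 0} = E" by (auto simp: indicator_def)
  then show "emeasure lebesgue {x. (indicator E x :: real) \<noteq> 0} < \<infinity>" using assms by simp
qed (use assms in simp)

lemma bounded_finite_support_in_X:
  assumes [measurable]: "f \<in> borel_measurable lebesgue" and "\<And>x. \<bar>f x\<bar> \<le> B" "emeasure lebesgue {x. f x \<noteq> 0} < \<infinity>"
  shows "f \<in> X"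
proof (rule abs_lattice)
  have "{x \<in> space lebesgue. f x \<noteq> 0} \<in> sets lebesgue" by measurable
  then show "(\<lambda>x. B * indicator {x. f x \<noteq> 0} x) \<in> X"
    using assms by (intro scale indicator_in_X) auto
  show "\<bar>f x\<bar> \<le> \<bar>B * indicator {x. f x \<noteq> 0} x\<bar>" for x
    using assms(2)[of x] by (auto simp: indicator_def)
qed simp

text \<open>Convergence in \<open>N\<close> implies convergence in measure, as indicators of sets of positive measure have positive norm.\<close>

lemma increasing_Cauchy_dominated:
  assumes u: "\<And>n. u n \<in> X" and inc: "\<And>n x. u n x \<le> u (Suc n) x"
    and cauchy: "\<And>e. e > 0 \<Longrightarrow> \<exists>M. \<forall>m\<ge>M. \<forall>n\<ge>M. N (\<lambda>x. u m x - u n x) < e"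
    and B: "\<And>n. N (u n) \<le> B"
  shows "\<exists>\<phi>\<in>X. N \<phi> \<le> K * B \<and> (\<forall>n. AE x in lebesgue. u n x \<le> \<phi> x)"
proof -
  note borel_measurable_lebesgue_ident [measurable]
  obtain \<phi> where \<phi>: "\<phi> \<in> X" "(\<lambda>n. N (\<lambda>x. u n x - \<phi> x)) \<longlonglongrightarrow> 0"
    using complete[OF u cauchy] by blast
  have [measurable]: "\<phi> \<in> borel_measurable lebesgue" "u n \<in> borel_measurable lebesgue" for n using \<phi>(1) u by (auto intro: X_meas)
  \<comment> \<open>A quasi-norm need not be continuous, so passing to the limit costs a factor
    \<open>K\<close>.\<close>
  have "N \<phi> \<le> K * (N (\<lambda>x. u n x - \<phi> x) + B)" for n
  proof -
    have "N \<phi> = N (\<lambda>x. - (u n x - \<phi> x) + u n x)" by simp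
    also have "\<dots> \<le> K * (N (\<lambda>x. - (u n x - \<phi> x)) + N (u n))"
      using scale[OF diff[OF u \<phi>(1)], of "-1"] u by (intro quasi) auto
    also have "N (\<lambda>x. - (u n x - \<phi> x)) = N (\<lambda>x. u n x - \<phi> x)" using diff[OF u \<phi>(1)] by (rule N_uminus)
    also have "K * (N (\<lambda>x. u n x - \<phi> x) + N (u n)) \<le> K * (N (\<lambda>x. u n x - \<phi> x) + B)"
      using B K1 by (intro mult_left_mono add_left_mono) auto
    finally show ?thesis .
  qed
  moreover have "(\<lambda>n. K * (N (\<lambda>x. u n x - \<phi> x) + B)) \<longlonglongrightarrow> K * (0 + B)"
    by (intro tendsto_intros \<phi>)
  ultimately have "N \<phi> \<le> K * B" using LIMSEQ_le_const[of "\<lambda>n. K * (N (\<lambda>x. u n x - \<phi> x) + B)"] by auto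
  moreover have "AE x in lebesgue. u n x \<le> \<phi> x" for n
  proof -
    have "AE x in lebesgue. \<not> (1 / (real k + 1) < u n x - \<phi> x \<and> \<bar>x\<bar> \<le> real R)" for k R
    proof -
      define \<epsilon> where "\<epsilon> = 1 / (real k + 1)"
      \<comment> \<open>On \<open>E\<close> all later \<open>u m\<close> exceed
        \<open>\<phi>\<close> by more than \<open>\<epsilon>\<close> as well. Hence
        \<open>\<epsilon> * N (indicator E)\<close> is bounded by norms that tend to 0. The
        restriction to a bounded interval puts the indicator into \<open>X\<close>.\<close>
      define E where "E = {x. \<epsilon> < u n x - \<phi> x \<and> \<bar>x\<bar> \<le> real R}"
      have "{x \<in> space lebesgue. \<epsilon> < u n x - \<phi> x \<and> \<bar>x\<bar> \<le> real R} \<in> sets lebesgue" by measurable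
      then have Em: "E \<in> sets lebesgue" by (simp add: E_def)
      have "emeasure lebesgue E \<le> emeasure lebesgue {-real R..real R}" using Em by (intro emeasure_mono) (auto simp: E_def)
      then have Ef: "emeasure lebesgue E < \<infinity>" by (rule le_less_trans) simp
      have EX: "indicator E \<in> X" using Em Ef by (rule indicator_in_X)
      have mono: "u n x \<le> u m x" if "n \<le> m" for m x using lift_Suc_mono_le[of "\<lambda>n. u n x"] inc that by auto
      have "\<epsilon> * N (indicator E) \<le> N (\<lambda>x. u m x - \<phi> x)" if "n \<le> m" for m
      proof -
        have "\<epsilon> * N (indicator E) = N (\<lambda>x. \<epsilon> * indicator E x)" using N_scale[OF EX, of \<epsilon>] by (simp add: \<epsilon>_def)
        also have "\<dots> \<le> N (\<lambda>x. u m x - \<phi> x)"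
        proof (rule abs_lattice(2)[OF diff[OF u \<phi>(1)]])
          show "(\<lambda>x. \<epsilon> * indicator E x) \<in> borel_measurable lebesgue" using Em by measurable
          have "\<epsilon> > 0" by (simp add: \<epsilon>_def)
          then show "\<bar>\<epsilon> * indicator E x\<bar> \<le> \<bar>u m x - \<phi> x\<bar>" for x
            using mono[OF that, of x] by (auto simp: indicator_def E_def)
        qed
        finally show ?thesis .
      qed
      then have "\<epsilon> * N (indicator E) \<le> 0"
        by (intro LIMSEQ_le_const[OF \<phi>(2)]) auto
      moreover have "\<epsilon> > 0" by (simp add: \<epsilon>_def)
      ultimately have "N (indicator E) = 0" using N_nonneg[OF EX] by (simp add: mult_le_0_iff)
      then have "AE x in lebesgue. (indicator E x :: real) = 0" using N_eq_0[OF EX] by simp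
      then show ?thesis by eventually_elim (auto simp: E_def \<epsilon>_def indicator_def split: if_splits)
    qed
    then have "AE x in lebesgue. \<forall>k R. \<not> (1 / (real k + 1) < u n x - \<phi> x \<and> \<bar>x\<bar> \<le> real R)"
      unfolding AE_all_countable by blast
    then show ?thesis
    proof eventually_elim
      case (elim x)
      show ?case
      proof (rule ccontr)
        assume "\<not> u n x \<le> \<phi> x"
        then obtain k where k: "1 / real (Suc k) < u n x - \<phi> x" using nat_approx_posE[of "u n x - \<phi> x"] by auto
        obtain R where "\<bar>x\<bar> \<le> real R" using real_arch_simple by blast
        then show False using elim k by (auto simp: add.commute)
      qed
    qed
  qed
  ultimately show ?thesis using \<phi>(1) by blast
qed

section \<open>Extension of dilation bounds from bounded functions of bounded support\<close>

lemma finite_support_of_bounded: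
  fixes f :: "real \<Rightarrow> real"
  assumes "\<And>x. \<bar>x\<bar> > R \<Longrightarrow> f x = 0"
  shows "emeasure lebesgue {x. f x \<noteq> (0::real)} < \<infinity>"
proof -
  have "{x. f x \<noteq> 0} \<subseteq> {-R..R}"
  proof
    fix x assume "x \<in> {x. f x \<noteq> 0}"
    then have "\<not> \<bar>x\<bar> > R" using assms by blast
    then show "x \<in> {-R..R}" by auto
  qed
  then have "emeasure lebesgue {x. f x \<noteq> 0} \<le> emeasure lebesgue {-R..R}" by (rule emeasure_mono) simp
  also have "\<dots> < \<infinity>" using emeasure_lborel_Icc_eq[of "-R" R] by auto
  finally show ?thesis .
qed

text \<open>Here both alternatives of condition (3) are treated. The truncations \<open>u n\<close>
  increase to \<open>\<bar>f\<bar>\<close>. Under the Fatou property the bound passes to the limit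
  directly; under order continuity the tails tend to 0, the dilated truncations form a Cauchy
  sequence, and its limit dominates the dilation of \<open>\<bar>f\<bar>\<close>. In either case
  membership of \<open>dil a f\<close> in \<open>X\<close> comes out as well, as the Boyd indices
  demand.\<close>

lemma dil_bound_extend:
  assumes a: "a > 0" and c: "c \<ge> 0"
    and bd: "\<And>f B R. f \<in> borel_measurable lebesgue \<Longrightarrow> (\<And>x. \<bar>f x\<bar> \<le> B) \<Longrightarrow> (\<And>x. \<bar>x\<bar> > R \<Longrightarrow> f x = 0) \<Longrightarrow> N (dil a f) \<le> c * N f"
    and f: "f \<in> X"
  shows "dil a f \<in> X \<and> N (dil a f) \<le> K * c * N f"
proof -
  note borel_measurable_lebesgue_ident [measurable]
  have fm [measurable]: "f \<in> borel_measurable lebesgue" using f by (rule X_meas)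
  define u where "u = (\<lambda>n x. if \<bar>x\<bar> \<le> real n then min \<bar>f x\<bar> (real n) else 0)"
  have um [measurable]: "u n \<in> borel_measurable lebesgue" for n unfolding u_def by measurable
  have u0: "0 \<le> u n x" "u n x \<le> \<bar>f x\<bar>" "u n x \<le> real n" "u n x \<le> u (Suc n) x" for n x by (auto simp: u_def)
  have usup: "\<bar>x\<bar> > real n \<Longrightarrow> u n x = 0" for n x by (simp add: u_def)
  have umono: "m \<le> n \<Longrightarrow> u m x \<le> u n x" for m n x using lift_Suc_mono_le[of "\<lambda>n. u n x"] u0(4) by auto
  have ulim: "(\<lambda>n. u n x) \<longlonglongrightarrow> \<bar>f x\<bar>" for x
  proof (rule tendsto_eventually, rule eventually_mono[OF eventually_ge_at_top[of "nat \<lceil>max \<bar>x\<bar> \<bar>f x\<bar>\<rceil>"]])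
    fix n assume "nat \<lceil>max \<bar>x\<bar> \<bar>f x\<bar>\<rceil> \<le> n"
    then have "\<bar>x\<bar> \<le> real n" "\<bar>f x\<bar> \<le> real n" by linarith+
    then show "u n x = \<bar>f x\<bar>" by (simp add: u_def)
  qed
  have uX: "u n \<in> X" for n
    using u0 usup by (intro bounded_finite_support_in_X[where B="real n"] finite_support_of_bounded[where R="real n"]) auto
  have uN: "N (u n) \<le> N f" for n using u0 by (intro abs_lattice(2)[OF f]) auto
  have absX: "(\<lambda>x. \<bar>f x\<bar>) \<in> X" by (rule abs_lattice(1)[OF f]) auto
  have dm [measurable]: "dil a (u n) \<in> borel_measurable lebesgue" for n by (rule measurable_dil) simp
  have dX: "dil a (u n) \<in> X" for n
  proof (rule bounded_finite_support_in_X[where B="real n"])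
    show "emeasure lebesgue {x. dil a (u n) x \<noteq> 0} < \<infinity>"
      using a usup[of n] by (intro finite_support_of_bounded[where R="real n / a"]) (auto simp: dil_def abs_mult field_simps)
    show "\<bar>dil a (u n) x\<bar> \<le> real n" for x using u0(1,3) by (simp add: dil_def)
  qed (rule dm)
  have dN: "N (dil a (u n)) \<le> c * N f" for n
  proof -
    have "N (dil a (u n)) \<le> c * N (u n)" using u0 usup by (intro bd[where B="real n" and R="real n"]) auto
    also have "\<dots> \<le> c * N f" using c uN by (intro mult_left_mono) auto
    finally show ?thesis .
  qed
  have dfm [measurable]: "dil a f \<in> borel_measurable lebesgue" by (rule measurable_dil) simp
  show ?thesis using order_continuous_or_fatou
  proof (elim disjE, goal_cases)
    case oc: 1
    define w where "w = (\<lambda>n x. \<bar>f x\<bar> - u n x)"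
    have wX: "w n \<in> X" for n unfolding w_def by (intro diff absX uX)
    have "(\<lambda>n. N (w n)) \<longlonglongrightarrow> 0"
    proof (rule oc[rule_format], intro conjI allI wX AE_I2)
      fix x show "(\<lambda>n. w n x) \<longlonglongrightarrow> 0" unfolding w_def using tendsto_diff[OF tendsto_const[of "\<bar>f x\<bar>"] ulim[of x]] by simp
    qed (use u0 in \<open>auto simp: w_def\<close>)
    note w0 = this
    have ev: "\<exists>M. \<forall>n\<ge>M. N (w n) < e" if "e > 0" for e
      using order_tendstoD(2)[OF w0 that] by (simp add: eventually_sequentially)
    have cauchy: "\<exists>M. \<forall>m\<ge>M. \<forall>n\<ge>M. N (\<lambda>x. dil a (u m) x - dil a (u n) x) < e" if e0: "e > 0" for e
    proof -
      have "e / (c + 1) > 0" using e0 c by simp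
      then obtain M where M: "N (w M) < e / (c + 1)" using ev by blast
      \<comment> \<open>A difference of truncations is again bounded with bounded support, so
        \<open>bd\<close> applies to it, and beyond \<open>M\<close> it is dominated by the tail
        \<open>w M\<close>. Using \<open>c + 1\<close> avoids a division by 0.\<close>
      have "N (\<lambda>x. dil a (u m) x - dil a (u n) x) < e" if mn: "m \<ge> M" "n \<ge> M" for m n
      proof -
        have "N (\<lambda>x. dil a (u m) x - dil a (u n) x) = N (dil a (\<lambda>x. u m x - u n x))" by (simp add: dil_def)
        also have "\<dots> \<le> c * N (\<lambda>x. u m x - u n x)"
        proof (rule bd[where B="real m + real n" and R="real m + real n"])
          show "\<bar>u m x - u n x\<bar> \<le> real m + real n" for x using u0(1,3)[of m x] u0(1,3)[of n x] by linarith
          show "\<bar>x\<bar> > real m + real n \<Longrightarrow> u m x - u n x = 0" for x using usup[of m x] usup[of n x] by auto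
        qed measurable
        also have "\<dots> \<le> c * N (w M)"
        proof (rule mult_left_mono[OF _ c], rule abs_lattice(2)[OF wX])
          show "\<bar>u m x - u n x\<bar> \<le> \<bar>w M x\<bar>" for x
            using umono[OF mn(1), of x] umono[OF mn(2), of x] u0(2)[of m x] u0(2)[of n x] unfolding w_def by linarith
        qed measurable
        also have "\<dots> \<le> (c + 1) * N (w M)" using N_nonneg[OF wX] by (intro mult_right_mono) auto
        also have "\<dots> < e" using M c by (simp add: pos_less_divide_eq mult.commute)
        finally show ?thesis .
      qed
      then show ?thesis by blast
    qed
    obtain \<phi> where \<phi>: "\<phi> \<in> X" "N \<phi> \<le> K * (c * N f)" "\<And>n. AE x in lebesgue. dil a (u n) x \<le> \<phi> x"
      using increasing_Cauchy_dominated[of "\<lambda>n. dil a (u n)", OF dX _ cauchy dN] u0(4) by (auto simp: dil_def)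
    have "AE x in lebesgue. \<forall>n. dil a (u n) x \<le> \<phi> x" using \<phi>(3) by (simp add: AE_all_countable)
    then have "AE x in lebesgue. \<bar>dil a f x\<bar> \<le> \<bar>\<phi> x\<bar>"
    proof eventually_elim
      case (elim x)
      have "\<bar>f (a * x)\<bar> \<le> \<phi> x" using elim by (intro LIMSEQ_le_const2[OF ulim]) (auto simp: dil_def)
      then show ?case by (simp add: dil_def)
    qed
    from AE_lattice[OF \<phi>(1) dfm this] \<phi>(2) show ?thesis by (auto simp: mult.assoc)
  next
    case fat: 2
    have "(\<lambda>x. \<bar>dil a f x\<bar>) \<in> X \<and> N (\<lambda>x. \<bar>dil a f x\<bar>) = (SUP n. N (dil a (u n)))"
    proof (rule fat[rule_format], intro conjI allI dX AE_I2)
      show "(\<lambda>x. \<bar>dil a f x\<bar>) \<in> borel_measurable lebesgue" by measurable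
      show "bdd_above (range (\<lambda>n. N (dil a (u n))))" using dN by (intro bdd_aboveI2)
    qed (use u0 ulim in \<open>auto simp: dil_def\<close>)
    moreover have "(SUP n. N (dil a (u n))) \<le> c * N f" using dN by (intro cSUP_least) auto
    moreover have "1 * (c * N f) \<le> K * (c * N f)" using K1 c N_nonneg[OF f] by (intro mult_right_mono) auto
    ultimately show ?thesis using abs_lattice[of "\<lambda>x. \<bar>dil a f x\<bar>" "dil a f"] by (auto simp: mult.assoc)
  qed
qed

end

subsection \<open>Necessity of the conditions on the Boyd indices\<close>

text \<open>At a negative point the singularity lies outside the support of \<open>G\<close>, so
  truncations at \<open>e < x\<close> change nothing and the principal value is an ordinary
  Stieltjes integral.\<close>

lemma hilbert_neg_eq:
  assumes [measurable]: "G \<in> borel_measurable borel" and G0: "\<And>y. y \<le> 0 \<Longrightarrow> G y = 0" and x: "x > 0"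
  shows "hilbert G (- x) = - (1 / pi) * (LINT y|lborel. G y / (x + y))"
proof -
  have tr: "hilbert_trunc G e (- x) = - (1 / pi) * (LINT y|lborel. G y / (x + y))" if e: "0 < e" "e < x" for e
  proof -
    have "(LINT y|lebesgue. indicator {y. e < \<bar>- x - y\<bar>} y * G y / (- x - y)) = (LINT y|lborel. indicator {y. e < \<bar>- x - y\<bar>} y * G y / (- x - y))"
      by (intro integral_completion) measurable
    also have "\<dots> = (LINT y|lborel. - (G y / (x + y)))"
    proof (intro Bochner_Integration.integral_cong refl)
      fix y
      have "- x - y = - (x + y)" by simp
      then have "G y / (- x - y) = - (G y / (x + y))" by (metis minus_divide_right)
      then show "indicator {y. e < \<bar>- x - y\<bar>} y * G y / (- x - y) = - (G y / (x + y))"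
        using G0[of y] e by (cases "y \<le> 0") (auto simp: indicator_def simp del: minus_add_distrib)
    qed
    finally show ?thesis unfolding hilbert_trunc_def by simp
  qed
  have "((\<lambda>e. hilbert_trunc G e (- x)) \<longlongrightarrow> - (1 / pi) * (LINT y|lborel. G y / (x + y))) (at_right 0)"
  proof (rule tendsto_eventually)
    show "\<forall>\<^sub>F e in at_right 0. hilbert_trunc G e (- x) = - (1 / pi) * (LINT y|lborel. G y / (x + y))"
      unfolding eventually_at_right_field using x tr by blast
  qed
  then show ?thesis unfolding hilbert_def by (intro tendsto_Lim) auto
qed

lemma has_bochner_integral_inverse_Icc:
  fixes a b :: real
  assumes "0 < a" "a \<le> b"
  shows "has_bochner_integral lborel (\<lambda>y. indicator {a..b} y * (1 / y)) (ln b - ln a)"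
proof -
  have "has_bochner_integral lborel (\<lambda>x. indicator {a..b} x *\<^sub>R (1 / x)) (ln b - ln a)"
  proof (rule has_bochner_integral_FTC_Icc[OF assms(2)])
    show "(ln has_vector_derivative 1 / x) (at x within {a..b})" if "a \<le> x" "x \<le> b" for x
      using that assms by (auto intro!: derivative_eq_intros simp: has_real_derivative_iff_has_vector_derivative[symmetric] divide_inverse)
    show "continuous_on {a..b} (\<lambda>x. 1 / x)" using assms by (auto intro!: continuous_intros)
  qed
  then show ?thesis by simp
qed

lemma integrable_bounded_on_interval:
  fixes f :: "real \<Rightarrow> real"
  assumes [measurable]: "f \<in> borel_measurable borel" and "\<And>x. \<bar>f x\<bar> \<le> B" "\<And>x. x \<notin> {a..b} \<Longrightarrow> f x = 0"
  shows "integrable lborel f"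
proof (rule Bochner_Integration.integrable_bound)
  show "integrable lborel (\<lambda>x. B * indicator {a..b} x)"
    by (intro integrable_mult_right) (use emeasure_lborel_Icc_eq[of a b] in \<open>auto simp: integrable_indicator_iff\<close>)
  show "AE x in lborel. norm (f x) \<le> norm (B * indicator {a..b} x)"
    using assms(2,3) by (intro AE_I2) (auto simp: indicator_def intro: order_trans[OF _ abs_ge_self])
qed simp

text \<open>All terms of the Stieltjes integral have one sign, so any integrable minorant
  \<open>h\<close> gives a lower bound. Below, \<open>h\<close> keeps only a convenient interval and
  replaces \<open>G\<close> by its value at an end of it.\<close>

lemma hilbert_neg_ge:
  assumes Gm [measurable]: "G \<in> borel_measurable borel" and G: "\<And>y. 0 \<le> G y" "\<And>y. G y \<le> B" "\<And>y. y \<le> 0 \<Longrightarrow> G y = 0" "\<And>y. y \<ge> R \<Longrightarrow> G y = 0"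
    and x: "x > 0" and h: "integrable lborel h" "\<And>y. y > 0 \<Longrightarrow> h y \<le> G y / (x + y)" "\<And>y. y \<le> 0 \<Longrightarrow> h y \<le> 0"
  shows "(LINT y|lborel. h y) \<le> pi * \<bar>hilbert G (- x)\<bar>"
proof -
  have i: "integrable lborel (\<lambda>y. G y / (x + y))"
  proof (rule integrable_bounded_on_interval[where a=0 and b=R and B="B / x"])
    have B0: "B \<ge> 0" using G(1,2)[of 0] by linarith
    show "\<bar>G y / (x + y)\<bar> \<le> B / x" for y
    proof (cases "y \<le> 0")
      case False
      then show ?thesis using G(1,2)[of y] x B0 by (auto simp: abs_div_pos intro!: frac_le)
    qed (use G(3) B0 x in auto)
    show "G y / (x + y) = 0" if "y \<notin> {0..R}" for y using that G(3)[of y] G(4)[of y] by auto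
  qed measurable
  have "(LINT y|lborel. h y) \<le> (LINT y|lborel. G y / (x + y))"
  proof (intro integral_mono h(1) i)
    show "h y \<le> G y / (x + y)" for y
      using h(2)[of y] h(3)[of y] G(3)[of y] by (cases "y > 0") auto
  qed
  also have "\<dots> = - pi * hilbert G (- x)" using hilbert_neg_eq[OF Gm G(3) x] by simp
  also have "\<dots> \<le> pi * \<bar>hilbert G (- x)\<bar>" using abs_ge_minus_self[of "pi * hilbert G (- x)"] by (simp add: abs_mult)
  finally show ?thesis .
qed

context ri
begin

text \<open>Reflection preserves Lebesgue measure, so the values of the Hilbert transform on the
  negative half line can be compared with those of \<open>g\<close> on the positive one.\<close>

lemma hilbert_reflect_le:
  assumes H: "hilbert G \<in> X" and [measurable]: "g \<in> borel_measurable lebesgue" and c: "c \<ge> 0"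
    and le: "\<And>x. x > 0 \<Longrightarrow> \<bar>g x\<bar> \<le> c * \<bar>hilbert G (- x)\<bar>" and g0: "\<And>x. x \<le> 0 \<Longrightarrow> g x = 0"
  shows "g \<in> X" "N g \<le> c * N (hilbert G)"
proof -
  define h where "h = (\<lambda>x. c * hilbert G x)"
  have hX: "h \<in> X" unfolding h_def using H by (rule scale)
  have hm [measurable]: "h \<in> borel_measurable lebesgue" using hX by (rule X_meas)
  have "distr_fun g t \<le> distr_fun h t" if "t \<ge> 0" for t
  proof -
    have "distr_fun g t \<le> distr_fun (dil (-1) h) t"
    proof (rule emeasure_mono)
      show "{x. t < \<bar>g x\<bar>} \<subseteq> {x. t < \<bar>dil (-1) h x\<bar>}"
      proof clarify
        fix x assume t: "t < \<bar>g x\<bar>"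
        then have "x > 0" using g0[of x] that by (cases "x > 0") auto
        then show "t < \<bar>dil (-1) h x\<bar>" using t le[of x] c by (simp add: dil_def h_def abs_mult)
      qed
      show "{x. t < \<bar>dil (-1) h x\<bar>} \<in> sets lebesgue" by (rule sets_lebesgue_Collect) measurable
    qed
    also have "{x. t < \<bar>dil (-1) h x\<bar>} = (\<lambda>x. (-1) *\<^sub>R x + 0) ` {x. t < \<bar>h x\<bar>}"
    proof safe
      fix x assume "t < \<bar>dil (-1) h x\<bar>"
      then show "x \<in> (\<lambda>x. (-1) *\<^sub>R x + 0) ` {x. t < \<bar>h x\<bar>}" by (intro image_eqI[of _ _ "- x"]) (auto simp: dil_def)
    qed (auto simp: dil_def)
    also have "emeasure lebesgue \<dots> = distr_fun h t"
      using emeasure_lebesgue_affine[of "-1" 0 "{x. t < \<bar>h x\<bar>}"] by simp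
    finally show ?thesis .
  qed
  from measure_lattice[OF hX _ this] have "g \<in> X" "N g \<le> N h" by auto
  then show "g \<in> X" "N g \<le> c * N (hilbert G)" using N_scale[OF H, of c] c by (auto simp: h_def)
qed

lemma dil_bound_power:
  assumes a: "a > 0" and c: "c \<ge> 0" and d: "\<And>f. f \<in> X \<Longrightarrow> dil a f \<in> X \<and> N (dil a f) \<le> c * N f" and f: "f \<in> X"
  shows "dil (a ^ k) f \<in> X \<and> N (dil (a ^ k) f) \<le> c ^ k * N f"
proof (induction k)
  case 0
  have "dil 1 f = f" by (simp add: dil_def fun_eq_iff)
  then show ?case using f by simp
next
  case (Suc k)
  have "dil (a ^ Suc k) f = dil a (dil (a ^ k) f)" by (simp add: dil_dil mult.commute)
  moreover have "N (dil a (dil (a ^ k) f)) \<le> c * (c ^ k * N f)"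
  proof (rule order_trans)
    show "N (dil a (dil (a ^ k) f)) \<le> c * N (dil (a ^ k) f)" using d Suc by blast
    show "c * N (dil (a ^ k) f) \<le> c * (c ^ k * N f)" using Suc c by (intro mult_left_mono) auto
  qed
  ultimately show ?case using d Suc by (auto simp: mult.assoc)
qed

text \<open>The distribution function of \<open>dil a f\<close> is that of \<open>f\<close> divided
  by \<open>a\<close>; no pointwise monotonicity of \<open>f\<close> is involved.\<close>

lemma dil_antimono:
  assumes f: "f \<in> X" and a: "0 < a" "a \<le> b" and da: "dil a f \<in> X"
  shows "dil b f \<in> X" "N (dil b f) \<le> N (dil a f)"
proof -
  have "distr_fun (dil b f) t \<le> distr_fun (dil a f) t" for t
  proof -
    have "1 / b \<le> 1 / a" using a by (simp add: frac_le)
    then show ?thesis using a by (subst (1 2) emeasure_dil) (auto intro!: mult_right_mono ennreal_leI)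
  qed
  moreover have "dil b f \<in> borel_measurable lebesgue" using X_meas[OF f] by (rule measurable_dil)
  ultimately show "dil b f \<in> X" "N (dil b f) \<le> N (dil a f)" using measure_lattice[OF da] by auto
qed

end

locale ri_hilbert = ri +
  fixes C :: real
  assumes C: "C \<ge> 1"
    and hilbert_bounded: "\<And>f. f \<in> borel_measurable lebesgue \<Longrightarrow> bounded (range f) \<Longrightarrow>
        emeasure lebesgue {x. f x \<noteq> 0} < \<infinity> \<Longrightarrow> hilbert f \<in> X \<and> N (hilbert f) \<le> C * N f"
begin

lemma hilbert_Borel_bounded:
  assumes "G \<in> borel_measurable borel" "\<And>y. 0 \<le> G y" "\<And>y. G y \<le> B" "\<And>y. y \<le> 0 \<Longrightarrow> G y = 0" "\<And>y. y \<ge> R \<Longrightarrow> G y = 0"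
  shows "G \<in> X" "hilbert G \<in> X" "N (hilbert G) \<le> C * N G"
proof -
  have m: "G \<in> borel_measurable lebesgue" using assms(1) by (intro measurable_completion) simp
  have fs: "emeasure lebesgue {x. G x \<noteq> 0} < \<infinity>"
  proof (rule finite_support_of_bounded[of "\<bar>R\<bar>"])
    fix x assume "\<bar>R\<bar> < \<bar>x\<bar>" then show "G x = 0" using assms(4)[of x] assms(5)[of x] by linarith
  qed
  have "bounded (range G)" using assms(2,3) by (intro boundedI[where B=B]) auto
  then show "hilbert G \<in> X" "N (hilbert G) \<le> C * N G" using hilbert_bounded[OF m _ fs] by auto
  show "G \<in> X" using assms(2,3) by (intro bounded_finite_support_in_X[OF m _ fs, of B]) auto
qed

text \<open>Dilation multiplies all distribution functions by the same factor, so \<open>f\<close>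
  may be replaced by its rearrangement in both norms. The support of the latter lies in an interval
  of the length of the support of \<open>f\<close>, enlarged by 1 to make \<open>M\<close>
  positive.\<close>

lemma dec_rearr_setup:
  assumes f: "f \<in> borel_measurable lebesgue" "\<And>x. \<bar>f x\<bar> \<le> B" "\<And>x. \<bar>x\<bar> > R \<Longrightarrow> f x = 0"
  obtains M where "M > 0" "\<And>y. y \<ge> M \<Longrightarrow> dec_rearr f y = 0"
    "\<And>a. a > 0 \<Longrightarrow> dil a (dec_rearr f) \<in> X \<Longrightarrow> N (dil a f) \<le> N (dil a (dec_rearr f))" "N (dec_rearr f) \<le> N f"
proof -
  interpret bounded_fun f B using f by unfold_locales auto
  have "emeasure lebesgue {x. f x \<noteq> 0} < \<infinity>" by (rule finite_support_of_bounded) (rule f(3))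
  then obtain m where m: "emeasure lebesgue {x. f x \<noteq> 0} = ennreal m" "m \<ge> 0" by (cases "emeasure lebesgue {x. f x \<noteq> 0}") auto
  define M where "M = m + 1"
  have M: "M > 0" "\<And>y. y \<ge> M \<Longrightarrow> dec_rearr f y = 0"
    using m dec_rearr_eq_0[of M] unfolding M_def by (auto intro!: ennreal_leI)
  have dm: "dec_rearr f \<in> borel_measurable lebesgue" using dec_rearr_borel by (intro measurable_completion) simp
  have fX: "f \<in> X" using f m by (intro bounded_finite_support_in_X[of f B]) auto
  have "N (dec_rearr f) \<le> N f" 
    by (rule measure_lattice(2)[OF fX dm]) (simp only: emeasure_dec_rearr order_refl)
  moreover have "N (dil a f) \<le> N (dil a (dec_rearr f))" if a: "a > 0" "dil a (dec_rearr f) \<in> X" for a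
    by (rule measure_lattice(2)[OF a(2)]) (use f a in \<open>simp_all only: measurable_dil emeasure_dil emeasure_dec_rearr order_refl\<close>)
  ultimately show ?thesis using that M by blast
qed

lemma dil_bound_large:
  assumes b: "b > 1" and f: "f \<in> borel_measurable lebesgue" "\<And>x. \<bar>f x\<bar> \<le> B" "\<And>x. \<bar>x\<bar> > R \<Longrightarrow> f x = 0"
  shows "N (dil b f) \<le> 2 * pi * C / ln b * N f"
proof -
  interpret bounded_fun f B using f by unfold_locales auto
  define F where "F = dec_rearr f"
  obtain M where M: "M > 0" "\<And>y. y \<ge> M \<Longrightarrow> F y = 0" and NF: "\<And>a. a > 0 \<Longrightarrow> dil a F \<in> X \<Longrightarrow> N (dil a f) \<le> N (dil a F)" "N F \<le> N f"
    using dec_rearr_setup[OF f] unfolding F_def by blast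
  have F0: "0 \<le> F y" "F y \<le> B" for y unfolding F_def by (rule dec_rearr_nonneg dec_rearr_le)+
  have Fneg: "y \<le> 0 \<Longrightarrow> F y = 0" for y by (simp add: F_def dec_rearr_def)
  have Fm [measurable]: "F \<in> borel_measurable borel" unfolding F_def by (rule dec_rearr_borel)
  have Fl [measurable]: "F \<in> borel_measurable lebesgue" using Fm by (intro measurable_completion) simp
  have H: "F \<in> X" "hilbert F \<in> X" "N (hilbert F) \<le> C * N F"
    using hilbert_Borel_bounded[of F B M] Fm F0 Fneg M(2) by auto
  have HN: "N (hilbert F) \<le> C * N f" using H(3) mult_left_mono[OF NF(2), of C] C by linarith
  have lb: "ln b > 0" using b by simp
  define c where "c = 2 * pi / ln b"
  have c: "c \<ge> 0" using lb by (simp add: c_def)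
  \<comment> \<open>On \<open>{x..b * x}\<close> one has \<open>F y \<ge> F (b * x)\<close> and
    \<open>x + y \<le> 2 * y\<close>; integrating \<open>1 / y\<close> there yields
    \<open>ln b\<close>.\<close>
  have key: "\<bar>dil b F x\<bar> \<le> c * \<bar>hilbert F (- x)\<bar>" if x: "x > 0" for x
  proof -
    have i: "has_bochner_integral lborel (\<lambda>y. F (b * x) / 2 * (indicator {x..b*x} y * (1 / y))) (F (b * x) / 2 * (ln (b * x) - ln x))"
      using x b by (intro has_bochner_integral_mult_right has_bochner_integral_inverse_Icc) auto
    have "(LINT y|lborel. F (b * x) / 2 * (indicator {x..b*x} y * (1 / y))) \<le> pi * \<bar>hilbert F (- x)\<bar>"
    proof (rule hilbert_neg_ge[OF Fm F0 Fneg M(2) x])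
      fix y :: real assume y: "0 < y"
      show "F (b * x) / 2 * (indicator {x..b * x} y * (1 / y)) \<le> F y / (x + y)"
      proof (cases "y \<in> {x..b*x}")
        case True
        have "F (b * x) \<le> F y" unfolding F_def using True y by (intro dec_rearr_antimono) auto
        then have "F (b * x) / (2 * y) \<le> F y / (x + y)" using True y x F0 by (intro frac_le) auto
        then show ?thesis using True by simp
      qed (use F0[of y] x y in auto)
    qed (use i x in \<open>auto simp: has_bochner_integral_iff\<close>)
    then have "F (b * x) / 2 * ln b \<le> pi * \<bar>hilbert F (- x)\<bar>"
      using i x b by (simp add: has_bochner_integral_iff ln_mult)
    then have "F (b * x) \<le> c * \<bar>hilbert F (- x)\<bar>" using lb by (simp add: c_def field_simps)
    then show ?thesis using F0 by (simp add: dil_def)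
  qed
  have "dil b F \<in> X \<and> N (dil b F) \<le> c * N (hilbert F)"
    using hilbert_reflect_le[OF H(2) _ c key] Fneg b measurable_dil[OF Fl] by (auto simp: dil_def mult_le_0_iff)
  then have "N (dil b f) \<le> c * N (hilbert F)" using NF(1)[of b] b by linarith
  also have "\<dots> \<le> c * (C * N f)"
    by (intro mult_left_mono c HN)
  finally show ?thesis by (simp add: c_def)
qed

text \<open>One application of the Hilbert transform only yields a bound of order \<open>1 / a\<close>. Applying it again to the averages
  \<open>G\<close> of \<open>F\<close> gains the factor \<open>ln (1 / a)\<close>.\<close>

lemma dil_bound_small:
  assumes a: "0 < a" "a < 1" and f: "f \<in> borel_measurable lebesgue" "\<And>x. \<bar>f x\<bar> \<le> B" "\<And>x. \<bar>x\<bar> > R \<Longrightarrow> f x = 0"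
  shows "N (dil a f) \<le> (2 * pi * C)^2 / (a * ln (1 / a)) * N f"
proof -
  interpret bounded_fun f B using f by unfold_locales auto
  define F where "F = dec_rearr f"
  obtain M where M: "M > 0" "\<And>y. y \<ge> M \<Longrightarrow> F y = 0" and NF: "\<And>a. a > 0 \<Longrightarrow> dil a F \<in> X \<Longrightarrow> N (dil a f) \<le> N (dil a F)" "N F \<le> N f"
    using dec_rearr_setup[OF f] unfolding F_def by blast
  have F0: "0 \<le> F y" "F y \<le> B" for y unfolding F_def by (rule dec_rearr_nonneg dec_rearr_le)+
  have Fneg: "y \<le> 0 \<Longrightarrow> F y = 0" for y by (simp add: F_def dec_rearr_def)
  have Fm [measurable]: "F \<in> borel_measurable borel" unfolding F_def by (rule dec_rearr_borel)
  have Fl [measurable]: "F \<in> borel_measurable lebesgue" using Fm by (intro measurable_completion) simp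
  have H: "F \<in> X" "hilbert F \<in> X" "N (hilbert F) \<le> C * N F"
    using hilbert_Borel_bounded[of F B M] Fm F0 Fneg M(2) by auto
  have HN: "N (hilbert F) \<le> C * N f" using H(3) mult_left_mono[OF NF(2), of C] C by linarith
  \<comment> \<open>The averages have unbounded support and are cut off at \<open>L\<close>. Nothing
    is lost, since \<open>F (a * x) = 0\<close> for \<open>x \<ge> L\<close>.\<close>
  define L where "L = M / a"
  define J where "J = (\<lambda>y. LINT u|lborel. (if 0 < u \<and> u < y then F u else 0))"
  define G where "G = (\<lambda>y. if 0 < y \<and> y < L then J y / y else 0)"
  have Jm [measurable]: "J \<in> borel_measurable borel" unfolding J_def by measurable
  have Gm [measurable]: "G \<in> borel_measurable borel" unfolding G_def by measurable
  have Ji: "integrable lborel (\<lambda>u. if 0 < u \<and> u < y then F u else 0)" for y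
    by (rule integrable_bounded_on_interval[where a=0 and b=y and B=B]) (use F0 B_nonneg in auto)
  have ind: "has_bochner_integral lborel (\<lambda>u. c * indicator {0<..<y} u) (c * y)" if "y > 0" for c y :: real
    using that by (auto simp: has_bochner_integral_iff integrable_indicator_iff)
  have J0: "J y \<ge> 0" for y unfolding J_def using F0 by (intro integral_nonneg_AE) auto
  have JB: "J y \<le> B * y" if "y > 0" for y
  proof -
    have "J y \<le> (LINT u|lborel. B * indicator {0<..<y} u)"
      unfolding J_def using F0 B_nonneg
      by (intro integral_mono Ji integrable.intros[OF ind[OF that]]) auto
    also have "\<dots> = B * y" by (rule has_bochner_integral_integral_eq[OF ind[OF that]])
    finally show ?thesis .
  qed
  have JF: "z * F z \<le> J y" if "0 < z" "z \<le> y" for y z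
  proof -
    have "(LINT u|lborel. F z * indicator {0<..<z} u) \<le> J y"
      unfolding J_def
    proof (rule integral_mono[OF _ Ji])
      show "integrable lborel (\<lambda>u. F z * indicator {0<..<z} u)" by (rule integrable.intros[OF ind[OF that(1)]])
      show "F z * indicator {0<..<z} u \<le> (if 0 < u \<and> u < y then F u else 0)" for u
      proof (cases "u \<in> {0<..<z}")
        case True
        then have "F z \<le> F u" unfolding F_def by (intro dec_rearr_antimono) auto
        then show ?thesis using True that by auto
      qed (use F0 in auto)
    qed
    moreover have "(LINT u|lborel. F z * indicator {0<..<z} u) = F z * z" by (rule has_bochner_integral_integral_eq[OF ind[OF that(1)]])
    ultimately show ?thesis by (simp only: mult.commute)
  qed
  have G0: "0 \<le> G y" for y using J0 by (simp add: G_def)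
  have GB: "G y \<le> B" for y using JB[of y] B_nonneg by (auto simp: G_def pos_divide_le_eq)
  have Gneg: "y \<le> 0 \<Longrightarrow> G y = 0" and GL: "y \<ge> L \<Longrightarrow> G y = 0" for y by (auto simp: G_def)
  have HG: "G \<in> X" "hilbert G \<in> X" "N (hilbert G) \<le> C * N G"
    using hilbert_Borel_bounded[of G B L] Gm G0 GB Gneg GL by auto
  have GF: "N G \<le> 2 * pi * (C * N f)"
  proof -
    \<comment> \<open>For \<open>u < x\<close> the kernel satisfies
      \<open>1 / (x + u) \<ge> 1 / (2 * x)\<close>, so the Stieltjes transform dominates half the
      average of \<open>F\<close> over \<open>{0<..<x}\<close>.\<close>
    have key: "\<bar>G x\<bar> \<le> 2 * pi * \<bar>hilbert F (- x)\<bar>" if x: "x > 0" for x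
    proof -
      have "(LINT u|lborel. (if 0 < u \<and> u < x then F u else 0) / (2 * x)) \<le> pi * \<bar>hilbert F (- x)\<bar>"
      proof (rule hilbert_neg_ge[OF Fm F0 Fneg M(2) x])
        show "integrable lborel (\<lambda>u. (if 0 < u \<and> u < x then F u else 0) / (2 * x))"
          using Ji by (rule Bochner_Integration.integrable_divide_zero)
        show "(if 0 < y \<and> y < x then F y else 0) / (2 * x) \<le> F y / (x + y)" if "0 < y" for y
          using that x F0[of y] by (auto intro!: frac_le)
      qed auto
      then have "J x / (2 * x) \<le> pi * \<bar>hilbert F (- x)\<bar>" by (simp add: J_def)
      then have "J x / x \<le> 2 * pi * \<bar>hilbert F (- x)\<bar>" using x by (simp add: field_simps)
      then show ?thesis using J0[of x] x by (simp add: G_def)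
    qed
    have "N G \<le> 2 * pi * N (hilbert F)"
    proof (rule hilbert_reflect_le(2)[OF H(2) _ _ key Gneg])
      show "G \<in> borel_measurable lebesgue" using Gm by (intro measurable_completion) simp
    qed auto
    also have "\<dots> \<le> 2 * pi * (C * N f)"
      by (intro mult_left_mono HN) auto
    finally show ?thesis .
  qed
  have la: "ln (1 / a) > 0" using a by simp
  define c where "c = 2 * pi / (a * ln (1 / a))"
  have c: "c \<ge> 0" using a la by (simp add: c_def)
  \<comment> \<open>With \<open>z = a * x\<close>, on \<open>{z..x}\<close> the average satisfies
    \<open>G y \<ge> z * F z / y\<close>, while \<open>x + y \<le> 2 * x\<close>. Integrating
    \<open>1 / y\<close> gives \<open>ln (1 / a)\<close>, and \<open>z / (2 * x) = a / 2\<close> is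
    the remaining factor.\<close>
  have key: "\<bar>dil a F x\<bar> \<le> c * \<bar>hilbert G (- x)\<bar>" if x: "x > 0" for x
  proof (cases "x < L")
    case False
    then have "a * x \<ge> M" using a by (simp add: L_def field_simps)
    then show ?thesis using M(2) c by (simp add: dil_def)
  next
    case True
    define z where "z = a * x"
    have z: "0 < z" "z < x" using a x by (auto simp: z_def)
    have i: "has_bochner_integral lborel (\<lambda>y. a * F z / 2 * (indicator {z..x} y * (1 / y))) (a * F z / 2 * (ln x - ln z))"
      using z by (intro has_bochner_integral_mult_right has_bochner_integral_inverse_Icc) auto
    have "(LINT y|lborel. a * F z / 2 * (indicator {z..x} y * (1 / y))) \<le> pi * \<bar>hilbert G (- x)\<bar>"
    proof (rule hilbert_neg_ge[OF Gm G0 GB Gneg GL x])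
      fix y :: real assume y: "0 < y"
      show "a * F z / 2 * (indicator {z..x} y * (1 / y)) \<le> G y / (x + y)"
      proof (cases "y \<in> {z..x}")
        case yz: True
        have "z * F z \<le> J y" using z yz by (intro JF) auto
        then have "z * F z / y \<le> G y" using yz True y by (simp add: G_def divide_right_mono)
        then have "(z * F z / y) / (2 * x) \<le> G y / (x + y)" using yz y x z F0 G0[of y] by (intro frac_le) auto
        moreover have "(z * F z / y) / (2 * x) = a * F z / 2 * (1 / y)" using x by (simp add: z_def)
        ultimately show ?thesis using yz by simp
      qed (use G0[of y] x y in auto)
    qed (use i z in \<open>auto simp: has_bochner_integral_iff\<close>)
    moreover have "ln x - ln z = ln (1 / a)" using x a by (simp add: z_def ln_mult ln_div)
    ultimately have "a * F z / 2 * ln (1 / a) \<le> pi * \<bar>hilbert G (- x)\<bar>"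
      using i by (simp add: has_bochner_integral_iff)
    then have "F z * (a * ln (1 / a)) \<le> 2 * pi * \<bar>hilbert G (- x)\<bar>" by (simp add: mult_ac)
    then have "F z \<le> 2 * pi * \<bar>hilbert G (- x)\<bar> / (a * ln (1 / a))" using a la by (subst pos_le_divide_eq) auto
    then show ?thesis using F0 by (simp add: dil_def z_def c_def)
  qed
  have dX: "dil a F \<in> X" and dN: "N (dil a F) \<le> c * N (hilbert G)"
    using hilbert_reflect_le[OF HG(2) _ c key] Fneg a measurable_dil[OF Fl] by (auto simp: dil_def mult_le_0_iff)
  have "N (dil a f) \<le> c * N (hilbert G)" using NF(1)[OF a(1) dX] dN by linarith
  also have "\<dots> \<le> c * (C * (2 * pi * (C * N f)))"
    using HG(3) mult_left_mono[OF GF, of C] C by (intro mult_left_mono c) linarith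
  also have "\<dots> = (2 * pi * C)^2 / (a * ln (1 / a)) * N f" by (simp add: c_def power2_eq_square)
  finally show ?thesis .
qed

section \<open>From a gain at one scale to the Boyd indices\<close>

lemma boyd_upper_finite: "boyd_upper X N < \<infinity>"
proof -
  \<comment> \<open>With this \<open>b\<close> the bound of \<open>dil_bound_large\<close>, times
    the factor \<open>K\<close> lost in \<open>dil_bound_extend\<close>, is exactly
    \<open>1 / 2\<close>.\<close>
  define b where "b = exp (4 * pi * C * K)"
  have e0: "4 * pi * C * K > 0" using C K1 by simp
  have b: "b > 1" unfolding b_def using e0 by simp
  have lb: "ln b = 4 * pi * C * K" by (simp add: b_def)
  have half: "dil b f \<in> X \<and> N (dil b f) \<le> (1/2) * N f" if f: "f \<in> X" for f
  proof -
    have "dil b f \<in> X \<and> N (dil b f) \<le> K * (2 * pi * C / ln b) * N f"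
    proof (rule dil_bound_extend[OF _ _ _ f])
      show "N (dil b g) \<le> 2 * pi * C / ln b * N g" 
        if "g \<in> borel_measurable lebesgue" "\<And>x. \<bar>g x\<bar> \<le> B" "\<And>x. \<bar>x\<bar> > R \<Longrightarrow> g x = 0" for g B R
        using that by (rule dil_bound_large[OF b])
    qed (use b C in auto)
    moreover have "K * (2 * pi * C / ln b) = 1/2" unfolding lb using C K1 by simp
    ultimately show ?thesis by (simp only:)
  qed
  \<comment> \<open>The exponent for which \<open>b powr (-1/q) = 1/2\<close>, so that the powers of
    \<open>b\<close> fit the rate exactly. A scale \<open>a\<close> between \<open>b ^ k\<close> and
    \<open>b ^ (k + 1)\<close> is compared with \<open>b ^ k\<close>, at the price of a factor
    2.\<close>
  define q where "q = ln b / ln 2"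
  have q: "q > 0" using b by (simp add: q_def)
  have bq: "b powr (-1/q) = 1/2"
  proof -
    have "b powr (-1/q) = exp (- ln 2)" using b by (simp add: powr_def q_def)
    then show ?thesis by (simp add: exp_minus)
  qed
  have "dil a f \<in> X \<and> N (dil a f) \<le> 2 * a powr (-1/q) * N f" if a: "1 < a" and f: "f \<in> X" for a f
  proof -
    define n where "n = (LEAST n. a < b ^ n)"
    have "\<exists>n. a < b ^ n" using real_arch_pow[OF b] by blast
    then have n: "a < b ^ n" unfolding n_def by (rule LeastI_ex)
    then have "n \<noteq> 0" using a by (intro notI) simp
    then obtain k where k: "n = Suc k" by (cases n) auto
    have bk: "b ^ k \<le> a" using not_less_Least[of k "\<lambda>n. a < b ^ n"] k by (simp add: n_def not_less)
    have D: "dil (b ^ k) f \<in> X" "N (dil (b ^ k) f) \<le> (1/2) ^ k * N f"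
      using dil_bound_power[OF _ _ half f, of k] b by auto
    have "dil a f \<in> X" "N (dil a f) \<le> N (dil (b ^ k) f)" using dil_antimono[OF f _ bk D(1)] b by auto
    moreover have "(1/2) ^ k \<le> 2 * a powr (-1/q)"
    proof -
      have "(1/2) ^ n = (b powr (-1/q)) ^ n" by (simp only: bq)
      also have "\<dots> = (b ^ n) powr (-1/q)" using b by (simp add: powr_realpow[symmetric] powr_powr mult.commute)
      also have "\<dots> \<le> a powr (-1/q)" using n a q by (intro powr_mono2') auto
      finally show ?thesis by (simp add: k)
    qed
    then have "(1/2) ^ k * N f \<le> 2 * a powr (-1/q) * N f" using N_nonneg[OF f] by (intro mult_right_mono)
    ultimately show ?thesis using D(2) by linarith
  qed
  then have "ereal q \<in> {ereal q | q. 0 < q \<and> (\<exists>c. \<forall>a. 1 < a \<longrightarrow>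
        (\<forall>f\<in>X. dil a f \<in> X \<and> N (dil a f) \<le> c * a powr (-1/q) * N f))}"
    using q by blast
  then have "boyd_upper X N \<le> ereal q" unfolding boyd_upper_def by (rule Inf_lower)
  then show ?thesis by (rule le_less_trans) simp
qed

lemma boyd_lower_gt_1: "boyd_lower X N > 1"
proof -
  define D where "D = (2 * pi * C)^2"
  have D: "D > 0" using C by (simp add: D_def)
  \<comment> \<open>Makes \<open>D * K / ln (1 / a)\<close> at most \<open>1 / 2\<close>, so the
    dilation norm is at most \<open>1 / (2 * a)\<close>, strictly better than the critical rate
    \<open>1 / a\<close>.\<close>
  define a where "a = exp (- (2 * D * K + 1))"
  have DK: "D * K > 0" using D K1 by simp
  have a: "0 < a" "a < 1" using DK by (auto simp: a_def)
  have la: "ln (1 / a) = 2 * D * K + 1" by (simp add: a_def ln_div)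
  \<comment> \<open>Ensures \<open>1 / (2 * a) > 1\<close>, hence a positive logarithm in the
    denominator of \<open>p\<close> below.\<close>
  have a2: "a < 1/2"
  proof -
    have "a \<le> exp (- 1)" using DK by (simp add: a_def)
    also have "exp (- 1 :: real) < 1 / 2" using exp_ge_add_one_self[of "1::real"] exp_ge_one_plus_x_over_n_power_n[of 2 1] 
      by (simp add: exp_minus field_simps power2_eq_square)
    finally show ?thesis .
  qed
  have half: "dil a f \<in> X \<and> N (dil a f) \<le> (1 / (2 * a)) * N f" if f: "f \<in> X" for f
  proof -
    have "dil a f \<in> X \<and> N (dil a f) \<le> K * (D / (a * ln (1 / a))) * N f"
    proof (rule dil_bound_extend[OF _ _ _ f])
      show "N (dil a g) \<le> D / (a * ln (1 / a)) * N g" 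
        if "g \<in> borel_measurable lebesgue" "\<And>x. \<bar>g x\<bar> \<le> B" "\<And>x. \<bar>x\<bar> > R \<Longrightarrow> g x = 0" for g B R
        unfolding D_def using that by (rule dil_bound_small[OF a])
      show "0 \<le> D / (a * ln (1 / a))" using a D DK unfolding la by simp
    qed (use a in auto)
    moreover have "K * (D / (a * ln (1 / a))) \<le> 1 / (2 * a)"
    proof -
      have "D * K / (2 * D * K + 1) \<le> 1 / 2" using DK by (simp add: field_simps)
      then have "D * K / (2 * D * K + 1) / a \<le> 1 / 2 / a" using a by (intro divide_right_mono) auto
      then show ?thesis unfolding la by (simp add: mult_ac)
    qed
    then have "K * (D / (a * ln (1 / a))) * N f \<le> 1 / (2 * a) * N f" using N_nonneg[OF f] by (rule mult_right_mono)
    ultimately show ?thesis by linarith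
  qed
  \<comment> \<open>The solution of \<open>a powr (-1/p) = 1 / (2 * a)\<close>; it exceeds 1 because
    the halved norm has the smaller logarithm.\<close>
  define p where "p = ln (1 / a) / ln (1 / (2 * a))"
  have l2: "0 < ln (1 / (2 * a))" "ln (1 / (2 * a)) < ln (1 / a)"
  proof -
    have "1 < 1 / (2 * a)" "1 / (2 * a) < 1 / a" using a a2 by (simp_all add: field_simps)
    then show "0 < ln (1 / (2 * a))" "ln (1 / (2 * a)) < ln (1 / a)" using a by (simp_all only: ln_gt_zero) (subst ln_less_cancel_iff, auto)
  qed
  have p: "p > 1" using l2 by (simp add: p_def)
  have ap: "a powr (-1/p) = 1 / (2 * a)"
  proof -
    have "ln a = - ln (1 / a)" using a by (simp add: ln_div)
    then have "a powr (-1/p) = exp (ln (1 / (2 * a)))" using a l2 by (simp add: powr_def p_def)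
    then show ?thesis using a by simp
  qed
  have "dil b f \<in> X \<and> N (dil b f) \<le> (1 / (2 * a)) * b powr (-1/p) * N f" if b: "0 < b" "b < 1" and f: "f \<in> X" for b f
  proof -
    \<comment> \<open>Norms of dilations grow as the scale decreases, so \<open>b\<close> is
      compared with the next smaller power of \<open>a\<close>; one surplus factor
      \<open>1 / (2 * a)\<close> enters the constant.\<close>
    define n where "n = (LEAST n. a ^ n < b)"
    have "\<exists>n. a ^ n < b" using real_arch_pow_inv[OF b(1) a(2)] by blast
    then have n: "a ^ n < b" unfolding n_def by (rule LeastI_ex)
    then have "n \<noteq> 0" using b by (intro notI) simp
    then obtain k where k: "n = Suc k" by (cases n) auto
    have bk: "b \<le> a ^ k" using not_less_Least[of k "\<lambda>n. a ^ n < b"] k by (simp add: n_def not_less)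
    have Dn: "dil (a ^ n) f \<in> X" "N (dil (a ^ n) f) \<le> (1 / (2 * a)) ^ n * N f"
      using dil_bound_power[OF _ _ half f, of n] a by auto
    have "dil b f \<in> X" "N (dil b f) \<le> N (dil (a ^ n) f)" using dil_antimono[OF f _ _ Dn(1), of b] n a by auto
    moreover have "(1 / (2 * a)) ^ n \<le> (1 / (2 * a)) * b powr (-1/p)"
    proof -
      have "(1 / (2 * a)) ^ k = (a powr (-1/p)) ^ k" by (simp only: ap)
      also have "\<dots> = (a ^ k) powr (-1/p)" using a by (simp add: powr_realpow[symmetric] powr_powr mult.commute)
      also have "\<dots> \<le> b powr (-1/p)" using bk b p by (intro powr_mono2') auto
      finally show ?thesis using a by (simp add: k divide_right_mono)
    qed
    then have "(1 / (2 * a)) ^ n * N f \<le> (1 / (2 * a)) * b powr (-1/p) * N f" using N_nonneg[OF f] by (intro mult_right_mono)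
    ultimately show ?thesis using Dn(2) by linarith
  qed
  then have "ereal p \<in> {ereal p | p. 0 < p \<and> (\<exists>c. \<forall>a. 0 < a \<and> a < 1 \<longrightarrow>
        (\<forall>f\<in>X. dil a f \<in> X \<and> N (dil a f) \<le> c * a powr (-1/p) * N f))}"
    using p by (auto intro!: exI[of _ p] exI[of _ "1 / (2 * a)"])
  then have "ereal p \<le> boyd_lower X N" unfolding boyd_lower_def by (rule Sup_upper)
  moreover have "(1::ereal) < ereal p" using p by (simp add: one_ereal_def)
  ultimately show ?thesis by (rule less_le_trans[rotated])
qed

end

subsection \<open>The rearrangement of the Hilbert transform\<close>

text \<open>Every truncated integral ignores null sets, so the transforms agree at all points and
  not merely almost everywhere.\<close>

lemma hilbert_cong_AE:
  assumes "f \<in> borel_measurable lebesgue" "g \<in> borel_measurable lebesgue" "AE x in lebesgue. f x = g x"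
  shows "hilbert f = hilbert g"
proof -
  have "(LINT y|lebesgue. indicator {y. e < \<bar>x - y\<bar>} y * f y / (x - y)) = (LINT y|lebesgue. indicator {y. e < \<bar>x - y\<bar>} y * g y / (x - y))" for e x
  proof (rule integral_cong_AE)
    have k: "(\<lambda>y. indicator {y. e < \<bar>x - y\<bar>} y / (x - y)) \<in> borel_measurable lebesgue"
      by (intro measurable_completion) measurable
    show "(\<lambda>y. indicator {y. e < \<bar>x - y\<bar>} y * f y / (x - y)) \<in> borel_measurable lebesgue"
      using borel_measurable_times[OF k assms(1)] by simp
    show "(\<lambda>y. indicator {y. e < \<bar>x - y\<bar>} y * g y / (x - y)) \<in> borel_measurable lebesgue"
      using borel_measurable_times[OF k assms(2)] by simp
    show "AE y in lebesgue. indicator {y. e < \<bar>x - y\<bar>} y * f y / (x - y) = indicator {y. e < \<bar>x - y\<bar>} y * g y / (x - y)"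
      using assms(3) by eventually_elim simp
  qed
  then show ?thesis by (simp add: hilbert_def[abs_def] hilbert_trunc_def)
qed

text \<open>A \<open>Lim\<close> over a continuum of heights is not visibly measurable. Almost
  everywhere it equals the limit of a sequence of Borel functions, and Lebesgue measure is
  complete.\<close>

lemma borel_measurable_hilbert:
  assumes f: "integrable lborel f" and B: "\<And>y. \<bar>f y\<bar> \<le> B"
  shows "hilbert f \<in> borel_measurable lebesgue"
    "AE x in lebesgue. (\<lambda>n. conj_conv f (1 / (real n + 1)) x) \<longlonglongrightarrow> hilbert f x"
proof -
  have [measurable]: "f \<in> borel_measurable borel" using f by auto
  define w where "w = (\<lambda>x. lim (\<lambda>n. conj_conv f (1 / (real n + 1)) x))"
  have "w \<in> borel_measurable borel" unfolding w_def by measurable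
  then have wm: "w \<in> borel_measurable lebesgue" by (intro measurable_completion) simp
  have seq: "filterlim (\<lambda>n. 1 / (real n + 1)) (at_right 0) sequentially"
  proof -
    have "(\<lambda>n. 1 / (real n + 1)) \<longlonglongrightarrow> 0" by real_asymp
    moreover have "1 / (real n + 1) \<noteq> 0" for n by (simp add: add_nonneg_eq_0_iff)
    ultimately show ?thesis by (simp add: filterlim_at)
  qed
  have "AE x in lborel. (\<lambda>n. conj_conv f (1 / (real n + 1)) x) \<longlonglongrightarrow> hilbert f x"
    using AE_conj_conv_tendsto_hilbert[OF f B] by eventually_elim (rule filterlim_compose[OF _ seq])
  then show lim: "AE x in lebesgue. (\<lambda>n. conj_conv f (1 / (real n + 1)) x) \<longlonglongrightarrow> hilbert f x" by (rule AE_completion)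
  then have "AE x in lebesgue. w x = hilbert f x" by eventually_elim (simp add: w_def limI)
  then show "hilbert f \<in> borel_measurable lebesgue" by (rule borel_measurable_AE[OF wm])
qed

text \<open>The bounds are uniform in the height, so Fatou's lemma carries them to the boundary. The
  factor 2 comes from the positive and the negative part of \<open>f\<close>.\<close>

lemma set_nn_integral_hilbert_le:
  assumes r: "r \<ge> 2" and fm [measurable]: "f \<in> borel_measurable borel" and B: "\<And>x. \<bar>f x\<bar> \<le> B"
    and fs: "emeasure lborel {x. f x \<noteq> 0} < \<infinity>"
    and A [measurable]: "A \<in> sets borel" and At: "emeasure lborel A \<le> ennreal t" and t: "t > 0"
  shows "(\<integral>\<^sup>+x\<in>A. ennreal \<bar>hilbert f x\<bar> \<partial>lebesgue) \<le> 2 *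
    (\<Sum>n. ennreal (t * (4 + ln r)) * ennreal (dec_rearr f (r ^ n * t)) + ennreal (t * step_weight r n) * ennreal (dec_rearr f (t / r ^ n)))"
    (is "_ \<le> 2 * ?S")
proof -
  have fl: "f \<in> borel_measurable lebesgue" using fm by (intro measurable_completion) simp
  interpret bounded_fun f B using fl B by unfold_locales
  have fi: "integrable lborel f" by (rule integrable_bounded_finite_support[OF fm B fs])
  define M where "M = (\<lambda>l. emeasure lborel {y. l < \<bar>f y\<bar>})"
  have Mm: "M \<in> borel_measurable borel"
  proof -
    have "M = (\<lambda>l. \<integral>\<^sup>+y. (if l < \<bar>f y\<bar> then 1 else 0) \<partial>lborel)"
    proof
      fix l
      have "M l = (\<integral>\<^sup>+y. indicator {y. l < \<bar>f y\<bar>} y \<partial>lborel)" unfolding M_def by (rule nn_integral_indicator[symmetric]) simp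
      then show "M l = (\<integral>\<^sup>+y. (if l < \<bar>f y\<bar> then 1 else 0) \<partial>lborel)" by (simp add: indicator_def of_bool_def)
    qed
    then show ?thesis by simp
  qed
  have Mfin: "M l < \<infinity>" if "l > 0" for l
  proof -
    have "M l \<le> emeasure lborel {x. f x \<noteq> 0}" unfolding M_def using that by (intro emeasure_mono) auto
    then show ?thesis using fs by (rule le_less_trans)
  qed
  have MF: "l \<le> dec_rearr f s" if "s > 0" "ennreal s < M l" for s l
  proof -
    have "distr_fun f l = M l" unfolding M_def by simp
    then show ?thesis using less_dec_rearr_iff[OF that(1), of l] that(2) by simp
  qed
  have part: "(\<integral>\<^sup>+x\<in>A. ennreal \<bar>conj_conv g e x\<bar> \<partial>lborel) \<le> ?S" 
    if e: "e > 0" and g: "integrable lborel g" "\<And>y. 0 \<le> g y" "\<And>y. g y \<le> \<bar>f y\<bar>" for g e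
  proof (rule set_nn_integral_conj_conv_layer_le[where M=M, OF e r g(1,2) _ Mfin Mm MF A At t])
    have [measurable]: "g \<in> borel_measurable borel" using g by auto
    show "emeasure lborel {y. l < g y} \<le> M l" for l
      unfolding M_def using g(3) by (intro emeasure_mono) (auto intro: less_le_trans)
  qed
  define fp where "fp = (\<lambda>y. max (f y) 0)"
  define fn where "fn = (\<lambda>y. max (- f y) 0)"
  have fpn: "integrable lborel fp" "integrable lborel fn" unfolding fp_def fn_def using fi by auto
  have vm [measurable]: "conj_conv h e \<in> borel_measurable borel" if "integrable lborel h" for h e
    using that by (intro borel_measurable_conj_conv) auto
  note [measurable] = vm[OF fi] vm[OF fpn(1)] vm[OF fpn(2)]
  have eps: "(\<integral>\<^sup>+x. ennreal \<bar>conj_conv f e x\<bar> * indicator A x \<partial>lebesgue) \<le> 2 * ?S" if e: "e > 0" for e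
  proof -
    have split: "conj_conv f e x = conj_conv fp e x - conj_conv fn e x" for x
    proof -
      have "conj_poisson e (x - y) * f y = conj_poisson e (x - y) * fp y - conj_poisson e (x - y) * fn y" for y
        by (auto simp: fp_def fn_def max_def)
      then show ?thesis unfolding conj_conv_def
        using integrable_conj_poisson_mult[OF e fpn(1), of x] integrable_conj_poisson_mult[OF e fpn(2), of x] by simp
    qed
    have "(\<integral>\<^sup>+x. ennreal \<bar>conj_conv f e x\<bar> * indicator A x \<partial>lebesgue) = (\<integral>\<^sup>+x. ennreal \<bar>conj_conv f e x\<bar> * indicator A x \<partial>lborel)"
      by (rule nn_integral_completion)
    also have "\<dots> \<le> (\<integral>\<^sup>+x. ennreal \<bar>conj_conv fp e x\<bar> * indicator A x + ennreal \<bar>conj_conv fn e x\<bar> * indicator A x \<partial>lborel)"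
      unfolding split by (intro nn_integral_mono) (auto simp: indicator_def simp flip: ennreal_plus intro!: ennreal_leI)
    also have "\<dots> = (\<integral>\<^sup>+x\<in>A. ennreal \<bar>conj_conv fp e x\<bar> \<partial>lborel) + (\<integral>\<^sup>+x\<in>A. ennreal \<bar>conj_conv fn e x\<bar> \<partial>lborel)"
      by (rule nn_integral_add) measurable
    also have "\<dots> \<le> ?S + ?S"
      by (intro add_mono part e fpn) (auto simp: fp_def fn_def)
    finally show ?thesis by (simp add: mult_2)
  qed
  show ?thesis
  proof (rule nn_integral_tendsto_le[OF _ _ _ eps tendsto_const])
    have Al: "A \<in> sets lebesgue" by simp
    have cl: "conj_conv f e \<in> borel_measurable lebesgue" for e by (intro measurable_completion) simp
    show "(\<lambda>x. ennreal \<bar>conj_conv f (1 / (real n + 1)) x\<bar> * indicator A x) \<in> borel_measurable lebesgue" for n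
      using cl Al by measurable
    show "(\<lambda>x. ennreal \<bar>hilbert f x\<bar> * indicator A x) \<in> borel_measurable lebesgue"
      using borel_measurable_hilbert(1)[OF fi B] Al by measurable
    show "AE x in lebesgue. (\<lambda>n. ennreal \<bar>conj_conv f (1 / (real n + 1)) x\<bar> * indicator A x) \<longlonglongrightarrow> ennreal \<bar>hilbert f x\<bar> * indicator A x"
      using borel_measurable_hilbert(2)[OF fi B]
    proof eventually_elim
      case (elim x)
      show ?case using tendsto_ennrealI[OF tendsto_rabs[OF elim]] by (cases "x \<in> A") auto
    qed
  qed simp
qed

subsection \<open>Sufficiency of the conditions on the Boyd indices\<close>

context ri
begin

lemma zero_in_X: "(\<lambda>x. 0) \<in> X" and N_zero: "N (\<lambda>x. 0) = 0"
proof -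
  have "(indicator {} :: real \<Rightarrow> real) \<in> X" by (rule indicator_in_X) auto
  moreover have "(indicator {} :: real \<Rightarrow> real) = (\<lambda>x. 0)" by (simp add: fun_eq_iff)
  ultimately show z: "(\<lambda>x. 0) \<in> X" by simp
  show "N (\<lambda>x. 0) = 0" using N_eq_0[OF z] by simp
qed

text \<open>Splitting off the first summand each time charges the power \<open>K ^ (k + 1)\<close>
  to the summand of index \<open>k\<close>, so sufficiently fast geometric decay of the norms
  compensates the constants.\<close>

lemma quasi_sum:
  assumes "\<And>k. g k \<in> X"
  shows "(\<lambda>x. \<Sum>k<n. g k x) \<in> X" "N (\<lambda>x. \<Sum>k<n. g k x) \<le> (\<Sum>k<n. K ^ Suc k * N (g k))"
proof -
  have "(\<lambda>x. \<Sum>k<n. g k x) \<in> X \<and> N (\<lambda>x. \<Sum>k<n. g k x) \<le> (\<Sum>k<n. K ^ Suc k * N (g k))"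
    using assms
  proof (induction n arbitrary: g)
    case 0
    then show ?case by (simp add: zero_in_X N_zero)
  next
    case (Suc n)
    have IH: "(\<lambda>x. \<Sum>k<n. g (Suc k) x) \<in> X" "N (\<lambda>x. \<Sum>k<n. g (Suc k) x) \<le> (\<Sum>k<n. K ^ Suc k * N (g (Suc k)))"
      using Suc.IH[of "\<lambda>k. g (Suc k)"] Suc.prems by auto
    have "N (\<lambda>x. g 0 x + (\<Sum>k<n. g (Suc k) x)) \<le> K * (N (g 0) + N (\<lambda>x. \<Sum>k<n. g (Suc k) x))"
      by (intro quasi Suc.prems IH)
    also have "\<dots> \<le> K * (N (g 0) + (\<Sum>k<n. K ^ Suc k * N (g (Suc k))))"
      using K1 IH by (intro mult_left_mono) auto
    also have "\<dots> = (\<Sum>k<Suc n. K ^ Suc k * N (g k))"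
      unfolding sum.lessThan_Suc_shift by (simp add: distrib_left sum_distrib_left mult.assoc)
    finally show ?case
      using add[OF Suc.prems[of 0] IH(1)] unfolding sum.lessThan_Suc_shift by simp
  qed
  then show "(\<lambda>x. \<Sum>k<n. g k x) \<in> X" "N (\<lambda>x. \<Sum>k<n. g k x) \<le> (\<Sum>k<n. K ^ Suc k * N (g k))" by auto
qed

text \<open>The ratio \<open>1 / (2 * K)\<close> cancels the powers of \<open>K\<close> and leaves
  tails of size \<open>(1/2) ^ n\<close>. The limit in \<open>X\<close> is not identified with the
  pointwise sum: it is enough that it dominates all partial sums.\<close>

lemma series_dominated:
  assumes h: "\<And>k. h k \<in> X" "\<And>k x. 0 \<le> h k x" and D: "D \<ge> 0" "\<And>k. N (h k) \<le> D * (1 / (2 * K)) ^ k"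
  shows "\<exists>\<phi>\<in>X. N \<phi> \<le> K * (2 * K * D) \<and> (\<forall>n. AE x in lebesgue. (\<Sum>k<n. h k x) \<le> \<phi> x)"
proof -
  have tail: "N (\<lambda>x. \<Sum>k<j. h (n + k) x) \<le> 2 * K * D * (1/2) ^ n" for n j
  proof -
    have "N (\<lambda>x. \<Sum>k<j. h (n + k) x) \<le> (\<Sum>k<j. K ^ Suc k * N (h (n + k)))"
      by (rule quasi_sum(2)) (rule h)
    also have "\<dots> \<le> (\<Sum>k<j. K * D * (1/2) ^ n * (1/2) ^ k)"
    proof (rule sum_mono)
      fix k
      have "K ^ Suc k * N (h (n + k)) \<le> K ^ Suc k * (D * (1 / (2 * K)) ^ (n + k))"
        using K1 D by (intro mult_left_mono) auto
      also have "\<dots> = K * D * ((1 / (2 * K)) ^ n * (K * (1 / (2 * K))) ^ k)"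
      proof -
        have "K ^ Suc k * (D * w ^ (n + k)) = K * D * (w ^ n * (K * w) ^ k)" for w
          by (simp add: power_add power_mult_distrib mult_ac)
        then show ?thesis .
      qed
      also have "K * (1 / (2 * K)) = 1/2" using K1 by simp
      also have "K * D * ((1 / (2 * K)) ^ n * (1/2) ^ k) \<le> K * D * ((1/2) ^ n * (1/2) ^ k)"
        using K1 D by (intro mult_left_mono mult_right_mono power_mono) (auto simp: field_simps)
      finally show "K ^ Suc k * N (h (n + k)) \<le> K * D * (1/2) ^ n * (1/2) ^ k" by (simp add: mult_ac)
    qed
    also have "\<dots> = K * D * (1/2) ^ n * (\<Sum>k<j. (1/2) ^ k)" by (simp add: sum_distrib_left)
    also have "\<dots> \<le> K * D * (1/2) ^ n * 2"
    proof (rule mult_left_mono)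
      have "(\<Sum>k<j. (1/2::real) ^ k) \<le> (\<Sum>k. (1/2) ^ k)" by (rule sum_le_suminf) (auto intro: summable_geometric)
      also have "\<dots> = 2" by (subst suminf_geometric) auto
      finally show "(\<Sum>k<j. (1/2::real) ^ k) \<le> 2" .
    qed (use K1 D in auto)
    finally show ?thesis by simp
  qed
  define S where "S = (\<lambda>n x. \<Sum>k<n. h k x)"
  have SX: "S n \<in> X" for n unfolding S_def by (rule quasi_sum(1)) (rule h)
  have diffS: "N (\<lambda>x. S m x - S n x) \<le> 2 * K * D * (1/2) ^ n" if "n \<le> m" for m n
  proof -
    have "S m x - S n x = (\<Sum>k<m - n. h (n + k) x)" for x
    proof -
      have "(\<Sum>k<n + j. h k x) = (\<Sum>k<n. h k x) + (\<Sum>k<j. h (n + k) x)" for j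
        by (induction j) (auto simp: add.assoc)
      from this[of "m - n"] show ?thesis using that by (simp add: S_def)
    qed
    then show ?thesis using tail[of n "m - n"] by simp
  qed
  have cauchy: "\<exists>M. \<forall>m\<ge>M. \<forall>n\<ge>M. N (\<lambda>x. S m x - S n x) < e" if e: "e > 0" for e
  proof -
    have "(\<lambda>n. 2 * K * D * (1/2) ^ n) \<longlonglongrightarrow> 2 * K * D * 0" by (intro tendsto_intros LIMSEQ_realpow_zero) auto
    then have "eventually (\<lambda>n. 2 * K * D * (1/2) ^ n < e) sequentially" using e by (intro order_tendstoD(2)) auto
    then obtain M where M: "\<And>n. n \<ge> M \<Longrightarrow> 2 * K * D * (1/2) ^ n < e" by (auto simp: eventually_sequentially)
    have "N (\<lambda>x. S m x - S n x) < e" if "m \<ge> M" "n \<ge> M" for m n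
    proof (cases "n \<le> m")
      case True
      then show ?thesis using diffS[of n m] M[OF that(2)] by linarith
    next
      case False
      have "N (\<lambda>x. S m x - S n x) = N (\<lambda>x. S n x - S m x)"
        using N_uminus[OF diff[OF SX[of n] SX[of m]]] by simp
      then show ?thesis using diffS[of m n] M[OF that(1)] False by simp
    qed
    then show ?thesis by blast
  qed
  have SB: "N (S n) \<le> 2 * K * D" for n using tail[of 0 n] by (simp add: S_def)
  show ?thesis
    using increasing_Cauchy_dominated[of S, OF SX _ cauchy SB] h(2) by (simp add: S_def)
qed

end

context bounded_fun
begin

lemma dil_dec_rearr_antimono:
  assumes "a > 0" "0 < x" "x \<le> y"
  shows "dil a (dec_rearr f) y \<le> dil a (dec_rearr f) x"
  unfolding dil_def using assms by (intro dec_rearr_antimono) auto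

end

locale ri_boyd = ri +
  fixes p q c :: real
  assumes p: "p > 1" and q: "q > 0" and c: "c \<ge> 1"
    and low: "\<And>a f. 0 < a \<Longrightarrow> a < 1 \<Longrightarrow> f \<in> X \<Longrightarrow> dil a f \<in> X \<and> N (dil a f) \<le> c * a powr (-1/p) * N f"
    and up: "\<And>a f. 1 < a \<Longrightarrow> f \<in> X \<Longrightarrow> dil a f \<in> X \<and> N (dil a f) \<le> c * a powr (-1/q) * N f"
begin

text \<open>A large ratio lets the decay of the dilation norms beat the growth \<open>K\<^sup>n\<close> of the constants in the
  quasi-triangle inequality.\<close>

lemma exists_ratio: "\<exists>r\<ge>2. r powr (-1/q) \<le> 1 / (4 * K) \<and> r powr (-1/p) \<ge> 4 * K / r"
proof -
  \<comment> \<open>Both decay exponents are at least \<open>s\<close>, so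
    \<open>r powr s \<ge> 4 * K\<close> settles both inequalities. Taking \<open>4 * K\<close> in
    place of \<open>2 * K\<close> reserves a factor \<open>2 ^ n\<close> for the weight
    \<open>n + 1\<close>.\<close>
  define s where "s = min (1/q) (1 - 1/p)"
  have s: "s > 0" using p q by (simp add: s_def)
  define r where "r = max 2 ((4 * K) powr (1 / s))"
  have r: "r \<ge> 2" by (simp add: r_def)
  have "4 * K = ((4 * K) powr (1 / s)) powr s" using s K1 by (simp add: powr_powr)
  also have "\<dots> \<le> r powr s" using s by (intro powr_mono2) (auto simp: r_def)
  finally have rs: "4 * K \<le> r powr s" .
  have "r powr (-1/q) = 1 / r powr (1/q)" using r by (simp add: powr_minus_divide)
  also have "\<dots> \<le> 1 / (4 * K)"
  proof (rule divide_left_mono)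
    have "r powr s \<le> r powr (1/q)" using r by (intro powr_mono) (auto simp: s_def)
    then show "4 * K \<le> r powr (1/q)" using rs by linarith
  qed (use K1 r in auto)
  finally have 1: "r powr (-1/q) \<le> 1 / (4 * K)" .
  have "r powr s \<le> r powr (1 - 1/p)" using r by (intro powr_mono) (auto simp: s_def)
  then have "4 * K \<le> r powr (1 - 1/p)" using rs by linarith
  also have "\<dots> = r * r powr (-1/p)" using r by (simp add: powr_diff powr_minus_divide)
  finally have "4 * K / r \<le> r powr (-1/p)" using r by (simp add: pos_divide_le_eq mult.commute)
  then show ?thesis using 1 r by blast
qed

lemma dil_power_bounds:
  assumes r: "r \<ge> 2" "r powr (-1/q) \<le> 1 / (4 * K)" "r powr (-1/p) \<ge> 4 * K / r" and f: "f \<in> X"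
  shows "dil (r ^ n) f \<in> X" "N (dil (r ^ n) f) \<le> c * (1 / (4 * K)) ^ n * N f"
    "dil (1 / r ^ n) f \<in> X" "N (dil (1 / r ^ n) f) / r ^ n \<le> c * (1 / (4 * K)) ^ n * N f"
proof -
  have N0: "N f \<ge> 0" by (rule N_nonneg[OF f])
  have r0: "r > 0" using r by simp
  have "dil (r ^ n) f \<in> X \<and> N (dil (r ^ n) f) \<le> c * (1 / (4 * K)) ^ n * N f \<and> 
    dil (1 / r ^ n) f \<in> X \<and> N (dil (1 / r ^ n) f) / r ^ n \<le> c * (1 / (4 * K)) ^ n * N f"
  proof (cases "n = 0")
    \<comment> \<open>The dilation hypotheses exclude the scale 1, where \<open>c \<ge> 1\<close>
      gives the bound.\<close>
    case True
    have "dil 1 f = f" by (simp add: dil_def fun_eq_iff)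
    moreover have "1 * N f \<le> c * N f" using c N0 by (intro mult_right_mono)
    ultimately show ?thesis using True f by simp
  next
    case False
    have rn: "1 < r ^ n" using r False by (intro one_less_power) auto
    have "(r ^ n) powr (-1/q) = (r powr (-1/q)) ^ n" using r by (simp add: powr_realpow[symmetric] powr_powr mult.commute)
    also have "\<dots> \<le> (1 / (4 * K)) ^ n" using r by (intro power_mono) auto
    finally have a: "(r ^ n) powr (-1/q) \<le> (1 / (4 * K)) ^ n" .
    have "(1 / r ^ n) powr (-1/p) = 1 / (r ^ n) powr (-1/p)" using r by (subst powr_divide) auto
    also have "(r ^ n) powr (-1/p) = (r powr (-1/p)) ^ n" using r by (simp add: powr_realpow[symmetric] powr_powr mult.commute)
    also have "1 / (r powr (-1/p)) ^ n \<le> 1 / (4 * K / r) ^ n"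
      using r K1 by (intro divide_left_mono power_mono) auto
    also have "\<dots> = (1 / (4 * K)) ^ n * r ^ n" by (simp add: power_divide power_mult_distrib)
    finally have b: "(1 / r ^ n) powr (-1/p) / r ^ n \<le> (1 / (4 * K)) ^ n" using r0 by (simp add: pos_divide_le_eq)
    have U: "dil (r ^ n) f \<in> X" "N (dil (r ^ n) f) \<le> c * (r ^ n) powr (-1/q) * N f" using up[OF rn f] by auto
    have L: "dil (1 / r ^ n) f \<in> X" "N (dil (1 / r ^ n) f) \<le> c * (1 / r ^ n) powr (-1/p) * N f" using low[OF _ _ f, of "1 / r ^ n"] rn by auto
    have "c * (r ^ n) powr (-1/q) * N f \<le> c * (1 / (4 * K)) ^ n * N f"
      using a c N0 by (intro mult_right_mono mult_left_mono) auto
    moreover have "N (dil (1 / r ^ n) f) / r ^ n \<le> c * ((1 / r ^ n) powr (-1/p) / r ^ n) * N f"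
      using divide_right_mono[OF L(2), of "r ^ n"] r0 by simp
    moreover have "c * ((1 / r ^ n) powr (-1/p) / r ^ n) * N f \<le> c * (1 / (4 * K)) ^ n * N f"
      using b c N0 by (intro mult_right_mono mult_left_mono) auto
    ultimately show ?thesis using U L by linarith
  qed
  then show "dil (r ^ n) f \<in> X" "N (dil (r ^ n) f) \<le> c * (1 / (4 * K)) ^ n * N f"
    "dil (1 / r ^ n) f \<in> X" "N (dil (1 / r ^ n) f) / r ^ n \<le> c * (1 / (4 * K)) ^ n * N f" by auto
qed

lemma hilbert_bounded_Borel:
  "\<exists>D. \<forall>f B. f \<in> borel_measurable borel \<longrightarrow> (\<forall>x. \<bar>f x\<bar> \<le> B) \<longrightarrow> emeasure lborel {x. f x \<noteq> 0} < \<infinity> \<longrightarrow>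
     hilbert f \<in> X \<and> N (hilbert f) \<le> D * N f"
proof -
  obtain r where r: "r \<ge> 2" "r powr (-1/q) \<le> 1 / (4 * K)" "r powr (-1/p) \<ge> 4 * K / r" using exists_ratio by blast
  have r0: "r > 0" using r by simp
  define \<alpha> where "\<alpha> = 4 + ln r"
  have \<alpha>: "\<alpha> > 0" using r by (simp add: \<alpha>_def add_pos_nonneg)
  \<comment> \<open>Collects one quasi-triangle constant, the factor 2 of the set estimate, the
    dilation constant and the weights of the two thresholds.\<close>
  define E where "E = 2 * K * c * (\<alpha> + 2 * r * \<alpha>)"
  have E: "E \<ge> 0" using K1 c \<alpha> r0 by (simp add: E_def)
  have main: "hilbert f \<in> X \<and> N (hilbert f) \<le> K * (2 * K * E) * N f"
    if fm: "f \<in> borel_measurable borel" and B: "\<And>x. \<bar>f x\<bar> \<le> B" and fs: "emeasure lborel {x. f x \<noteq> 0} < \<infinity>" for f B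
  proof -
    have fl: "f \<in> borel_measurable lebesgue" using fm by (intro measurable_completion) simp
    interpret bounded_fun f B using fl B by unfold_locales
    have fX: "f \<in> X"
    proof (rule bounded_finite_support_in_X[OF fl B])
      show "emeasure lebesgue {x. f x \<noteq> 0} < \<infinity>" using fs fm by simp
    qed
    have fi: "integrable lborel f" by (rule integrable_bounded_finite_support[OF fm B fs])
    define F where "F = dec_rearr f"
    have Fm: "F \<in> borel_measurable lebesgue" unfolding F_def using dec_rearr_borel by (intro measurable_completion) simp
    have FX: "F \<in> X" "N F \<le> N f"
      unfolding F_def by (rule measure_lattice[OF fX Fm[unfolded F_def]], simp only: emeasure_dec_rearr order_refl)+
    \<comment> \<open>At a set of measure \<open>m\<close> the bound for the integral of the Hilbert
      transform is \<open>m\<close> times the sum of the \<open>h n m\<close>. Hence the sum of the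
      \<open>h n\<close> is the candidate majorant of the rearrangement.\<close>
    define h where "h = (\<lambda>n x. 2 * \<alpha> * dil (r ^ n) F x + 2 * step_weight r n * dil (1 / r ^ n) F x)"
    note db = dil_power_bounds[OF r FX(1)]
    have w0: "step_weight r n \<ge> 0" for n unfolding step_weight_def using r0 \<alpha> by (simp add: \<alpha>_def)
    have hX: "h n \<in> X" for n unfolding h_def by (intro add scale db)
    have h0: "h n x \<ge> 0" for n x
      unfolding h_def using \<alpha> w0 dec_rearr_nonneg by (intro add_nonneg_nonneg mult_nonneg_nonneg) (auto simp: dil_def F_def)
    have hN: "N (h n) \<le> E * N f * (1 / (2 * K)) ^ n" for n
    proof -
      have "N (h n) \<le> K * (N (\<lambda>x. 2 * \<alpha> * dil (r ^ n) F x) + N (\<lambda>x. 2 * step_weight r n * dil (1 / r ^ n) F x))"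
        unfolding h_def by (intro quasi scale db)
      also have "\<dots> = K * (2 * \<alpha> * N (dil (r ^ n) F) + 2 * step_weight r n * N (dil (1 / r ^ n) F))"
        using N_scale[OF db(1), of "2 * \<alpha>"] N_scale[OF db(3), of "2 * step_weight r n"] \<alpha> w0[of n] by simp
      also have "2 * step_weight r n * N (dil (1 / r ^ n) F) = 2 * (2 * r * \<alpha> * (real n + 1)) * (N (dil (1 / r ^ n) F) / r ^ n)"
        by (simp add: step_weight_def \<alpha>_def)
      also have "K * (2 * \<alpha> * N (dil (r ^ n) F) + 2 * (2 * r * \<alpha> * (real n + 1)) * (N (dil (1 / r ^ n) F) / r ^ n))
         \<le> K * (2 * (\<alpha> * 2 ^ n) * (c * (1 / (4 * K)) ^ n * N f) + 2 * (2 * r * \<alpha> * 2 ^ n) * (c * (1 / (4 * K)) ^ n * N f))"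
      proof -
        have Ff: "c * (1 / (4 * K)) ^ n * N F \<le> c * (1 / (4 * K)) ^ n * N f"
          using FX(2) c K1 by (intro mult_left_mono) auto
        \<comment> \<open>The reserve kept in \<open>exists_ratio\<close> is spent here: the ratio
          \<open>1 / (4 * K)\<close> becomes the \<open>1 / (2 * K)\<close> that
          \<open>series_dominated\<close> asks for.\<close>
        have n2: "real n + 1 \<le> 2 ^ n"
        proof -
          have "n < 2 ^ n" by (rule less_exp)
          then have "real (Suc n) \<le> real (2 ^ n)" by (intro of_nat_mono Suc_leI)
          then show ?thesis by simp
        qed
        have a1: "\<alpha> * 1 \<le> \<alpha> * 2 ^ n" using \<alpha> by (intro mult_left_mono) auto
        show ?thesis
          using order_trans[OF db(2)[of n] Ff] order_trans[OF db(4)[of n] Ff] a1 n2 \<alpha> r0 K1 N_nonneg[OF db(1)[of n]] N_nonneg[OF db(3)[of n]]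
          by (intro mult_left_mono add_mono mult_mono) auto
      qed
      also have "\<dots> = E * N f * (2 * (1 / (4 * K))) ^ n"
      proof -
        have "K * (2 * (\<alpha> * 2 ^ n) * (c * w ^ n * N f) + 2 * (2 * r * \<alpha> * 2 ^ n) * (c * w ^ n * N f)) = E * N f * (2 * w) ^ n" for w
          by (simp add: E_def power_mult_distrib algebra_simps)
        then show ?thesis .
      qed
      also have "2 * (1 / (4 * K)) = 1 / (2 * K)" by simp
      finally show ?thesis .
    qed
    have EN: "E * N f \<ge> 0" using E N_nonneg[OF fX] by simp
    obtain \<phi> where \<phi>: "\<phi> \<in> X" "N \<phi> \<le> K * (2 * K * (E * N f))" "\<And>n. AE x in lebesgue. (\<Sum>k<n. h k x) \<le> \<phi> x"
      using series_dominated[OF hX h0 EN hN] by blast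
    have \<phi>m [measurable]: "\<phi> \<in> borel_measurable lebesgue" using \<phi>(1) by (rule X_meas)
    have Hm [measurable]: "hilbert f \<in> borel_measurable lebesgue" by (rule borel_measurable_hilbert(1)[OF fi B])
    have "rearr (hilbert f) s \<le> rearr \<phi> s" if s: "s \<ge> 0" for s
    proof (rule dense_le)
      fix b assume b: "b < rearr (hilbert f) s"
      show "b \<le> rearr \<phi> s"
      proof (cases "b < 0")
        case True
        then show ?thesis using rearr_nonneg[of \<phi> s] by (auto intro: order_trans less_imp_le)
      next
        case False
        then obtain t' where t': "b = ereal t'" "t' \<ge> 0" using b by (cases b) auto
        \<comment> \<open>The gap between \<open>t'\<close> and \<open>t\<close> pays for replacing
          the infinite series by a partial sum later on.\<close>
        obtain z where "b < ereal z" "ereal z < rearr (hilbert f) s" using ereal_dense2[OF b] by auto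
        then obtain t where t: "t' < t" "ereal t < rearr (hilbert f) s" using t' by auto
        \<comment> \<open>Intersecting with bounded intervals makes the measure \<open>m\<close> of
          the superlevel set finite, yet still larger than \<open>s\<close>.\<close>
        define A where "A = (\<lambda>R::nat. {x. t < \<bar>hilbert f x\<bar>} \<inter> {-real R..real R})"
        have Hs: "{x. t < \<bar>hilbert f x\<bar>} \<in> sets lebesgue"
        proof -
          have "{x \<in> space lebesgue. t < \<bar>hilbert f x\<bar>} \<in> sets lebesgue" by measurable
          then show ?thesis by simp
        qed
        have Am: "A R \<in> sets lebesgue" for R unfolding A_def using Hs by auto
        have "(SUP R. emeasure lebesgue (A R)) = emeasure lebesgue (\<Union>R. A R)"
          using Am by (intro SUP_emeasure_incseq) (auto simp: A_def incseq_def)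
        also have "(\<Union>R. A R) = {x. t < \<bar>hilbert f x\<bar>}"
        proof safe
          fix x assume "t < \<bar>hilbert f x\<bar>"
          moreover obtain R where "\<bar>x\<bar> \<le> real R" using real_arch_simple by blast
          ultimately have "x \<in> A R" by (auto simp: A_def)
          then show "x \<in> (\<Union>R. A R)" by blast
        qed (auto simp: A_def)
        finally have "ennreal s < (SUP R. emeasure lebesgue (A R))" using t(2) less_rearr_iff[OF Hm] by simp
        then obtain R where R: "ennreal s < emeasure lebesgue (A R)" by (auto simp: less_SUP_iff)
        have "emeasure lebesgue (A R) \<le> emeasure lebesgue {-real R..real R}" by (intro emeasure_mono) (auto simp: A_def)
        then have "emeasure lebesgue (A R) < \<infinity>" by (rule le_less_trans) simp
        then obtain m where m: "emeasure lebesgue (A R) = ennreal m" "m \<ge> 0" by (cases "emeasure lebesgue (A R)") auto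
        have sm: "s < m" using R s m by (simp add: ennreal_less_iff)
        then have m0: "m > 0" using s by simp
        \<comment> \<open>A Borel subset of full measure, because the set estimates are stated for
          Borel sets.\<close>
        define A' where "A' = main_part lborel (A R)"
        have A'b: "A' \<in> sets borel" using Am[of R] unfolding A'_def by (metis main_part_sets sets_lborel)
        have A'm: "emeasure lborel A' = ennreal m" unfolding A'_def using m Am[of R] by simp
        have A'A: "A' \<subseteq> A R" unfolding A'_def using main_part_null_part_Un[OF Am[of R]] by blast
        have lb: "ennreal (t * m) \<le> (\<integral>\<^sup>+x\<in>A'. ennreal \<bar>hilbert f x\<bar> \<partial>lebesgue)"
        proof -
          have "ennreal (t * m) = ennreal t * emeasure lebesgue A'" using A'm A'b t(1) t'(2) m by (simp add: ennreal_mult)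
          also have "\<dots> = (\<integral>\<^sup>+x. ennreal t * indicator A' x \<partial>lebesgue)" using A'b by (subst nn_integral_cmult_indicator) auto
          also have "\<dots> \<le> (\<integral>\<^sup>+x\<in>A'. ennreal \<bar>hilbert f x\<bar> \<partial>lebesgue)"
            using A'A by (intro nn_integral_mono) (auto simp: indicator_def A_def intro!: ennreal_leI)
          finally show ?thesis .
        qed
        also have "\<dots> \<le> 2 * (\<Sum>n. ennreal (m * (4 + ln r)) * ennreal (dec_rearr f (r ^ n * m)) + ennreal (m * step_weight r n) * ennreal (dec_rearr f (m / r ^ n)))"
          by (rule set_nn_integral_hilbert_le[OF r(1) fm B fs A'b _ m0]) (simp add: A'm)
        also have "\<dots> = (\<Sum>n. 2 * (ennreal (m * (4 + ln r)) * ennreal (dec_rearr f (r ^ n * m)) + ennreal (m * step_weight r n) * ennreal (dec_rearr f (m / r ^ n))))"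
          by (rule ennreal_suminf_cmult[symmetric])
        also have "\<dots> = (\<Sum>n. ennreal m * ennreal (h n m))"
        proof (rule suminf_cong)
          fix n
          have "2 * (ennreal (m * (4 + ln r)) * ennreal (dec_rearr f (r ^ n * m)) + ennreal (m * step_weight r n) * ennreal (dec_rearr f (m / r ^ n)))
            = ennreal 2 * (ennreal (m * (4 + ln r) * dec_rearr f (r ^ n * m)) + ennreal (m * step_weight r n * dec_rearr f (m / r ^ n)))"
            using m0 \<alpha> w0[of n] dec_rearr_nonneg by (simp add: ennreal_mult \<alpha>_def)
          also have "\<dots> = ennreal (2 * (m * (4 + ln r) * dec_rearr f (r ^ n * m) + m * step_weight r n * dec_rearr f (m / r ^ n)))"
            using m0 \<alpha> w0[of n] dec_rearr_nonneg by (subst ennreal_plus[symmetric]) (auto simp: ennreal_mult \<alpha>_def)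
          also have "2 * (m * (4 + ln r) * dec_rearr f (r ^ n * m) + m * step_weight r n * dec_rearr f (m / r ^ n)) = m * h n m"
            by (simp add: h_def dil_def F_def \<alpha>_def algebra_simps)
          finally show "2 * (ennreal (m * (4 + ln r)) * ennreal (dec_rearr f (r ^ n * m)) + ennreal (m * step_weight r n) * ennreal (dec_rearr f (m / r ^ n))) = ennreal m * ennreal (h n m)"
            using m0 h0 by (simp add: ennreal_mult)
        qed
        also have "\<dots> = ennreal m * (\<Sum>n. ennreal (h n m))" by (rule ennreal_suminf_cmult)
        finally have "ennreal m * ennreal t \<le> ennreal m * (\<Sum>n. ennreal (h n m))"
          using m0 t t' by (simp add: ennreal_mult mult.commute)
        then have "ennreal t \<le> (\<Sum>n. ennreal (h n m))" using m0 by (simp add: ennreal_mult_le_mult_iff)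
        moreover have "ennreal t' < ennreal t" using t t' by (simp add: ennreal_lessI)
        ultimately have "ennreal t' < (SUP n. \<Sum>k<n. ennreal (h k m))" by (simp add: suminf_eq_SUP)
        then obtain n where "ennreal t' < (\<Sum>k<n. ennreal (h k m))" by (auto simp: less_SUP_iff)
        then have n: "t' < (\<Sum>k<n. h k m)" using h0 t'(2) by (simp add: sum_ennreal ennreal_less_iff)
        \<comment> \<open>The partial sum exceeds \<open>t'\<close> at the point \<open>m\<close>
          and is decreasing, so it does so on all of \<open>{0<..m}\<close>, and almost everywhere
          there \<open>\<phi>\<close> exceeds \<open>t'\<close> too. This interval has measure
          \<open>m > s\<close>.\<close>
        have hmono: "h k m \<le> h k x" if "0 < x" "x \<le> m" for k x
          unfolding h_def F_def using that r0 \<alpha> w0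
          by (intro add_mono mult_left_mono dil_dec_rearr_antimono) auto
        have "AE x in lebesgue. x \<in> {0<..m} \<longrightarrow> x \<in> {x. t' < \<bar>\<phi> x\<bar>}"
          using \<phi>(3)[of n]
        proof eventually_elim
          case (elim x)
          show ?case
          proof
            assume "x \<in> {0<..m}"
            then have "(\<Sum>k<n. h k m) \<le> (\<Sum>k<n. h k x)" by (intro sum_mono hmono) auto
            then show "x \<in> {x. t' < \<bar>\<phi> x\<bar>}" using n elim by auto
          qed
        qed
        then have "emeasure lebesgue {0<..m} \<le> distr_fun \<phi> t'"
        proof (rule emeasure_mono_AE)
          show "{x. t' < \<bar>\<phi> x\<bar>} \<in> sets lebesgue" by (rule sets_lebesgue_Collect) measurable
        qed
        moreover have "ennreal s < emeasure lebesgue {0<..m}" using sm s m0 by (simp add: ennreal_lessI)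
        ultimately have "ereal t' < rearr \<phi> s" using less_rearr_iff[OF \<phi>m, of t' s] by (simp add: less_le_trans)
        then show ?thesis using t' by simp
      qed
    qed
    then have "hilbert f \<in> X" "N (hilbert f) \<le> N \<phi>" using lattice[OF \<phi>(1) Hm] N_lattice[OF \<phi>(1) Hm] by auto
    then show ?thesis using \<phi>(2) by (simp add: mult.assoc)
  qed
  then show ?thesis by (intro exI[of _ "K * (2 * K * E)"]) blast
qed

text \<open>A Lebesgue measurable function is replaced by a Borel function equal to it almost
  everywhere, which has the same Hilbert transform. The constant is made nonnegative since the sign
  of \<open>D\<close> is unknown.\<close>

lemma hilbert_bounded_on: "hilbert_bounded_on X N"
proof -
  obtain D where D: "\<And>f B. f \<in> borel_measurable borel \<Longrightarrow> (\<And>x. \<bar>f x\<bar> \<le> B) \<Longrightarrow> emeasure lborel {x. f x \<noteq> 0} < \<infinity> \<Longrightarrow>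
     hilbert f \<in> X \<and> N (hilbert f) \<le> D * N f" using hilbert_bounded_Borel by metis
  have "hilbert f \<in> X \<and> N (hilbert f) \<le> max D 0 * N f"
    if f: "f \<in> borel_measurable lebesgue" "bounded (range f)" "emeasure lebesgue {x. f x \<noteq> 0} < \<infinity>" for f
  proof -
    obtain B where B: "\<And>x. \<bar>f x\<bar> \<le> B" using f(2) by (auto simp: bounded_iff)
    have B0: "B \<ge> 0" using B[of 0] by linarith
    have fX: "f \<in> X" using f B by (intro bounded_finite_support_in_X) auto
    obtain g0 where g0: "g0 \<in> borel_measurable lborel" "AE x in lborel. f x = g0 x"
      using completion_ex_borel_measurable_real[OF f(1)] by blast
    \<comment> \<open>The cut makes the bound \<open>B\<close> valid everywhere while changing
      \<open>g0\<close> only on a null set.\<close>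
    define g where "g = (\<lambda>x. if \<bar>g0 x\<bar> \<le> B then g0 x else 0)"
    have gm: "g \<in> borel_measurable borel" using g0(1) unfolding g_def by simp
    have gl: "g \<in> borel_measurable lebesgue" using gm by (intro measurable_completion) simp
    have "AE x in lborel. f x = g x" using g0(2) 
    proof eventually_elim
      case (elim x)
      then show ?case using B[of x] by (simp add: g_def)
    qed
    then have ae: "AE x in lebesgue. f x = g x" by (rule AE_completion)
    have sm: "{x. h x \<noteq> 0} \<in> sets lebesgue" if "h \<in> borel_measurable lebesgue" for h :: "real \<Rightarrow> real"
    proof -
      have "{x \<in> space lebesgue. h x \<noteq> 0} \<in> sets lebesgue" using that by measurable
      then show ?thesis by simp
    qed
    have "emeasure lebesgue {x. g x \<noteq> 0} = emeasure lebesgue {x. f x \<noteq> 0}"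
      using ae sm[OF f(1)] sm[OF gl] by (intro emeasure_eq_AE) (auto elim!: eventually_mono)
    then have "emeasure lborel {x. g x \<noteq> 0} < \<infinity>" using f(3) gm by simp
    then have Hg: "hilbert g \<in> X" "N (hilbert g) \<le> D * N g" using D[OF gm, of B] B0 by (auto simp: g_def)
    have "AE x in lebesgue. \<bar>g x\<bar> \<le> \<bar>f x\<bar>" using ae by eventually_elim simp
    from AE_lattice[OF fX gl this] have gX: "g \<in> X" "N g \<le> N f" .
    have "D * N g \<le> max D 0 * N f" using gX N_nonneg[OF gX(1)] by (intro mult_mono) auto
    then show ?thesis using Hg hilbert_cong_AE[OF f(1) gl ae] by simp
  qed
  then show ?thesis unfolding hilbert_bounded_on_def by blast
qed

end

lemma boyd_lower_gt_1D:
  assumes "boyd_lower X N > 1"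
  shows "\<exists>p c. p > 1 \<and> (\<forall>a. 0 < a \<and> a < 1 \<longrightarrow> (\<forall>f\<in>X. dil a f \<in> X \<and> N (dil a f) \<le> c * a powr (-1/p) * N f))"
proof -
  obtain y where y: "1 < y" "y \<in> {ereal p | p. 0 < p \<and> (\<exists>c. \<forall>a. 0 < a \<and> a < 1 \<longrightarrow>
        (\<forall>f\<in>X. dil a f \<in> X \<and> N (dil a f) \<le> c * a powr (-1/p) * N f))}"
    using assms unfolding boyd_lower_def less_Sup_iff by (elim bexE)
  from y(2) obtain p c where pc: "y = ereal p" "\<forall>a. 0 < a \<and> a < 1 \<longrightarrow>
        (\<forall>f\<in>X. dil a f \<in> X \<and> N (dil a f) \<le> c * a powr (-1/p) * N f)"
    unfolding mem_Collect_eq by (elim exE conjE)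
  from y(1) pc(1) have "p > 1" by (simp add: one_ereal_def)
  with pc(2) show ?thesis by (intro exI conjI)
qed

lemma boyd_upper_finiteD:
  assumes "boyd_upper X N < \<infinity>"
  shows "\<exists>q c. q > 0 \<and> (\<forall>a. 1 < a \<longrightarrow> (\<forall>f\<in>X. dil a f \<in> X \<and> N (dil a f) \<le> c * a powr (-1/q) * N f))"
proof -
  obtain y where y: "y \<in> {ereal q | q. 0 < q \<and> (\<exists>c. \<forall>a. 1 < a \<longrightarrow>
        (\<forall>f\<in>X. dil a f \<in> X \<and> N (dil a f) \<le> c * a powr (-1/q) * N f))}"
    using assms unfolding boyd_upper_def Inf_less_iff by (elim bexE)
  then show ?thesis unfolding mem_Collect_eq by (elim exE conjE) (intro exI conjI)
qed

theorem theorem4: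
  fixes X :: "(real \<Rightarrow> real) set" and N :: "(real \<Rightarrow> real) \<Rightarrow> real"
  assumes "ri_space X N"
  shows "hilbert_bounded_on X N \<longleftrightarrow> boyd_lower X N > 1 \<and> boyd_upper X N < \<infinity>"
proof -
  have "\<exists>K\<ge>1. \<forall>f\<in>X. \<forall>g\<in>X. (\<lambda>x. f x + g x) \<in> X \<and> N (\<lambda>x. f x + g x) \<le> K * (N f + N g)"
    using assms unfolding ri_space_def by (elim conjE)
  then obtain K where K: "K \<ge> 1" "\<And>f g. f \<in> X \<Longrightarrow> g \<in> X \<Longrightarrow> N (\<lambda>x. f x + g x) \<le> K * (N f + N g)" by blast
  interpret ri X N K using assms K by unfold_locales
  show ?thesis
  proof
    assume "hilbert_bounded_on X N"
    then obtain C where C: "\<And>f. f \<in> borel_measurable lebesgue \<Longrightarrow> bounded (range f) \<Longrightarrow>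
        emeasure lebesgue {x. f x \<noteq> 0} < \<infinity> \<Longrightarrow> hilbert f \<in> X \<and> N (hilbert f) \<le> C * N f"
      unfolding hilbert_bounded_on_def by blast
    \<comment> \<open>Enlarging the constant is permitted because \<open>N f\<close> is nonnegative
      for the functions in question, which belong to \<open>X\<close>.\<close>
    interpret ri_hilbert X N K "max 1 C"
    proof unfold_locales
      fix f :: "real \<Rightarrow> real" assume f: "f \<in> borel_measurable lebesgue" "bounded (range f)" "emeasure lebesgue {x. f x \<noteq> 0} < \<infinity>"
      obtain B where "\<And>x. \<bar>f x\<bar> \<le> B" using f(2) by (auto simp: bounded_iff)
      then have "f \<in> X" using f by (intro bounded_finite_support_in_X) auto
      then have "C * N f \<le> max 1 C * N f" using N_nonneg by (intro mult_right_mono) auto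
      then show "hilbert f \<in> X \<and> N (hilbert f) \<le> max 1 C * N f" using C[OF f] by linarith
    qed simp
    show "boyd_lower X N > 1 \<and> boyd_upper X N < \<infinity>" using boyd_lower_gt_1 boyd_upper_finite by simp
  next
    assume *: "boyd_lower X N > 1 \<and> boyd_upper X N < \<infinity>"
    from boyd_lower_gt_1D[OF *[THEN conjunct1]] obtain p c where p: "p > 1"
      "\<forall>a. 0 < a \<and> a < 1 \<longrightarrow> (\<forall>f\<in>X. dil a f \<in> X \<and> N (dil a f) \<le> c * a powr (-1/p) * N f)"
      by (elim exE conjE)
    from boyd_upper_finiteD[OF *[THEN conjunct2]] obtain q d where q: "q > 0"
      "\<forall>a. 1 < a \<longrightarrow> (\<forall>f\<in>X. dil a f \<in> X \<and> N (dil a f) \<le> d * a powr (-1/q) * N f)"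
      by (elim exE conjE)
    define e where "e = max 1 (max c d)"
    have e: "c \<le> e" "d \<le> e" "1 \<le> e" by (auto simp: e_def)
    have mono: "b * a powr s * N f \<le> e * a powr s * N f" if "b \<le> e" "f \<in> X" for a b s f
      using that N_nonneg by (intro mult_right_mono) auto
    interpret ri_boyd X N K p q e
    proof unfold_locales
      fix a f assume f: "f \<in> X"
      show "dil a f \<in> X \<and> N (dil a f) \<le> e * a powr (- 1 / p) * N f" if "0 < a" "a < 1"
        using p(2) that f order_trans[OF _ mono[OF e(1) f]] by blast
      show "dil a f \<in> X \<and> N (dil a f) \<le> e * a powr (- 1 / q) * N f" if "1 < a"
        using q(2) that f order_trans[OF _ mono[OF e(2) f]] by blast
    qed (use p q e in auto)
    show "hilbert_bounded_on X N" by (rule hilbert_bounded_on)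
  qed
qed

end
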